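(* Let $q$ be a power of an odd prime $p$ and let $\mathbf{A} = \mathbb{F}_q[T]$. For every integer $n \ge 2$, $\mathrm{SL}_n(\mathbf{A})$ is a polynomial family over $\mathbf{A}$ with $45 + n(3n+1)/2$ parameters.
   Context: $\mathbb{F}_q$ is the finite field with $q$ elements and $T$ is an indeterminate. For a commutative ring $R$ with identity, a subset $X \subseteq R^h$ is called a polynomial family over $R$ with $d$ parameters ($d$ a positive integer) if there exist polynomials $P_1, \ldots, P_h \in R[x_1, \ldots, x_d]$ such that $X = \{(P_1(t), \ldots, P_h(t)) : t \in R^d\}$. The set $\mathrm{SL}_n(\mathbf{A})$ is viewed as a subset of $\mathbf{A}^{n^2}$ via the matrix entries. *)

theory Defs
  imports
    "HOL-Library.Cardinality"
    "HOL-Library.Poly_Mapping"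
    "HOL-Computational_Algebra.Computational_Algebra"
    "Jordan_Normal_Form.Determinant"
begin

text \<open>A polynomial in the variables \<open>x\<^sub>0, x\<^sub>1, \<dots>\<close> is a finitely supported
  map from monomials to coefficients; a monomial is a finitely supported map from
  variable indices to exponents.\<close>

type_synonym 'r mpolynomial = "(nat \<Rightarrow>\<^sub>0 nat) \<Rightarrow>\<^sub>0 'r"

definition mpoly_vars :: "'r::comm_ring_1 mpolynomial \<Rightarrow> nat set" where
  "mpoly_vars P = (\<Union>m\<in>Poly_Mapping.keys P. Poly_Mapping.keys m)"

definition mpoly_eval :: "'r::comm_ring_1 mpolynomial \<Rightarrow> 'r vec \<Rightarrow> 'r" where
  "mpoly_eval P t =
     (\<Sum>m\<in>Poly_Mapping.keys P. Poly_Mapping.lookup P m *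
        (\<Prod>i\<in>Poly_Mapping.keys m. (t $ i) ^ Poly_Mapping.lookup m i))"

text \<open>The ring \<open>R\<close> is the whole type \<open>'r\<close>, and \<open>R\<^sup>h\<close> is \<^term>\<open>carrier_vec h\<close>.
  Indices start at \<open>0\<close>, so \<open>R[x\<^sub>1, \<dots>, x\<^sub>d]\<close> consists of the polynomials whose
  variable indices are below \<open>d\<close>.\<close>

definition polynomial_family :: "nat \<Rightarrow> nat \<Rightarrow> 'r::comm_ring_1 vec set \<Rightarrow> bool" where
  "polynomial_family h d X \<longleftrightarrow>
     d > 0 \<and>
     (\<exists>P :: nat \<Rightarrow> 'r mpolynomial.
        (\<forall>i<h. mpoly_vars (P i) \<subseteq> {..<d}) \<and>
        X = {vec h (\<lambda>i. mpoly_eval (P i) t) | t. t \<in> carrier_vec d})"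

definition special_linear :: "nat \<Rightarrow> 'r::comm_ring_1 mat set" where
  "special_linear n = {A \<in> carrier_mat n n. det A = 1}"

text \<open>The identification of \<open>n \<times> n\<close> matrices with \<open>R\<close>-vectors of length \<open>n\<^sup>2\<close>
  lists the entries row by row.\<close>

definition mat_entries :: "nat \<Rightarrow> 'r mat \<Rightarrow> 'r vec" where
  "mat_entries n A = vec (n\<^sup>2) (\<lambda>k. A $$ (k div n, k mod n))"

end

theory Submission
  imports Defs "HOL-Number_Theory.Cong"
begin

text \<open>Write \<open>A\<close> for the polynomial ring in \<open>T\<close> over the field with \<open>q\<close> elements.  The proof gives the
parametrization with \<open>11 + n (3 n + 1) / 2\<close> parameters, and a polynomial map in these is also a
polynomial map in more variables.

The core is \<open>SL\<^sub>2\<close>.  An element of \<open>SL\<^sub>2(A)\<close> is not a product of a bounded number of elementary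
matrices, so another source of polynomial matrices is needed.  For a matrix \<open>\<beta>\<close> of determinant \<open>1\<close>,
the product \<open>\<beta> \<beta>\<^sup>T\<close> equals \<open>\<beta> w \<beta>\<^sup>-\<^sup>1 w\<^sup>-\<^sup>1\<close> with \<open>w\<close> the rotation by a right angle, and \<open>w\<close> is a product
of three elementary matrices.  A conjugate of an elementary matrix is \<open>1 + r N\<close> where the nilpotent
matrix \<open>N\<close> is quadratic in one column of \<open>\<beta>\<close>, and \<open>1 + r N\<close> has determinant \<open>1\<close> even if \<open>\<beta>\<close> has not.
So \<open>\<beta> \<beta>\<^sup>T\<close> extends to a polynomial map into \<open>SL\<^sub>2\<close> on all matrices \<open>\<beta>\<close>.
If \<open>\<beta> = 1 + s M\<close>, then this map is \<open>1\<close> modulo \<open>s\<close> and may be conjugated by \<open>diag(s, 1)\<close> without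
introducing denominators.  The result is \<open>swindle\<close>: five free parameters give every matrix that is
needed to pass from \<open>((x, s\<^sup>2 b), (c, y))\<close> to \<open>((x, b), (s\<^sup>2 c, y))\<close>, for \<open>x\<close> and \<open>y\<close> congruent to \<open>1\<close>
modulo \<open>s\<close>.

Now let \<open>\<gamma> = ((v, k), (l, z))\<close> have determinant \<open>1\<close>.  Each power of \<open>\<gamma>\<close> has the form
\<open>\<gamma>\<^sup>m = f \<gamma> + g\<close>, and two swindles connect \<open>((x, k), (f\<^sup>2 l, y))\<close> to \<open>((x, f\<^sup>2 k), (l, y))\<close>, where
\<open>x = g + f v\<close> is \<open>v\<^sup>m\<close> modulo \<open>k\<close> and \<open>y = g + f z\<close> is \<open>z\<^sup>m\<close> modulo \<open>l\<close>.  If \<open>m\<close> is such that \<open>v\<^sup>m\<close> is a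
nonzero constant modulo \<open>k\<close> while \<open>z\<^sup>m\<close> is \<open>z\<close> modulo \<open>l\<close>, then the first matrix is a product of a few
elementary matrices and the second one is \<open>\<gamma>\<close> up to elementary matrices
(\<open>power_exchange_factorization\<close>).  This bounds the number of parameters although \<open>m\<close> is unbounded.

Such an \<open>m\<close> exists if \<open>k\<close> is irreducible of large prime degree \<open>n\<close>, compared with \<open>q\<close> and the degree of
\<open>l\<close>: modulo \<open>k\<close> the element \<open>v\<close> has order dividing \<open>(q\<^sup>n - 1) / (q - 1)\<close> up to constants, and this
number is coprime to the exponent of the unit group modulo \<open>l\<close>, which only involves \<open>q\<close> and the
numbers \<open>q\<^sup>i - 1\<close> with \<open>i < n\<close> (\<open>power_exchange_exponent\<close>).  An elementary column operation replaces
the entry \<open>k\<close> by any polynomial congruent to it modulo \<open>v\<close>, so what remains is the theorem of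
Kornblum: each reduced residue class contains irreducible polynomials of every large prime
degree (\<open>irreducible_in_residue_class\<close>).

For Kornblum's theorem, the series \<open>L(u, \<chi>)\<close> of a nonprincipal character is a polynomial in \<open>u\<close>, so the
sum of \<open>\<chi>\<close> over prime powers of degree \<open>n\<close>, weighted by the degree of the prime, is minus a sum
of \<open>n\<close>-th powers of complex numbers \<open>\<rho>\<close>.  It is to be shown that \<open>|\<rho>| < q\<close> for all of them.  The number of
prime powers in the class of \<open>1\<close> is nonnegative in every degree; choosing degrees \<open>n\<close> for which all
the \<open>\<rho>\<^sup>n\<close> are nearly positive shows that \<open>|\<rho>| \<ge> q\<close> happens for at most one \<open>\<rho>\<close> of one character.  By complex
conjugation that character is real and \<open>\<rho> = q\<close> or \<open>\<rho> = - q\<close>; this is impossible because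
\<open>L(\<plusminus> u, \<chi>) / (1 - q u)\<close> would be a polynomial, while its coefficients of even index are positive.

For larger \<open>n\<close>, the last row of a matrix in \<open>SL\<^sub>n(A)\<close> is unimodular.  Adding multiples of its last entry to two
of the others makes these unimodular among themselves, after which the row can be
cleared.  This reduces \<open>n\<close> by one at the price of \<open>3 n - 1\<close> parameters.\<close>

section \<open>Polynomial functions and polynomial families\<close>

text \<open>Parameters are assignments \<open>nat \<Rightarrow> 'r\<close>, of which only the values below \<open>d\<close> matter.  With this
encoding a block of parameters is used by shifting indices, and no vectors have to be split.\<close>

inductive polynomial_function :: "nat \<Rightarrow> ((nat \<Rightarrow> 'r::comm_ring_1) \<Rightarrow> 'r) \<Rightarrow> bool" for d where
  const: "polynomial_function d (\<lambda>_. c)"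
| var: "i < d \<Longrightarrow> polynomial_function d (\<lambda>x. x i)"
| add: "polynomial_function d f \<Longrightarrow> polynomial_function d g \<Longrightarrow> polynomial_function d (\<lambda>x. f x + g x)"
| mult: "polynomial_function d f \<Longrightarrow> polynomial_function d g \<Longrightarrow> polynomial_function d (\<lambda>x. f x * g x)"

lemma polynomial_function_uminus:
  "polynomial_function d f \<Longrightarrow> polynomial_function d (\<lambda>x. - f x)"
  using polynomial_function.mult[OF polynomial_function.const[of d "-1"], of f] by simp

lemma polynomial_function_diff:
  "polynomial_function d f \<Longrightarrow> polynomial_function d g \<Longrightarrow> polynomial_function d (\<lambda>x. f x - g x)"
  using polynomial_function.add[OF _ polynomial_function_uminus, of d f g] by simp

lemma polynomial_function_sum:
  "(\<And>i. i \<in> I \<Longrightarrow> polynomial_function d (f i)) \<Longrightarrow> polynomial_function d (\<lambda>x. \<Sum>i\<in>I. f i x)"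
  by (induction I rule: infinite_finite_induct) (auto intro: polynomial_function.intros)

lemmas polynomial_function_intros = polynomial_function.intros polynomial_function_uminus
  polynomial_function_diff polynomial_function_sum

lemma polynomial_function_shift:
  assumes "polynomial_function d f"
  shows "polynomial_function (k + d) (\<lambda>x. f (\<lambda>i. x (k + i)))"
  using assms by induction (auto intro: polynomial_function.intros)

lemma polynomial_function_cong:
  assumes "polynomial_function d f" "\<And>i. i < d \<Longrightarrow> x i = y i"
  shows "f x = f y"
  using assms by induction auto

lemma prod_keys_superset:
  fixes x :: "nat \<Rightarrow> 'r::comm_ring_1"
  assumes "finite S" "Poly_Mapping.keys m \<subseteq> S"
  shows "(\<Prod>i\<in>Poly_Mapping.keys m. x i ^ Poly_Mapping.lookup m i) =
    (\<Prod>i\<in>S. x i ^ Poly_Mapping.lookup m i)"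
  using assms by (intro prod.mono_neutral_left) (auto simp: in_keys_iff)

lemma prod_keys_add:
  fixes x :: "nat \<Rightarrow> 'r::comm_ring_1"
  shows "(\<Prod>i\<in>Poly_Mapping.keys (m + m'). x i ^ Poly_Mapping.lookup (m + m') i) =
    (\<Prod>i\<in>Poly_Mapping.keys m. x i ^ Poly_Mapping.lookup m i) *
    (\<Prod>i\<in>Poly_Mapping.keys m'. x i ^ Poly_Mapping.lookup m' i)"
proof -
  let ?S = "Poly_Mapping.keys m \<union> Poly_Mapping.keys m'"
  have S: "finite ?S" by simp
  have "(\<Prod>i\<in>Poly_Mapping.keys (m + m'). x i ^ Poly_Mapping.lookup (m + m') i) =
      (\<Prod>i\<in>?S. x i ^ Poly_Mapping.lookup (m + m') i)"
    by (rule prod_keys_superset[OF S Poly_Mapping.keys_add])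
  also have "\<dots> = (\<Prod>i\<in>?S. x i ^ Poly_Mapping.lookup m i) * (\<Prod>i\<in>?S. x i ^ Poly_Mapping.lookup m' i)"
    by (simp add: lookup_add power_add prod.distrib)
  finally show ?thesis
    using prod_keys_superset[OF S, of m x] prod_keys_superset[OF S, of m' x] by simp
qed

text \<open>Evaluation is a sum over the support, which changes under addition; over a common finite
superset of the supports it becomes additive.\<close>

lemma mpoly_eval_superset:
  assumes "finite S" "Poly_Mapping.keys P \<subseteq> S"
  shows "mpoly_eval P t = (\<Sum>m\<in>S. Poly_Mapping.lookup P m *
        (\<Prod>i\<in>Poly_Mapping.keys m. (t $ i) ^ Poly_Mapping.lookup m i))"
  unfolding mpoly_eval_def using assms by (intro sum.mono_neutral_left) (auto simp: in_keys_iff)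

lemma mpoly_eval_add: "mpoly_eval (P + Q) t = mpoly_eval P t + mpoly_eval Q t"
proof -
  let ?S = "Poly_Mapping.keys P \<union> Poly_Mapping.keys Q"
  have S: "finite ?S" by simp
  show ?thesis
    using mpoly_eval_superset[OF S, of P t] mpoly_eval_superset[OF S, of Q t]
    by (subst mpoly_eval_superset[OF S Poly_Mapping.keys_add])
       (simp add: lookup_add ring_distribs sum.distrib)
qed

lemma mpoly_eval_single:
  "mpoly_eval (Poly_Mapping.single m c) t =
    c * (\<Prod>i\<in>Poly_Mapping.keys m. (t $ i) ^ Poly_Mapping.lookup m i)"
  by (subst mpoly_eval_superset[of "{m}"]) auto

text \<open>Multiplication is known explicitly only on monomials, so bilinear identities are proved by
building both factors from single terms.\<close>

lemma poly_mapping_single_induct [case_names zero add]: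
  assumes "Q 0" "\<And>p k v. Q p \<Longrightarrow> Q (p + Poly_Mapping.single k v)"
  shows "Q (p :: 'a \<Rightarrow>\<^sub>0 'b::comm_monoid_add)"
proof (induction p rule: update_induct)
  case const
  then show ?case using assms(1) .
next
  case (update f a b)
  have "Poly_Mapping.update a b f = f + Poly_Mapping.single a b"
  proof (rule poly_mapping_eqI)
    fix k
    have "Poly_Mapping.lookup f a = 0" using update(1) by (simp add: in_keys_iff)
    then show "Poly_Mapping.lookup (Poly_Mapping.update a b f) k =
        Poly_Mapping.lookup (f + Poly_Mapping.single a b) k"
      by (cases "k = a") (simp_all add: lookup_update lookup_add lookup_single_eq lookup_single_not_eq)
  qed
  then show ?case using assms(2) update by metis
qed

lemma mpoly_eval_mult: "mpoly_eval (P * Q) t = mpoly_eval P t * mpoly_eval Q t"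
proof (induction P rule: poly_mapping_single_induct)
  case zero
  then show ?case by (simp add: mpoly_eval_def)
next
  case (add P m c)
  have "mpoly_eval (Poly_Mapping.single m c * Q) t = mpoly_eval (Poly_Mapping.single m c) t * mpoly_eval Q t"
  proof (induction Q rule: poly_mapping_single_induct)
    case zero
    then show ?case by (simp add: mpoly_eval_def)
  next
    case (add Q m' c')
    then show ?case
      by (simp add: ring_distribs mpoly_eval_add mult_single mpoly_eval_single prod_keys_add mult_ac)
  qed
  then show ?case using add by (simp add: ring_distribs mpoly_eval_add)
qed

lemma mpoly_vars_add: "mpoly_vars (P + Q) \<subseteq> mpoly_vars P \<union> mpoly_vars Q"
  using Poly_Mapping.keys_add[of P Q] by (fastforce simp: mpoly_vars_def)

lemma mpoly_vars_mult: "mpoly_vars (P * Q) \<subseteq> mpoly_vars P \<union> mpoly_vars Q"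
proof
  fix i assume "i \<in> mpoly_vars (P * Q)"
  then obtain m where m: "m \<in> Poly_Mapping.keys (P * Q)" "i \<in> Poly_Mapping.keys m"
    by (auto simp: mpoly_vars_def)
  then obtain a b where "m = a + b" "a \<in> Poly_Mapping.keys P" "b \<in> Poly_Mapping.keys Q"
    using Poly_Mapping.keys_mult[of P Q] by blast
  then show "i \<in> mpoly_vars P \<union> mpoly_vars Q"
    using m Poly_Mapping.keys_add[of a b] by (auto simp: mpoly_vars_def)
qed

lemma polynomial_function_imp_mpoly:
  assumes "polynomial_function d f"
  shows "\<exists>P. mpoly_vars P \<subseteq> {..<d} \<and> (\<forall>t. mpoly_eval P t = f (\<lambda>i. t $ i))"
  using assms
proof induction
  case (const c)
  show ?case
    by (rule exI[of _ "Poly_Mapping.single 0 c"])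
       (auto simp: mpoly_vars_def mpoly_eval_single split: if_splits)
next
  case (var i)
  let ?m = "Poly_Mapping.single i (1::nat)"
  have "mpoly_eval (Poly_Mapping.single ?m 1) t = t $ i" for t :: "'a vec"
    by (simp add: mpoly_eval_single)
  moreover have "mpoly_vars (Poly_Mapping.single ?m (1::'a)) \<subseteq> {..<d}"
    using var by (auto simp: mpoly_vars_def)
  ultimately show ?case by blast
next
  case (add f g)
  then obtain P Q where "mpoly_vars P \<subseteq> {..<d}" "\<forall>t. mpoly_eval P t = f (\<lambda>i. t $ i)"
    "mpoly_vars Q \<subseteq> {..<d}" "\<forall>t. mpoly_eval Q t = g (\<lambda>i. t $ i)" by auto
  then show ?case using mpoly_vars_add[of P Q]
    by (intro exI[of _ "P + Q"]) (auto simp: mpoly_eval_add)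
next
  case (mult f g)
  then obtain P Q where "mpoly_vars P \<subseteq> {..<d}" "\<forall>t. mpoly_eval P t = f (\<lambda>i. t $ i)"
    "mpoly_vars Q \<subseteq> {..<d}" "\<forall>t. mpoly_eval Q t = g (\<lambda>i. t $ i)" by auto
  then show ?case using mpoly_vars_mult[of P Q]
    by (intro exI[of _ "P * Q"]) (auto simp: mpoly_eval_mult)
qed

text \<open>The range is required to be all of \<open>SL\<^sub>n\<close>: the map takes no value outside, whatever the parameters.\<close>

definition special_linear_parametrization ::
    "nat \<Rightarrow> nat \<Rightarrow> ((nat \<Rightarrow> 'r::comm_ring_1) \<Rightarrow> 'r mat) \<Rightarrow> bool" where
  "special_linear_parametrization n d F \<longleftrightarrow>
     (\<forall>i<n. \<forall>j<n. polynomial_function d (\<lambda>x. F x $$ (i, j))) \<and> range F = special_linear n"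

lemma polynomial_family_special_linear:
  assumes F: "special_linear_parametrization n d (F :: (nat \<Rightarrow> 'r::comm_ring_1) \<Rightarrow> 'r mat)"
    and d: "d \<le> D" "D > 0"
  shows "polynomial_family (n\<^sup>2) D (mat_entries n ` (special_linear n :: 'r mat set))"
proof -
  let ?f = "\<lambda>k x. F x $$ (k div n, k mod n)"
  have idx: "k div n < n" "k mod n < n" if "k < n\<^sup>2" for k
    using that by (auto simp: power2_eq_square less_mult_imp_div_less)
       (metis mod_less_divisor mult_is_0 not_less_zero neq0_conv)
  have pf: "polynomial_function d (?f k)" if "k < n\<^sup>2" for k
    using F idx[OF that] by (auto simp: special_linear_parametrization_def)
  then have "\<forall>k. \<exists>P. k < n\<^sup>2 \<longrightarrow> mpoly_vars P \<subseteq> {..<d} \<and> (\<forall>t. mpoly_eval P t = ?f k (\<lambda>i. t $ i))"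
    using polynomial_function_imp_mpoly by blast
  then obtain P where P: "\<And>k. k < n\<^sup>2 \<Longrightarrow> mpoly_vars (P k) \<subseteq> {..<d} \<and>
      (\<forall>t. mpoly_eval (P k) t = ?f k (\<lambda>i. t $ i))"
    by metis
  have ev: "vec (n\<^sup>2) (\<lambda>k. mpoly_eval (P k) t) = mat_entries n (F (\<lambda>i. t $ i))" for t
    using P by (auto simp: mat_entries_def)
  have "mat_entries n ` special_linear n = {vec (n\<^sup>2) (\<lambda>k. mpoly_eval (P k) t) | t. t \<in> carrier_vec D}"
  proof (intro equalityI subsetI)
    fix y assume "y \<in> mat_entries n ` (special_linear n :: 'r mat set)"
    then have "y \<in> mat_entries n ` range F"
      using F by (simp only: special_linear_parametrization_def)
    then obtain x where x: "y = mat_entries n (F x)" by blast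
    have "mat_entries n (F x) = mat_entries n (F (\<lambda>i. vec D x $ i))"
      unfolding mat_entries_def
      using polynomial_function_cong[OF pf, of _ x "\<lambda>i. vec D x $ i"] d
      by (intro eq_vecI) auto
    then show "y \<in> {vec (n\<^sup>2) (\<lambda>k. mpoly_eval (P k) t) | t. t \<in> carrier_vec D}"
      using x ev[of "vec D x"] by (auto intro!: exI[of _ "vec D x"])
  next
    fix y assume "y \<in> {vec (n\<^sup>2) (\<lambda>k. mpoly_eval (P k) t) | t. t \<in> carrier_vec D}"
    then show "y \<in> mat_entries n ` special_linear n"
      using F ev by (auto simp: special_linear_parametrization_def)
  qed
  moreover have "\<forall>k<n\<^sup>2. mpoly_vars (P k) \<subseteq> {..<D}" using P d by fastforce
  ultimately show ?thesis unfolding polynomial_family_def using d by blast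
qed

section \<open>Two-by-two matrices and the exchange of powers\<close>

text \<open>Explicit quadruples make identities between products of concrete matrices a matter of ring
normalization, and the monoid structure provides the powers \<open>\<gamma>\<^sup>m\<close>.\<close>

datatype 'a mat2 = Mat2 'a 'a 'a 'a

instantiation mat2 :: (comm_ring_1) monoid_mult
begin
definition one_mat2 :: "'a mat2" where "one_mat2 = Mat2 1 0 0 1"
fun times_mat2 :: "'a mat2 \<Rightarrow> 'a mat2 \<Rightarrow> 'a mat2" where
  "times_mat2 (Mat2 a b c d) (Mat2 a' b' c' d') =
     Mat2 (a * a' + b * c') (a * b' + b * d') (c * a' + d * c') (c * b' + d * d')"
instance
proof
  fix x y z :: "'a mat2"
  show "x * y * z = x * (y * z)"
    by (cases x; cases y; cases z) (simp add: algebra_simps)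
  show "1 * x = x" "x * 1 = x" by (cases x, simp add: one_mat2_def)+
qed
end

fun det2 :: "'a::comm_ring_1 mat2 \<Rightarrow> 'a" where
  "det2 (Mat2 a b c d) = a * d - b * c"

fun transpose2 :: "'a mat2 \<Rightarrow> 'a mat2" where
  "transpose2 (Mat2 a b c d) = Mat2 a c b d"

fun adjugate2 :: "'a::comm_ring_1 mat2 \<Rightarrow> 'a mat2" where
  "adjugate2 (Mat2 a b c d) = Mat2 d (- b) (- c) a"

lemma det2_mult: "det2 (x * y) = det2 x * det2 y"
  by (cases x; cases y) (simp add: algebra_simps)

lemma det2_transpose [simp]: "det2 (transpose2 x) = det2 x"
  by (cases x) (simp add: algebra_simps)

lemma det2_adjugate [simp]: "det2 (adjugate2 x) = det2 x"
  by (cases x) (simp add: algebra_simps)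

lemma transpose2_mult: "transpose2 (x * y) = transpose2 y * transpose2 x"
  by (cases x; cases y) (simp add: algebra_simps)

lemma transpose2_transpose2 [simp]: "transpose2 (transpose2 x) = x"
  by (cases x) simp

lemma adjugate2_mult_cancel:
  "det2 x = 1 \<Longrightarrow> adjugate2 x * x = 1" "det2 x = 1 \<Longrightarrow> x * adjugate2 x = 1"
  by (cases x; simp add: one_mat2_def algebra_simps)+

definition upper2 :: "'a::comm_ring_1 \<Rightarrow> 'a mat2" where "upper2 x = Mat2 1 x 0 1"

definition lower2 :: "'a::comm_ring_1 \<Rightarrow> 'a mat2" where "lower2 x = Mat2 1 0 x 1"

lemma det2_upper2 [simp]: "det2 (upper2 x) = 1" and det2_lower2 [simp]: "det2 (lower2 x) = 1"
  by (simp_all add: upper2_def lower2_def)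

text \<open>Let \<open>\<beta> = ((A, s b), (s c, E))\<close> with \<open>A = 1 + s t\<close> and \<open>E = 1 + s e\<close>, let \<open>\<delta>\<close> be its determinant, and let
\<open>N\<^sub>1\<close>, \<open>N\<^sub>2\<close> be the nilpotent matrices attached to its columns.  Then
\<open>(1 + N\<^sub>1) (1 - N\<^sub>2) (1 + N\<^sub>1) = (1 - \<delta>\<^sup>2) + (2 - \<delta>\<^sup>2) N\<^sub>1 - N\<^sub>2\<close> is the polynomial extension of \<open>\<beta> w \<beta>\<^sup>-\<^sup>1\<close>
to all \<open>\<beta>\<close>.  The definition is this matrix times \<open>w\<^sup>-\<^sup>1\<close>, conjugated by \<open>diag(s, 1)\<close>; the division by \<open>s\<close>
in the upper right corner is carried out with \<open>1 - \<delta>\<^sup>2 = - s \<eta> (1 + \<delta>)\<close>.\<close>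

definition swindle :: "'a::comm_ring_1 \<Rightarrow> 'a \<Rightarrow> 'a \<Rightarrow> 'a \<Rightarrow> 'a \<Rightarrow> 'a mat2" where
  "swindle s t b c e =
    (let A = 1 + s * t; E = 1 + s * e; \<eta> = t + e + s * (t * e - b * c); \<delta> = 1 + s * \<eta>;
         \<kappa> = 2 - \<delta> * \<delta>
     in Mat2 (\<kappa> * A * A + s * s * b * b)
             (\<eta> * (1 + \<delta>) + \<kappa> * A * c + b * E)
             (s * (\<kappa> * A * s * c + s * b * E - s * \<eta> * (1 + \<delta>)))
             (\<kappa> * s * s * c * c + E * E))"

lemma det2_swindle: "det2 (swindle s t b c e) = 1"
proof -
  define A B C E \<eta> where d: "A = 1 + s * t" "B = s * b" "C = s * c" "E = 1 + s * e"
    "\<eta> = t + e + s * (t * e - b * c)"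
  define \<delta> where \<delta>: "\<delta> = 1 + s * \<eta>"
  have \<delta>1: "\<delta> = A * E - B * C" unfolding \<delta> d by (simp add: algebra_simps)
  have \<delta>2: "s * \<eta> * (1 + \<delta>) = \<delta> * \<delta> - 1" unfolding \<delta> by (simp add: algebra_simps)
  have "det2 (swindle s t b c e) =
    ((2 - \<delta> * \<delta>) * A * A + B * B) * ((2 - \<delta> * \<delta>) * C * C + E * E)
    - (s * \<eta> * (1 + \<delta>) + (2 - \<delta> * \<delta>) * A * C + B * E) * ((2 - \<delta> * \<delta>) * A * C + B * E - s * \<eta> * (1 + \<delta>))"
    unfolding swindle_def Let_def d(1,2,3,4)[symmetric] d(5)[symmetric] \<delta>[symmetric] det2.simps
    unfolding d(2,3) by (simp add: algebra_simps)
  also have "\<dots> = (2 - \<delta> * \<delta>) * (A * E - B * C) * (A * E - B * C) + (\<delta> * \<delta> - 1) * (\<delta> * \<delta> - 1)"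
    unfolding \<delta>2 by (simp add: algebra_simps)
  also have "\<dots> = 1" unfolding \<delta>1[symmetric] by (simp add: algebra_simps)
  finally show ?thesis .
qed

text \<open>For determinant \<open>1\<close> the swindle is \<open>D\<^sup>-\<^sup>1 \<beta> \<beta>\<^sup>T D\<close> with \<open>D = diag(s, 1)\<close>, and this factors as
\<open>(D\<^sup>-\<^sup>1 \<beta> D) (D \<beta> D\<^sup>-\<^sup>1)\<^sup>T\<close>.\<close>

lemma swindle_eq:
  fixes s :: "'a::idom"
  assumes "x * y - s * s * b * c = 1" "s dvd x - 1" "s dvd y - 1"
  shows "\<exists>t e. Mat2 x b (s * s * c) y * transpose2 (Mat2 x (s * s * b) c y) = swindle s t b c e"
proof -
  obtain t0 e0 where te0: "x - 1 = s * t0" "y - 1 = s * e0" using assms by (auto simp: dvd_def)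
  \<comment> \<open>For \<open>s = 0\<close> the relation between \<open>t\<close> and \<open>e\<close> does not follow from the determinant;
    both are then \<open>0\<close>.\<close>
  define t e where "t = (if s = 0 then 0 else t0)" "e = (if s = 0 then 0 else e0)"
  then have te: "x = 1 + s * t" "y = 1 + s * e" using te0 by (auto simp: algebra_simps)
  have "s * (t + e + s * (t * e - b * c)) = 0" using assms(1) unfolding te by (simp add: algebra_simps)
  then have \<eta>: "t + e + s * (t * e - b * c) = 0" using \<open>t = _\<close> \<open>e = _\<close> by (cases "s = 0") auto
  have "Mat2 x b (s * s * c) y * transpose2 (Mat2 x (s * s * b) c y) = swindle s t b c e"
    unfolding swindle_def Let_def \<eta> te by (simp add: algebra_simps)
  then show ?thesis by blast
qed

text \<open>Changing the signs of both factors does not change their product, so diagonal entries congruent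
to \<open>-1\<close> are covered as well.\<close>

lemma swindle_eq_neg:
  fixes s :: "'a::idom"
  assumes "x * y - s * s * b * c = 1" "s dvd x + 1" "s dvd y + 1"
  shows "\<exists>t e. Mat2 x b (s * s * c) y * transpose2 (Mat2 x (s * s * b) c y) = swindle s t (- b) (- c) e"
proof -
  have "s dvd - x - 1" "s dvd - y - 1" using assms by (metis dvd_minus_iff minus_add_distrib minus_diff_eq diff_minus_eq_add uminus_add_conv_diff add.commute)+
  then show ?thesis using swindle_eq[of "- x" "- y" s "- b" "- c"] assms(1) by auto
qed

text \<open>Cayley--Hamilton expresses \<open>\<gamma>\<^sup>m\<close> linearly in \<open>\<gamma>\<close>.  Modulo \<open>k\<close> the matrix \<open>\<gamma>\<close> is lower triangular and modulo
\<open>l\<close> it is upper triangular, which determines the diagonal of the power.\<close>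

lemma power_mat2:
  fixes v :: "'a::comm_ring_1"
  assumes "v * z - k * l = 1"
  shows "\<exists>f g. Mat2 v k l z ^ m = Mat2 (g + f * v) (f * k) (f * l) (g + f * z) \<and>
    (g + f * v) * (g + f * z) - f * f * k * l = 1 \<and>
    k dvd (g + f * v) - v ^ m \<and> l dvd (g + f * z) - z ^ m"
proof (induction m)
  case 0
  then show ?case by (intro exI[of _ 0] exI[of _ 1]) (simp add: one_mat2_def)
next
  case (Suc m)
  then obtain f g where IH: "Mat2 v k l z ^ m = Mat2 (g + f * v) (f * k) (f * l) (g + f * z)"
    "(g + f * v) * (g + f * z) - f * f * k * l = 1"
    "k dvd (g + f * v) - v ^ m" "l dvd (g + f * z) - z ^ m" by auto
  have vz: "v * z = 1 + k * l" using assms by (simp add: algebra_simps)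
  let ?f = "f * (v + z) + g" and ?g = "- f"
  have 1: "?g + ?f * v = v * (g + f * v) + k * (f * l)"
    using arg_cong[OF vz, of "\<lambda>x. f * x"] by (simp add: algebra_simps)
  have 2: "?g + ?f * z = z * (g + f * z) + l * (f * k)"
    using arg_cong[OF vz, of "\<lambda>x. f * x"] by (simp add: algebra_simps)
  have pow: "Mat2 v k l z ^ Suc m = Mat2 (?g + ?f * v) (?f * k) (?f * l) (?g + ?f * z)"
    unfolding power_Suc2 IH(1) 1 2 by (simp add: algebra_simps)
  have "det2 (Mat2 v k l z ^ n) = 1" for n
  proof (induction n)
    case (Suc n)
    then show ?case using assms by (simp add: det2_mult)
  qed (simp add: one_mat2_def)
  from this[of "Suc m"] have "(?g + ?f * v) * (?g + ?f * z) - ?f * ?f * k * l = 1"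
    unfolding pow by (simp add: mult_ac)
  moreover have "k dvd (?g + ?f * v) - v ^ Suc m"
  proof -
    have "(?g + ?f * v) - v ^ Suc m = v * ((g + f * v) - v ^ m) + k * (f * l)"
      unfolding 1 by (simp add: algebra_simps)
    then show ?thesis using IH(3) by simp
  qed
  moreover have "l dvd (?g + ?f * z) - z ^ Suc m"
  proof -
    have "(?g + ?f * z) - z ^ Suc m = z * ((g + f * z) - z ^ m) + l * (f * k)"
      unfolding 2 by (simp add: algebra_simps)
    then show ?thesis using IH(4) by simp
  qed
  ultimately show ?case using pow by blast
qed

text \<open>With a unit in the corner one column operation creates an entry \<open>1\<close>, and a second one moves it to
the corner.\<close>

lemma unit_corner_factorization:
  fixes u :: "'a::comm_ring_1"
  assumes "u * u' = 1" "u * d - k * c = 1"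
  shows "\<exists>p q r. Mat2 u k c d = lower2 p * upper2 1 * lower2 q * upper2 r"
proof -
  let ?r = "(k - 1) * u'" 
  let ?q = "u - 1"
  have 1: "u * ?r = k - 1" using assms(1) by (metis mult.assoc mult.commute mult_1)
  define e where "e = d - c * ?r"
  have e: "u * e = 1 + c"
  proof -
    have "u * e = u * d - c * (u * ?r)" by (simp add: e_def algebra_simps)
    also have "\<dots> = u * d - c * (k - 1)" unfolding 1 ..
    also have "\<dots> = 1 + c" using assms(2) by (simp add: algebra_simps)
    finally show ?thesis .
  qed
  define p where "p = e - 1"
  have "lower2 p * upper2 1 * lower2 ?q * upper2 ?r = Mat2 u (u * ?r + 1) (p * u + ?q) ((p * u + ?q) * ?r + p + 1)"
    by (simp add: lower2_def upper2_def algebra_simps)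
  also have "u * ?r + 1 = k" using 1 by simp
  also have "p * u + ?q = c" using e by (simp add: p_def algebra_simps)
  also have "c * ?r + p + 1 = d" by (simp add: p_def e_def)
  finally show ?thesis by metis
qed

text \<open>Since \<open>\<gamma>\<^sup>m\<close> is the scalar \<open>g\<close> modulo \<open>f\<close> and has determinant \<open>1\<close>, \<open>f\<close> divides \<open>(g - 1) (g + 1)\<close>.  It splits
accordingly as \<open>f = a b\<close>, so that the diagonal of \<open>\<gamma>\<^sup>m\<close> is \<open>1\<close> modulo \<open>a\<close> and \<open>-1\<close> modulo \<open>b\<close>: one swindle
moves \<open>a\<^sup>2\<close> across the diagonal, a second one moves \<open>b\<^sup>2\<close>.\<close>

lemma power_exchange_factorization:
  fixes v :: "'a::idom"
  assumes primal: "\<And>f x y :: 'a. f dvd x * y \<Longrightarrow> \<exists>f1 f2. f = f1 * f2 \<and> f1 dvd x \<and> f2 dvd y"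
    and det: "v * z - k * l = 1" and u: "u * u' = 1"
    and k: "k dvd v ^ m - u" and l: "l dvd z ^ m - z"
  shows "\<exists>h s t b c e s' t' b' c' e' p q r i j. Mat2 v k l z =
    upper2 h * transpose2 (swindle s t b c e) * adjugate2 (swindle s' t' b' c' e') *
    lower2 p * upper2 1 * lower2 q * upper2 r * lower2 j * upper2 i"
proof -
  obtain f g where fg: "(g + f * v) * (g + f * z) - f * f * k * l = 1"
    "k dvd (g + f * v) - v ^ m" "l dvd (g + f * z) - z ^ m"
    using power_mat2[OF det, of m] by blast
  define x y where xy: "x = g + f * v" "y = g + f * z"
  have det': "x * y - f * f * k * l = 1" using fg xy by simp
  have "(g - 1) * (g + 1) = f * (f * (k * l - v * z) - g * (v + z))"
    using fg(1) by (simp add: algebra_simps)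
  then have "f dvd (g - 1) * (g + 1)" by simp
  then obtain a b where ab: "f = a * b" "a dvd g - 1" "b dvd g + 1"
    using primal by blast
  have a: "a dvd x - 1" "a dvd y - 1"
  proof -
    have "x - 1 = (g - 1) + a * (b * v)" "y - 1 = (g - 1) + a * (b * z)"
      unfolding xy ab by (simp_all add: algebra_simps)
    then show "a dvd x - 1" "a dvd y - 1" using ab(2) by (simp_all only: dvd_add dvd_triv_left)
  qed
  have b: "b dvd x + 1" "b dvd y + 1"
  proof -
    have "x + 1 = (g + 1) + b * (a * v)" "y + 1 = (g + 1) + b * (a * z)"
      unfolding xy ab by (simp_all add: algebra_simps)
    then show "b dvd x + 1" "b dvd y + 1" using ab(3) by (simp_all only: dvd_add dvd_triv_left)
  qed
  let ?\<eta>1 = "Mat2 x k (f * f * l) y" and ?\<eta>2 = "Mat2 x (f * f * k) l y"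
  let ?\<mu> = "Mat2 x (b * b * k) (a * a * l) y"
  obtain t e where S1: "?\<mu> * transpose2 ?\<eta>2 = swindle a t (b * b * k) l e"
    using swindle_eq[of x y a "b * b * k" l] a det' unfolding ab by (auto simp: mult_ac)
  obtain t' e' where S2: "?\<eta>1 * transpose2 ?\<mu> = swindle b t' (- k) (- (a * a * l)) e'"
    using swindle_eq_neg[of x y b k "a * a * l"] b det' unfolding ab by (auto simp: mult_ac)
  have d: "det2 ?\<eta>1 = 1" "det2 ?\<eta>2 = 1" "det2 ?\<mu> = 1"
    using det' unfolding ab by (simp_all add: mult_ac)
  let ?S1 = "swindle a t (b * b * k) l e" and ?S2 = "swindle b t' (- k) (- (a * a * l)) e'"
  have "adjugate2 ?S2 * ?\<eta>1 = adjugate2 (transpose2 ?\<mu>)"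
  proof -
    have "?\<eta>1 = ?S2 * adjugate2 (transpose2 ?\<mu>)"
      unfolding S2[symmetric] mult.assoc[of ?\<eta>1]
      using adjugate2_mult_cancel(2)[of "transpose2 ?\<mu>"] d(3) by (simp del: transpose2.simps adjugate2.simps times_mat2.simps)
    then have "adjugate2 ?S2 * ?\<eta>1 = adjugate2 ?S2 * ?S2 * adjugate2 (transpose2 ?\<mu>)"
      by (simp only: mult.assoc)
    then show ?thesis by (simp only: adjugate2_mult_cancel det2_swindle mult_1_left)
  qed
  then have "transpose2 ?S1 * (adjugate2 ?S2 * ?\<eta>1)
    = ?\<eta>2 * (transpose2 ?\<mu> * adjugate2 (transpose2 ?\<mu>))"
    unfolding S1[symmetric] transpose2_mult transpose2_transpose2 by (simp only: mult.assoc)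
  then have \<eta>2: "?\<eta>2 = transpose2 ?S1 * adjugate2 ?S2 * ?\<eta>1"
    using adjugate2_mult_cancel(2)[of "transpose2 ?\<mu>"] d(3)
    by (simp only: det2_transpose mult_1_right mult.assoc)
  \<comment> \<open>A column operation on \<open>?\<eta>1\<close> replaces \<open>x\<close> by the unit \<open>u\<close>; \<open>?\<eta>2\<close> and \<open>\<gamma>\<close> share the second row
    up to a column operation.\<close>
  have "x - u = (x - v ^ m) + (v ^ m - u)" by simp
  then have "k dvd x - u" using dvd_add[OF fg(2)[folded xy] k] by simp
  then obtain j where j: "x = u + k * j" by (metis add.commute diff_eq_eq dvdE)
  let ?d = "y" and ?c = "f * f * l - y * j"
  have "u * ?d - k * ?c = 1" using det' unfolding j by (simp add: algebra_simps)
  then obtain p q r where pqr: "Mat2 u k ?c ?d = lower2 p * upper2 1 * lower2 q * upper2 r"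
    using unit_corner_factorization[OF u] by blast
  have \<eta>1: "?\<eta>1 = Mat2 u k ?c ?d * lower2 j"
    unfolding j by (simp add: lower2_def algebra_simps)
  have "y - z = (y - z ^ m) + (z ^ m - z)" by simp
  then have "l dvd y - z" using dvd_add[OF fg(3)[folded xy] l] by simp
  then obtain i where i: "y = z + l * i" by (metis add.commute diff_eq_eq dvdE)
  let ?w = "f * f * k - x * i"
  have "?\<eta>2 * upper2 (- i) = Mat2 x ?w l z"
    unfolding i by (simp add: upper2_def algebra_simps)
  moreover have "Mat2 v k l z = upper2 (k * x - v * ?w) * Mat2 x ?w l z"
  proof -
    have xz: "x * z - ?w * l = 1" using det' unfolding i by (simp add: algebra_simps)
    have "x + (k * x - v * ?w) * l = v * (x * z - ?w * l) - x * (v * z - k * l - 1)"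
      "?w + (k * x - v * ?w) * z = k * (x * z - ?w * l) - ?w * (v * z - k * l - 1)"
      by (simp_all add: algebra_simps)
    then show ?thesis unfolding xz det by (simp add: upper2_def)
  qed
  ultimately have h: "Mat2 v k l z = upper2 (k * x - v * ?w) * (?\<eta>2 * upper2 (- i))"
    by simp
  have "Mat2 v k l z = upper2 (k * x - v * ?w) * transpose2 ?S1 *
    adjugate2 ?S2 *
    lower2 p * upper2 1 * lower2 q * upper2 r * lower2 j * upper2 (- i)"
    unfolding h \<eta>2 \<eta>1 pqr by (simp only: mult.assoc)
  then show ?thesis by blast
qed

section \<open>Divisibility and residues of polynomials over a field\<close>

lemma poly_bezout:
  fixes f g :: "'a::field poly"
  shows "\<exists>d u v. d = u * f + v * g \<and> d dvd f \<and> d dvd g"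
proof (induction "if g = 0 then 0 else Suc (degree g)" arbitrary: f g rule: less_induct)
  case less
  show ?case
  proof (cases "g = 0")
    case True
    then show ?thesis by (intro exI[of _ f] exI[of _ 1] exI[of _ 0]) simp
  next
    case False
    then have "(if f mod g = 0 then 0 else Suc (degree (f mod g))) < (if g = 0 then 0 else Suc (degree g))"
      using degree_mod_less[of g f] by auto
    from less[OF this] obtain d u v where d: "d = u * g + v * (f mod g)" "d dvd g" "d dvd f mod g" by blast
    have "d = v * f + (u - v * (f div g)) * g"
      unfolding d(1) by (simp add: algebra_simps minus_div_mult_eq_mod[symmetric])
    moreover have "d dvd f" using d(2,3) by (simp add: dvd_mod_iff)
    ultimately show ?thesis using d(2) by blast
  qed
qed

lemma irreducible_bezout:
  fixes P f :: "'a::field poly"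
  assumes "irreducible P" "\<not> P dvd f"
  shows "\<exists>u v. u * P + v * f = 1"
proof -
  obtain d u v where d: "d = u * P + v * f" "d dvd P" "d dvd f"
    using poly_bezout by metis
  have "is_unit d"
    using assms d(2,3) by (metis dvd_trans irreducibleD')
  then obtain e where e: "1 = d * e" by (rule dvdE)
  have "e * u * P + e * v * f = 1" unfolding e d(1) by (simp add: algebra_simps)
  then show ?thesis by blast
qed

text \<open>Polynomials over a field form a Bezout domain, where every element is primal.\<close>

lemma poly_dvd_mult_split:
  fixes f x y :: "'a::field poly"
  assumes "f dvd x * y"
  shows "\<exists>f1 f2. f = f1 * f2 \<and> f1 dvd x \<and> f2 dvd y"
proof -
  obtain d u v where d: "d = u * f + v * x" "d dvd f" "d dvd x" using poly_bezout by metis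
  show ?thesis
  proof (cases "d = 0")
    case True
    then show ?thesis using d by (intro exI[of _ 0] exI[of _ 1]) auto
  next
    case False
    obtain f' x' where fx: "f = d * f'" "x = d * x'" using d(2,3) by (auto elim!: dvdE)
    have "d * (u * f' + v * x') = d * 1" using d(1) unfolding fx by (simp add: algebra_simps)
    then have 1: "u * f' + v * x' = 1" using False by simp
    have "f' dvd x' * y" using assms False unfolding fx by (simp add: mult.assoc)
    then have "f' dvd u * y * f' + v * (x' * y)"
      by (rule dvd_add[OF dvd_triv_right dvd_mult])
    also have "u * y * f' + v * (x' * y) = (u * f' + v * x') * y" by (simp add: algebra_simps)
    also have "\<dots> = y" by (simp only: 1 mult_1_left)
    finally show ?thesis using fx d(3) by (intro exI[of _ d] exI[of _ f']) simp
  qed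
qed

text \<open>A nonunit divisor of least degree is irreducible.\<close>

lemma irreducible_factor_exists:
  fixes f :: "'a::field poly"
  assumes "degree f > 0"
  obtains Q where "irreducible Q" "Q dvd f"
proof -
  have "f \<noteq> 0" using assms by auto
  then have ex: "f dvd f \<and> \<not> is_unit f" using assms by (simp add: is_unit_iff_degree)
  define Q where "Q = arg_min degree (\<lambda>Q. Q dvd f \<and> \<not> is_unit Q)"
  have Q1: "Q dvd f" "\<not> is_unit Q"
    using arg_min_natI[of "\<lambda>Q. Q dvd f \<and> \<not> is_unit Q" f degree] ex by (simp_all add: Q_def)
  have Qmin: "degree Q \<le> degree R" if "R dvd f" "\<not> is_unit R" for R
    unfolding Q_def using arg_min_nat_le[of "\<lambda>Q. Q dvd f \<and> \<not> is_unit Q" R degree] that by blast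
  have "irreducible Q"
  proof (rule irreducibleI)
    show "Q \<noteq> 0" using Q1 \<open>f \<noteq> 0\<close> by auto
    fix u v assume uv: "Q = u * v"
    show "is_unit u \<or> is_unit v"
    proof (rule ccontr)
      assume neg: "\<not> (is_unit u \<or> is_unit v)"
      have "u \<noteq> 0" "v \<noteq> 0" using uv \<open>Q \<noteq> 0\<close> by auto
      moreover have "degree v > 0" using neg \<open>v \<noteq> 0\<close> by (auto simp: is_unit_iff_degree)
      ultimately have "degree u < degree Q" by (simp add: uv degree_mult_eq)
      moreover have "u dvd f" using Q1 uv by (metis dvd_mult_left)
      ultimately show False using Qmin[of u] neg by auto
    qed
  qed (use Q1 in auto)
  then show thesis using that Q1(1) by blast
qed

lemma prime_elem_dvd_prod:
  assumes "prime_elem p" "p dvd prod f A"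
  shows "\<exists>x\<in>A. p dvd f x"
  using assms(2)
proof (induction A rule: infinite_finite_induct)
  case (insert x A)
  then show ?case using prime_elem_dvd_multD[OF assms(1), of "f x" "prod f A"] by auto
qed (use assms(1) in \<open>auto simp: prime_elem_def\<close>)

lemma dvd_diff_mult:
  "(a::'a::comm_ring_1) dvd f - f' \<Longrightarrow> a dvd g - g' \<Longrightarrow> a dvd f * g - f' * g'"
  using dvd_add[OF dvd_mult2[of a "f - f'" g] dvd_mult[of a "g - g'" f']] by (simp add: algebra_simps)

lemma dvd_diff_power: "(a::'a::comm_ring_1) dvd f - f' \<Longrightarrow> a dvd f ^ n - f' ^ n"
  by (induction n) (auto intro: dvd_diff_mult)

lemma dvd_diff_trans: "(a::'a::comm_ring_1) dvd f - g \<Longrightarrow> a dvd g - h \<Longrightarrow> a dvd f - h"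
  using dvd_add[of a "f - g" "g - h"] by simp

lemma dvd_diff_sym: "(a::'a::comm_ring_1) dvd f - g \<Longrightarrow> a dvd g - f"
  using dvd_minus_iff[of a "f - g"] by simp

definition unit_mod :: "'a::field poly \<Rightarrow> 'a poly \<Rightarrow> bool" where
  "unit_mod a f \<longleftrightarrow> (\<exists>g. a dvd f * g - 1)"

lemma unit_mod_mult_iff: "unit_mod a (f * g) \<longleftrightarrow> unit_mod a f \<and> unit_mod a g"
proof
  assume "unit_mod a (f * g)"
  then obtain h where "a dvd f * g * h - 1" by (auto simp: unit_mod_def)
  then have "a dvd f * (g * h) - 1" "a dvd g * (f * h) - 1" by (simp_all add: mult_ac)
  then show "unit_mod a f \<and> unit_mod a g" by (auto simp: unit_mod_def)
next
  assume "unit_mod a f \<and> unit_mod a g"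
  then obtain f' g' where "a dvd f * f' - 1" "a dvd g * g' - 1" by (auto simp: unit_mod_def)
  then have "a dvd (f * f' - 1) * (g * g') + (g * g' - 1)" by (intro dvd_add dvd_mult2)
  also have "(f * f' - 1) * (g * g') + (g * g' - 1) = f * g * (f' * g') - 1" by (simp add: algebra_simps)
  finally show "unit_mod a (f * g)" by (auto simp: unit_mod_def)
qed

lemma unit_mod_one [simp]: "unit_mod a 1"
  by (auto simp: unit_mod_def intro: exI[of _ 1])

lemma unit_mod_power: "unit_mod a f \<Longrightarrow> unit_mod a (f ^ n)"
  by (induction n) (auto simp: unit_mod_mult_iff)

lemma unit_mod_cong:
  assumes "a dvd f - g" "unit_mod a f"
  shows "unit_mod a g"
proof -
  obtain h where h: "a dvd f * h - 1" using assms by (auto simp: unit_mod_def)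
  have "g * h - 1 = (f * h - 1) - (f - g) * h" by (simp add: algebra_simps)
  then have "a dvd g * h - 1" using dvd_diff[OF h dvd_mult2[OF assms(1), of h]] by (simp only:)
  then show ?thesis by (auto simp: unit_mod_def)
qed

lemma unit_mod_cancel:
  assumes "unit_mod a h" "a dvd h * f - h * g"
  shows "a dvd f - g"
proof -
  obtain h' where h: "a dvd h * h' - 1" using assms by (auto simp: unit_mod_def)
  have "f - g = (h * f - h * g) * h' - (h * h' - 1) * (f - g)" by (simp add: algebra_simps)
  then show ?thesis using h assms(2) by (metis dvd_diff dvd_mult2)
qed

lemma irreducible_unit_mod:
  fixes P f :: "'a::field poly"
  assumes "irreducible P" "\<not> P dvd f"
  shows "unit_mod P f" "unit_mod f P"
proof -
  obtain u v where "u * P + v * f = 1" using irreducible_bezout[OF assms] by blast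
  then have "f * v - 1 = P * (- u)" "P * u - 1 = f * (- v)" by (simp_all add: algebra_simps)
  then have "P dvd f * v - 1" "f dvd P * u - 1" by (simp_all only: dvd_triv_left)
  then show "unit_mod P f" "unit_mod f P" unfolding unit_mod_def by blast+
qed

lemma card_field_gt_1: "CARD('a::{field,finite}) > 1"
proof -
  have "card {0, 1 :: 'a} \<le> CARD('a)" by (intro card_mono) auto
  then show ?thesis by simp
qed

section \<open>Monic polynomials and their prime power divisors\<close>

definition monics :: "nat \<Rightarrow> 'a::{field,finite} poly set" where
  "monics n = {f. degree f = n \<and> lead_coeff f = 1}"

definition monic_irreducibles :: "'a::{field,finite} poly set" where
  "monic_irreducibles = {P. irreducible P \<and> lead_coeff P = 1}"

definition prime_powers :: "nat \<Rightarrow> ('a::{field,finite} poly \<times> nat) set" where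
  "prime_powers n = {(P, i). P \<in> monic_irreducibles \<and> i \<ge> 1 \<and> i * degree P = n}"

lemma card_polys_degree_less:
  "card {f :: 'a::{field,finite} poly. f = 0 \<or> degree f < n} = CARD('a) ^ n"
  "finite {f :: 'a::{field,finite} poly. f = 0 \<or> degree f < n}"
proof -
  have "card {f :: 'a::{field,finite} poly. f = 0 \<or> degree f < n} = CARD('a) ^ n \<and>
    finite {f :: 'a::{field,finite} poly. f = 0 \<or> degree f < n}"
  proof (induction n)
    case 0
    have "{f :: 'a poly. f = 0 \<or> degree f < 0} = {0}" by auto
    then show ?case by simp
  next
    case (Suc n)
    let ?L = "\<lambda>n. {f :: 'a poly. f = 0 \<or> degree f < n}"
    have inj: "inj_on (\<lambda>(c, f). pCons c f) (UNIV \<times> ?L n)"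
      by (auto simp: inj_on_def)
    have "?L (Suc n) = (\<lambda>(c, f). pCons c f) ` (UNIV \<times> ?L n)"
    proof (intro equalityI subsetI)
      fix f assume f: "f \<in> ?L (Suc n)"
      obtain c g where fg: "f = pCons c g" by (cases f)
      then have "g \<in> ?L n" using f by (auto split: if_splits)
      then show "f \<in> (\<lambda>(c, f). pCons c f) ` (UNIV \<times> ?L n)" using fg by auto
    qed (auto split: if_splits)
    then show ?case using Suc inj
      by (simp only: card_image card_cartesian_product power_Suc finite_imageI finite_SigmaI) auto
  qed
  then show "card {f :: 'a::{field,finite} poly. f = 0 \<or> degree f < n} = CARD('a) ^ n"
    "finite {f :: 'a::{field,finite} poly. f = 0 \<or> degree f < n}" by auto
qed

text \<open>Subtracting the leading term identifies the monic polynomials of degree \<open>n\<close> with the polynomials of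
smaller degree, hence their number.\<close>

lemma monics_eq:
  "monics n = (\<lambda>g. monom 1 n + g) ` {g :: 'a::{field,finite} poly. g = 0 \<or> degree g < n}"
proof (intro equalityI subsetI)
  fix f :: "'a poly" assume f: "f \<in> monics n"
  let ?g = "f - monom 1 n"
  have "coeff ?g k = 0" if "k \<ge> n" for k
    using f that by (auto simp: monics_def coeff_eq_0)
  then have "?g = 0 \<or> degree ?g < n"
    by (metis leading_coeff_0_iff linorder_not_less)
  then show "f \<in> (\<lambda>g. monom 1 n + g) ` {g. g = 0 \<or> degree g < n}"
    by (intro image_eqI[of _ _ ?g]) auto
next
  fix f :: "'a poly" assume "f \<in> (\<lambda>g. monom 1 n + g) ` {g. g = 0 \<or> degree g < n}"
  then obtain g where g: "g = 0 \<or> degree g < n" "f = monom 1 n + g" by auto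
  have "degree f = n"
    using g by (cases "g = 0") (auto simp: degree_monom_eq degree_add_eq_left)
  moreover have "coeff f n = 1" using g by (auto simp: coeff_eq_0)
  ultimately show "f \<in> monics n" by (auto simp: monics_def)
qed

lemma card_monics: "card (monics n :: 'a::{field,finite} poly set) = CARD('a) ^ n"
  and finite_monics [simp]: "finite (monics n :: 'a::{field,finite} poly set)"
  unfolding monics_eq
  using card_polys_degree_less[where 'a = 'a]
  by (simp_all only: card_image inj_on_def add_left_cancel finite_imageI) (auto simp: card_image inj_on_def)

lemma monic_irreducible_degree: "P \<in> monic_irreducibles \<Longrightarrow> degree P > 0"
  by (auto simp: monic_irreducibles_def is_unit_iff_degree irreducible_def)

lemma monic_irreducible_prime: "P \<in> monic_irreducibles \<Longrightarrow> prime_elem P"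
  by (auto simp: monic_irreducibles_def intro: field_poly_irreducible_imp_prime)

lemma finite_prime_powers [simp]: "finite (prime_powers n :: ('a::{field,finite} poly \<times> nat) set)"
proof (rule finite_subset)
  show "prime_powers n \<subseteq> {f :: 'a poly. f = 0 \<or> degree f < Suc n} \<times> {..n}"
  proof
    fix x :: "'a poly \<times> nat" assume "x \<in> prime_powers n"
    then obtain P i where Pi: "x = (P, i)" "P \<in> monic_irreducibles" "i \<ge> 1" "i * degree P = n"
      by (auto simp: prime_powers_def)
    have "degree P \<le> i * degree P" "i \<le> i * degree P"
      using Pi monic_irreducible_degree[of P] by auto
    then show "x \<in> {f :: 'a poly. f = 0 \<or> degree f < Suc n} \<times> {..n}" using Pi by auto
  qed
  show "finite ({f :: 'a poly. f = 0 \<or> degree f < Suc n} \<times> {..n})"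
    using card_polys_degree_less(2) by blast
qed

lemma monic_irreducible_factor:
  fixes f :: "'a::{field,finite} poly"
  assumes "degree f > 0" "lead_coeff f = 1"
  obtains P g where "P \<in> monic_irreducibles" "lead_coeff g = 1" "f = P * g"
proof -
  obtain Q where Q: "irreducible Q" "Q dvd f" using irreducible_factor_exists[OF assms(1)] .
  let ?P = "Polynomial.smult (inverse (lead_coeff Q)) Q"
  have Q0: "Q \<noteq> 0" using Q by auto
  have P: "?P \<in> monic_irreducibles"
    using Q0 Q irreducible_mult_unit_left[of "[:inverse (lead_coeff Q):]" Q]
    by (auto simp: monic_irreducibles_def is_unit_pCons_iff)
  have "?P dvd f" using Q0 Q by (auto simp: smult_dvd_iff)
  then obtain g where g: "f = ?P * g" by (auto simp: dvd_def)
  have "lead_coeff f = lead_coeff ?P * lead_coeff g"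
    unfolding g by (rule lead_coeff_mult)
  then have "lead_coeff g = 1" using P assms by (auto simp: monic_irreducibles_def)
  then show thesis using that P g by blast
qed

definition prime_power_divisors :: "'a::{field,finite} poly \<Rightarrow> ('a poly \<times> nat) set" where
  "prime_power_divisors f = {(P, i). P \<in> monic_irreducibles \<and> i \<ge> 1 \<and> P ^ i dvd f}"

text \<open>Multiplying by \<open>Q\<close> shifts the powers of \<open>Q\<close> among the divisors by one and adds \<open>Q\<close> itself; other
primes are unaffected.  This replaces the use of unique factorization below.\<close>

lemma prime_power_divisors_times:
  fixes Q g :: "'a::{field,finite} poly"
  assumes Q: "Q \<in> monic_irreducibles"
  shows "prime_power_divisors (Q * g) =
    insert (Q, 1) ((\<lambda>(P, i). if P = Q then (P, Suc i) else (P, i)) ` prime_power_divisors g)"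
    (is "?L = insert _ (?\<phi> ` ?R)")
proof (intro equalityI subsetI)
  fix x assume "x \<in> ?L"
  then obtain P i where x: "x = (P, i)" "P \<in> monic_irreducibles" "i \<ge> 1" "P ^ i dvd Q * g"
    by (auto simp: prime_power_divisors_def)
  have Q0: "Q \<noteq> 0" using Q by (auto simp: monic_irreducibles_def)
  show "x \<in> insert (Q, 1) (?\<phi> ` ?R)"
  proof (cases "P = Q")
    case True
    obtain j where j: "i = Suc j" using x by (cases i) auto
    then have "Q ^ j dvd g" using x True Q0 by auto
    then have "j \<ge> 1 \<Longrightarrow> (Q, j) \<in> ?R" using Q by (auto simp: prime_power_divisors_def)
    then show ?thesis using x True j
      by (cases "j = 0") (auto intro!: image_eqI[of _ _ "(Q, j)"])
  next
    case False
    have "\<not> P dvd Q"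
    proof
      assume "P dvd Q"
      then obtain u where u: "Q = P * u" by (auto simp: dvd_def)
      then have "is_unit u"
        using Q x by (auto simp: monic_irreducibles_def irreducible_def)
      then have "degree u = 0" using Q0 u by (auto simp: is_unit_iff_degree)
      then obtain c where c: "u = [:c:]" by (auto elim: degree_eq_zeroE)
      have "lead_coeff Q = lead_coeff P * lead_coeff u" unfolding u by (rule lead_coeff_mult)
      then have "u = 1" using c Q x by (auto simp: monic_irreducibles_def one_pCons)
      then show False using u False by simp
    qed
    then have "P ^ i dvd g"
      using x monic_irreducible_prime[of P] 
        prime_elem_power_dvd_cases[of P i Q g 1 i] by auto
    then show ?thesis using x False
      by (auto simp: prime_power_divisors_def intro!: image_eqI[of _ _ "(P, i)"])
  qed
next
  fix x assume "x \<in> insert (Q, 1) (?\<phi> ` ?R)"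
  then show "x \<in> ?L"
    using Q by (auto simp: prime_power_divisors_def split: if_splits)
qed

text \<open>The analogue of writing \<open>log n\<close> as the sum of the von Mangoldt function over the divisors of \<open>n\<close>.\<close>

lemma sum_degree_prime_power_divisors:
  fixes f :: "'a::{field,finite} poly"
  assumes "lead_coeff f = 1"
  shows "finite (prime_power_divisors f) \<and>
    (\<Sum>(P, i)\<in>prime_power_divisors f. degree P) = degree f"
  using assms
proof (induction "degree f" arbitrary: f rule: less_induct)
  case less
  show ?case
  proof (cases "degree f = 0")
    case True
    then have "f = 1" using less by (auto elim!: degree_eq_zeroE simp: one_pCons)
    moreover have "prime_power_divisors (1 :: 'a poly) = {}"
    proof -
      have "\<not> P ^ i dvd 1" if "P \<in> monic_irreducibles" "i \<ge> 1" for P :: "'a poly" and i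
        using that by (cases i) (auto simp: is_unit_power_iff monic_irreducibles_def irreducible_def)
      then show ?thesis by (auto simp: prime_power_divisors_def)
    qed
    ultimately show ?thesis by simp
  next
    case False
    then obtain Q g where Qg: "Q \<in> monic_irreducibles" "lead_coeff g = 1" "f = Q * g"
      using less monic_irreducible_factor[of f] by blast
    have nz: "Q \<noteq> 0" "g \<noteq> 0" using Qg by (auto simp: monic_irreducibles_def)
    have deg: "degree f = degree Q + degree g" using Qg nz by (simp add: degree_mult_eq)
    then have IH: "finite (prime_power_divisors g)"
      "(\<Sum>(P, i)\<in>prime_power_divisors g. degree P) = degree g"
      using less(1)[of g] Qg monic_irreducible_degree[of Q] by auto
    let ?\<phi> = "\<lambda>(P, i). if P = Q then (P, Suc i) else (P, i)"
    have inj: "inj_on ?\<phi> (prime_power_divisors g)"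
      by (auto simp: inj_on_def split: if_splits)
    have notin: "(Q, 1) \<notin> ?\<phi> ` prime_power_divisors g"
      by (auto simp: prime_power_divisors_def split: if_splits)
    have "(\<Sum>(P, i)\<in>?\<phi> ` prime_power_divisors g. degree P) = degree g"
      by (subst sum.reindex[OF inj], subst IH(2)[symmetric], rule sum.cong) auto
    then show ?thesis
      using notin IH(1) unfolding Qg(3) prime_power_divisors_times[OF Qg(1)]
      using deg Qg(3) by auto
  qed
qed

text \<open>The coefficient of \<open>u\<^sup>n\<close> in \<open>L(u, \<chi>)\<close>.\<close>

definition coeff_sum :: "('a::{field,finite} poly \<Rightarrow> complex) \<Rightarrow> nat \<Rightarrow> complex" where
  "coeff_sum \<chi> n = (\<Sum>f\<in>monics n. \<chi> f)"

text \<open>The coefficient of \<open>u\<^sup>n\<close> in \<open>u L'(u, \<chi>) / L(u, \<chi>)\<close>.\<close>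

definition prime_power_sum :: "('a::{field,finite} poly \<Rightarrow> complex) \<Rightarrow> nat \<Rightarrow> complex" where
  "prime_power_sum \<chi> n = (\<Sum>(P, i)\<in>prime_powers n. of_nat (degree P) * \<chi> P ^ i)"

lemma monics_multiples:
  fixes h :: "'a::{field,finite} poly"
  assumes "lead_coeff h = 1" "degree h \<le> n"
  shows "{f \<in> monics n. h dvd f} = (\<lambda>g. h * g) ` monics (n - degree h)"
proof (intro equalityI subsetI)
  have h0: "h \<noteq> 0" using assms by auto
  fix f assume "f \<in> {f \<in> monics n. h dvd f}"
  then obtain g where g: "f = h * g" "degree f = n" "lead_coeff f = 1"
    by (auto simp: monics_def dvd_def)
  then have "g \<noteq> 0" by auto
  then have "degree g = n - degree h" using g h0 by (auto simp: degree_mult_eq)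
  moreover have "lead_coeff g = 1" using g assms by (metis lead_coeff_mult mult_1)
  ultimately show "f \<in> (\<lambda>g. h * g) ` monics (n - degree h)" using g by (auto simp: monics_def)
next
  have h0: "h \<noteq> 0" using assms by auto
  fix f assume "f \<in> (\<lambda>g. h * g) ` monics (n - degree h)"
  then obtain g where g: "f = h * g" "degree g = n - degree h" "lead_coeff g = 1"
    unfolding monics_def by blast
  then have "g \<noteq> 0" by auto
  then have "degree f = n" using g h0 assms by (auto simp: degree_mult_eq)
  moreover have "lead_coeff f = 1" using g assms by (metis lead_coeff_mult mult_1)
  ultimately show "f \<in> {f \<in> monics n. h dvd f}" using g by (auto simp: monics_def)
qed

text \<open>Weight every monic \<open>f\<close> of degree \<open>n\<close> by its degree, distribute this degree over the prime powers
dividing \<open>f\<close>, and sum over the cofactors first.  This is the Euler product in the form of a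
recursion.\<close>

lemma coeff_sum_recursion:
  fixes \<chi> :: "'a::{field,finite} poly \<Rightarrow> complex"
  assumes mult: "\<And>f g. \<chi> (f * g) = \<chi> f * \<chi> g" and one: "\<chi> 1 = 1"
  shows "of_nat n * coeff_sum \<chi> n = (\<Sum>j=1..n. prime_power_sum \<chi> j * coeff_sum \<chi> (n - j))"
proof -
  have pow: "\<chi> (f ^ i) = \<chi> f ^ i" for f i by (induction i) (auto simp: mult one)
  let ?PP = "\<Union>j\<in>{1..n}. prime_powers j :: ('a poly \<times> nat) set"
  let ?t = "\<lambda>x. of_nat (degree (fst x)) * \<chi> (fst x) ^ snd x * coeff_sum \<chi> (n - snd x * degree (fst x))"
  have fin: "finite ?PP" by auto
  have sub: "prime_power_divisors f = {x \<in> ?PP. fst x ^ snd x dvd f}" if "f \<in> monics n" for f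
  proof -
    have "i * degree P \<in> {1..n}" if "P \<in> monic_irreducibles" "i \<ge> 1" "P ^ i dvd f" for P i
    proof -
      have "f \<noteq> 0" using \<open>f \<in> monics n\<close> by (auto simp: monics_def)
      then have "degree (P ^ i) \<le> degree f" using that by (intro dvd_imp_degree_le) auto
      then show ?thesis using that \<open>f \<in> monics n\<close> monic_irreducible_degree[of P]
        by (auto simp: degree_power_eq monics_def monic_irreducibles_def mult.commute)
    qed
    then show ?thesis by (auto simp: prime_power_divisors_def prime_powers_def)
  qed
  have "of_nat n * coeff_sum \<chi> n = (\<Sum>f\<in>monics n. \<chi> f * of_nat n)"
    by (simp add: coeff_sum_def sum_distrib_left mult.commute)
  also have "\<dots> = (\<Sum>f\<in>monics n. \<Sum>x\<in>?PP. if fst x ^ snd x dvd f then of_nat (degree (fst x)) * \<chi> f else 0)"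
  proof (rule sum.cong[OF refl])
    fix f :: "'a poly" assume f: "f \<in> monics n"
    have "(\<Sum>(P, i)\<in>prime_power_divisors f. degree P) = n"
      using f sum_degree_prime_power_divisors[of f] by (auto simp: monics_def)
    then have "of_nat n = (of_nat (\<Sum>(P, i)\<in>prime_power_divisors f. degree P) :: complex)"
      by simp
    also have "\<dots> = (\<Sum>x\<in>prime_power_divisors f. of_nat (degree (fst x)))"
      by (simp only: case_prod_beta of_nat_sum)
    finally have n: "of_nat n = (\<Sum>x\<in>prime_power_divisors f. of_nat (degree (fst x)) :: complex)" .
    have "\<chi> f * of_nat n = (\<Sum>x\<in>{x \<in> ?PP. fst x ^ snd x dvd f}. of_nat (degree (fst x)) * \<chi> f)"
      unfolding n sub[OF f] sum_distrib_left by (simp only: mult.commute)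
    then show "\<chi> f * of_nat n = (\<Sum>x\<in>?PP. if fst x ^ snd x dvd f then of_nat (degree (fst x)) * \<chi> f else 0)"
      by (simp only: sum.inter_filter[OF fin])
  qed
  also have "\<dots> = (\<Sum>x\<in>?PP. \<Sum>f\<in>{f \<in> monics n. fst x ^ snd x dvd f}. of_nat (degree (fst x)) * \<chi> f)"
    by (subst sum.swap) (simp only: sum.inter_filter[OF finite_monics])
  also have "\<dots> = (\<Sum>x\<in>?PP. ?t x)"
  proof (rule sum.cong[OF refl])
    fix x :: "'a poly \<times> nat" assume x: "x \<in> ?PP"
    then have P: "fst x \<in> monic_irreducibles" and le: "snd x * degree (fst x) \<le> n"
      by (auto simp: prime_powers_def)
    let ?h = "fst x ^ snd x"
    have P0: "fst x \<noteq> 0" using P by (auto simp: monic_irreducibles_def)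
    have h: "lead_coeff ?h = 1" "degree ?h = snd x * degree (fst x)"
    proof -
      have "lead_coeff (fst x) = 1" using P by (simp add: monic_irreducibles_def)
      then show "lead_coeff ?h = 1" by (simp only: lead_coeff_power power_one)
      show "degree ?h = snd x * degree (fst x)" by (rule degree_power_eq[OF P0])
    qed
    have "?h \<noteq> 0" using P0 by simp
    have inj: "inj_on (\<lambda>g. ?h * g) (monics (n - degree ?h))"
      using \<open>?h \<noteq> 0\<close> by (auto simp: inj_on_def)
    show "(\<Sum>f\<in>{f \<in> monics n. ?h dvd f}. of_nat (degree (fst x)) * \<chi> f) =
      ?t x"
      by (subst monics_multiples) (use h le inj in \<open>auto simp: sum.reindex mult pow coeff_sum_def
          sum_distrib_left mult.assoc\<close>)
  qed
  also have "\<dots> = (\<Sum>j=1..n. \<Sum>x\<in>prime_powers j. ?t x)"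
    by (rule sum.UNION_disjoint) (simp_all, auto simp: prime_powers_def)
  also have "\<dots> = (\<Sum>j=1..n. prime_power_sum \<chi> j * coeff_sum \<chi> (n - j))"
    by (rule sum.cong[OF refl], unfold prime_power_sum_def sum_distrib_right, rule sum.cong[OF refl])
       (auto simp: prime_powers_def)
  finally show ?thesis .
qed

section \<open>Exponents of residue class groups\<close>

definition residues_mod :: "'a::{field,finite} poly \<Rightarrow> 'a poly set" where
  "residues_mod a = {f. f = 0 \<or> degree f < degree a}"

lemma finite_residues_mod [simp]: "finite (residues_mod a)"
  using card_polys_degree_less(2)[of "degree a"] by (simp add: residues_mod_def)

lemma mod_in_residues [simp]: "a \<noteq> 0 \<Longrightarrow> f mod a \<in> residues_mod a"
  using degree_mod_less[of a f] by (auto simp: residues_mod_def)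

text \<open>Multiplication by \<open>f\<close> permutes the nonzero residues modulo \<open>P\<close>; compare the products.\<close>

lemma fermat_irreducible:
  fixes P f :: "'a::{field,finite} poly"
  assumes P: "irreducible P" and f: "\<not> P dvd f"
  shows "P dvd f ^ (CARD('a) ^ degree P - 1) - 1"
proof -
  let ?S = "residues_mod P - {0}"
  have P0: "P \<noteq> 0" using P by auto
  have prime: "prime_elem P" using P by (rule field_poly_irreducible_imp_prime)
  have zero: "0 \<in> residues_mod P" by (simp add: residues_mod_def)
  have card: "card ?S = CARD('a) ^ degree P - 1"
    using card_polys_degree_less(1)[of "degree P", where 'a = 'a] zero
    by (simp add: residues_mod_def)
  have ndvd: "\<not> P dvd r" if "r \<in> ?S" for r
    using that dvd_imp_degree_le[of P r] by (auto simp: residues_mod_def)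
  have inj: "inj_on (\<lambda>r. f * r mod P) ?S"
  proof (rule inj_onI)
    fix r s assume rs: "r \<in> ?S" "s \<in> ?S" "f * r mod P = f * s mod P"
    then have "P dvd f * r - f * s" by (simp only: mod_eq_dvd_iff)
    then have "P dvd r - s" using unit_mod_cancel irreducible_unit_mod(1)[OF P f] by blast
    moreover have "r - s = 0 \<or> degree (r - s) < degree P"
      using rs(1,2) degree_diff_less[of r "degree P" s] by (auto simp: residues_mod_def)
    ultimately show "r = s" using dvd_imp_degree_le[of P "r - s"] by fastforce
  qed
  have maps: "(\<lambda>r. f * r mod P) ` ?S \<subseteq> ?S"
  proof
    fix x assume "x \<in> (\<lambda>r. f * r mod P) ` ?S"
    then obtain r where r: "r \<in> ?S" "x = f * r mod P" by blast
    have "\<not> P dvd f * r" using f ndvd[OF r(1)] prime prime_elem_dvd_mult_iff by blast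
    then show "x \<in> ?S" using r(2) P0 by (auto simp: dvd_eq_mod_eq_0)
  qed
  have image: "(\<lambda>r. f * r mod P) ` ?S = ?S"
    using endo_inj_surj[OF _ maps inj] by simp
  have "P dvd (\<Prod>r\<in>B. f * r) - (\<Prod>r\<in>B. f * r mod P)" if "finite B" for B
    using that
  proof (induction B rule: finite_induct)
    case (insert r B)
    have "P dvd f * r - f * r mod P" by (simp add: minus_mod_eq_mult_div)
    from dvd_diff_mult[OF this insert.IH] show ?case using insert.hyps by simp
  qed simp
  then have "P dvd (\<Prod>r\<in>?S. f * r) - (\<Prod>r\<in>?S. f * r mod P)" by simp
  also have "(\<Prod>r\<in>?S. f * r mod P) = \<Prod>?S"
    using prod.reindex[OF inj, of "\<lambda>r. r"] unfolding image by simp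
  also have "(\<Prod>r\<in>?S. f * r) = f ^ (CARD('a) ^ degree P - 1) * \<Prod>?S"
    by (simp add: prod.distrib card)
  finally have "P dvd \<Prod>?S * f ^ (CARD('a) ^ degree P - 1) - \<Prod>?S * 1" by (simp add: mult.commute)
  moreover have "\<not> P dvd \<Prod>?S" using prime_elem_dvd_prod[OF prime, of "\<lambda>r. r" ?S] ndvd by auto
  ultimately show ?thesis using unit_mod_cancel irreducible_unit_mod(1)[OF P] by blast
qed

text \<open>The constants embed into the residues modulo the irreducible polynomial \<open>T\<close>.\<close>

lemma finite_field_power_card:
  fixes u :: "'a::{field,finite}"
  shows "u ^ CARD('a) = u"
proof (cases "u = 0")
  case False
  let ?X = "[:0, 1:] :: 'a poly"
  have "\<not> ?X dvd [:u:]" using dvd_imp_degree_le[of ?X "[:u:]"] False by auto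
  then have "?X dvd [:u:] ^ (CARD('a) - 1) - 1"
    using fermat_irreducible[of ?X "[:u:]"] irreducible_linear_field_poly[of "1 :: 'a" 0] by simp
  then have "poly ([:u:] ^ (CARD('a) - 1) - 1) 0 = 0" by (simp add: dvd_iff_poly_eq_0)
  then have "u ^ (CARD('a) - 1) = 1" by simp
  moreover have "u ^ CARD('a) = u * u ^ (CARD('a) - 1)"
    by (metis One_nat_def Suc_pred power_Suc zero_less_card_finite)
  ultimately show ?thesis by simp
qed (simp add: power_0_left)

text \<open>Both sides are values at \<open>w\<close> of monic polynomials of degree \<open>q\<close> over the polynomial ring, and both of these
vanish at the \<open>q\<close> constants.\<close>

lemma power_card_minus_self:
  fixes w :: "'a::{field,finite} poly"
  shows "w ^ CARD('a) - w = (\<Prod>u\<in>UNIV. w - [:u:])"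
proof -
  let ?q = "CARD('a)"
  define A :: "'a poly poly" where "A = [:0, 1:] ^ ?q - [:0, 1:]"
  define B :: "'a poly poly" where "B = (\<Prod>u\<in>UNIV. [:- [:u:], 1:])"
  have q: "?q > 1" by (rule card_field_gt_1)
  have degX: "degree ([:0, 1:] ^ ?q :: 'a poly poly) = ?q" by (simp add: degree_power_eq)
  have degA: "degree A = ?q"
    using q degX by (simp add: A_def diff_conv_add_uminus degree_add_eq_left del: add_uminus_conv_diff)
  have degB: "degree B = ?q"
    by (simp add: B_def degree_prod_eq_sum_degree)
  have lc: "coeff A ?q = 1" "coeff B ?q = 1"
  proof -
    have "lead_coeff ([:0, 1:] ^ ?q :: 'a poly poly) = 1" by (simp only: lead_coeff_power) simp
    moreover have "coeff ([:0, 1:] :: 'a poly poly) ?q = 0" using q by (intro coeff_eq_0) simp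
    ultimately show "coeff A ?q = 1" unfolding A_def by (simp only: degX coeff_diff diff_zero)
    have "lead_coeff B = 1" unfolding B_def by (simp only: lead_coeff_prod) simp
    then show "coeff B ?q = 1" by (simp only: degB)
  qed
  have "A - B = 0"
  proof (rule ccontr)
    assume ne: "A - B \<noteq> 0"
    have "degree (A - B) \<le> ?q" by (rule degree_diff_le) (simp_all add: degA degB)
    moreover have "degree (A - B) \<noteq> ?q"
    proof
      assume d: "degree (A - B) = ?q"
      have "lead_coeff (A - B) = 0" unfolding d using lc by simp
      then show False using ne leading_coeff_0_iff[of "A - B"] by blast
    qed
    ultimately have less: "degree (A - B) < ?q" by simp
    have "poly (A - B) [:u:] = 0" for u :: 'a
    proof -
      have "[:u:] ^ n = [:u ^ n:]" for n by (induction n) (auto simp: one_pCons)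
      then have "poly A [:u:] = 0" by (simp add: A_def finite_field_power_card)
      moreover have "poly B [:u:] = 0"
        unfolding B_def poly_prod by (rule prod_zero) (auto intro!: bexI[of _ u])
      ultimately show ?thesis by simp
    qed
    then have "range (\<lambda>u :: 'a. [:u:]) \<subseteq> {x. poly (A - B) x = 0}" by auto
    then have "card (range (\<lambda>u :: 'a. [:u:])) \<le> card {x. poly (A - B) x = 0}"
      by (intro card_mono poly_roots_finite ne)
    also have "\<dots> \<le> degree (A - B)" by (rule card_poly_roots_bound[OF ne])
    finally show False using less by (simp add: card_image inj_on_def)
  qed
  then have "poly A w = poly B w" by simp
  moreover have "poly [:- [:u:], 1:] w = w - [:u:]" for u
    by (simp only: poly_pCons poly_0 mult_zero_right add_0_right mult_1_right uminus_add_conv_diff)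
  then have "poly B w = (\<Prod>u\<in>UNIV. w - [:u:])" unfolding B_def poly_prod by (simp only:)
  ultimately show ?thesis by (simp add: A_def)
qed

text \<open>The factorization of \<open>w\<^sup>q - w\<close> does not change when \<open>w\<close> is translated by a constant.\<close>

lemma power_card_add_one:
  fixes w :: "'a::{field,finite} poly"
  shows "(w + 1) ^ CARD('a) = w ^ CARD('a) + 1"
proof -
  have "(w + 1) ^ CARD('a) - (w + 1) = (\<Prod>u\<in>UNIV. w + 1 - [:u:])" by (rule power_card_minus_self)
  also have "\<dots> = (\<Prod>u\<in>UNIV. w - [:u:])"
    by (rule prod.reindex_bij_witness[of _ "\<lambda>u. u + 1" "\<lambda>u. u - 1"]) (auto simp: one_pCons)
  also have "\<dots> = w ^ CARD('a) - w" by (rule power_card_minus_self[symmetric])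
  finally show ?thesis by (simp add: algebra_simps)
qed

lemma power_card_power_minus_one:
  fixes y :: "'a::{field,finite} poly"
  shows "y ^ (CARD('a) ^ j) - 1 = (y - 1) ^ (CARD('a) ^ j)"
proof (induction j)
  case (Suc j)
  have "y ^ (CARD('a) ^ Suc j) = (y ^ (CARD('a) ^ j)) ^ CARD('a)"
    by (simp only: power_mult[symmetric] power_Suc2)
  also have "\<dots> = (y ^ (CARD('a) ^ j) - 1) ^ CARD('a) + 1"
    using power_card_add_one[of "y ^ (CARD('a) ^ j) - 1"] by simp
  also have "\<dots> = ((y - 1) ^ (CARD('a) ^ j)) ^ CARD('a) + 1" by (simp only: Suc.IH)
  also have "\<dots> = (y - 1) ^ (CARD('a) ^ Suc j) + 1"
    by (simp only: power_mult[symmetric] power_Suc2)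
  finally show ?case by simp
qed simp

lemma dvd_power_degree:
  fixes c y :: "'a::field poly"
  assumes "c \<noteq> 0" "\<And>P. irreducible P \<Longrightarrow> P dvd c \<Longrightarrow> P dvd y"
  shows "c dvd y ^ degree c"
  using assms
proof (induction "degree c" arbitrary: c rule: less_induct)
  case less
  show ?case
  proof (cases "degree c = 0")
    case True
    then show ?thesis using less.prems(1) by (simp add: is_unit_iff_degree)
  next
    case False
    then obtain P where P: "irreducible P" "P dvd c" using irreducible_factor_exists by blast
    then obtain c' where c': "c = P * c'" by (auto elim: dvdE)
    have nz: "P \<noteq> 0" "c' \<noteq> 0" using less.prems(1) c' by auto
    have "degree P > 0" using P(1) nz(1) by (auto simp: irreducible_def is_unit_iff_degree)
    then have deg: "degree c' + 1 \<le> degree c" using nz by (simp add: c' degree_mult_eq)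
    have "c' dvd y ^ degree c'" using less.hyps[of c'] less.prems(2) deg nz(2) c' by auto
    then have "c dvd y ^ degree c' * y" using less.prems(2) P by (simp add: c' mult.commute mult_dvd_mono)
    also have "y ^ degree c' * y dvd y ^ degree c"
      using le_imp_power_dvd[OF deg, of y] by (simp add: mult.commute)
    finally show ?thesis .
  qed
qed

text \<open>By Fermat, \<open>z\<close> to the product of all \<open>q\<^sup>i - 1\<close> is \<open>1\<close> modulo each irreducible factor of \<open>c\<close>.  Raising to a
large power of \<open>q\<close>, which commutes with subtracting \<open>1\<close>, takes care of multiplicities.\<close>

lemma unit_mod_exponent:
  fixes c z :: "'a::{field,finite} poly"
  assumes c: "c \<noteq> 0" "degree c < n" and z: "unit_mod c z"
  shows "c dvd z ^ (CARD('a) ^ degree c * (\<Prod>i\<in>{1..<n}. CARD('a) ^ i - 1)) - 1"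
proof -
  let ?q = "CARD('a)" and ?\<Pi> = "\<Prod>i\<in>{1..<n}. CARD('a) ^ i - 1"
  have "P dvd z ^ ?\<Pi> - 1" if P: "irreducible P" "P dvd c" for P
  proof -
    have nz: "P \<noteq> 0" using P(1) by auto
    have "degree P > 0" using P(1) nz by (auto simp: irreducible_def is_unit_iff_degree)
    moreover have "degree P < n" using dvd_imp_degree_le[OF P(2) c(1)] c(2) by simp
    ultimately have "?q ^ degree P - 1 dvd ?\<Pi>" by (intro dvd_prodI) auto
    then obtain e where e: "?\<Pi> = (?q ^ degree P - 1) * e" by (auto elim: dvdE)
    have "\<not> P dvd z"
    proof
      assume "P dvd z"
      obtain g where g: "c dvd z * g - 1" using z by (auto simp: unit_mod_def)
      then have "P dvd z * g - 1" using P(2) by (rule dvd_trans[rotated])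
      then have "P dvd z * g - (z * g - 1)" by (rule dvd_diff[OF dvd_mult2[OF \<open>P dvd z\<close>]])
      then show False using P(1) by (simp add: irreducible_def)
    qed
    from dvd_diff_power[OF fermat_irreducible[OF P(1) this], of e] show ?thesis
      unfolding e by (simp add: power_mult)
  qed
  then have "c dvd (z ^ ?\<Pi> - 1) ^ degree c" by (intro dvd_power_degree c(1))
  also have "\<dots> dvd (z ^ ?\<Pi> - 1) ^ (?q ^ degree c)"
    using card_field_gt_1[where 'a = 'a] unfolding One_nat_def
    by (intro le_imp_power_dvd less_imp_le power_gt_expt)
  also have "\<dots> = z ^ (?q ^ degree c * ?\<Pi>) - 1"
    by (simp only: power_card_power_minus_one[symmetric] power_mult[symmetric] mult.commute)
  finally show ?thesis .
qed

lemma unit_mod_exponent_pos: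
  "CARD('a::{field,finite}) ^ d * (\<Prod>i\<in>{1..<n}. CARD('a) ^ i - 1) > 0"
proof -
  have "CARD('a) ^ i - 1 > 0" if "i \<in> {1..<n}" for i
    using that one_less_power[OF card_field_gt_1[where 'a = 'a], of i] by simp
  then have "(\<Prod>i\<in>{1..<n}. CARD('a) ^ i - 1) > 0" by (intro prod_pos) blast
  then show ?thesis by simp
qed

lemma unit_mod_exponent_exists:
  fixes a :: "'a::{field,finite} poly"
  assumes "a \<noteq> 0"
  obtains E where "E > 0" "\<And>f. unit_mod a f \<Longrightarrow> a dvd f ^ E - 1"
  using that unit_mod_exponent_pos unit_mod_exponent[OF assms lessI] by blast

section \<open>Dirichlet characters\<close>

definition dirichlet_characters :: "'a::field poly \<Rightarrow> ('a poly \<Rightarrow> complex) set" where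
  "dirichlet_characters a = {\<chi>. \<chi> 1 = 1 \<and> (\<forall>f g. \<chi> (f * g) = \<chi> f * \<chi> g) \<and>
     (\<forall>f g. a dvd f - g \<longrightarrow> \<chi> f = \<chi> g) \<and> (\<forall>f. \<not> unit_mod a f \<longrightarrow> \<chi> f = 0)}"

definition principal_character :: "'a::field poly \<Rightarrow> 'a poly \<Rightarrow> complex" where
  "principal_character a f = (if unit_mod a f then 1 else 0)"

lemma principal_character_in: "principal_character a \<in> dirichlet_characters a"
  using unit_mod_cong[of a] dvd_diff_sym[of a]
  by (auto simp: dirichlet_characters_def principal_character_def unit_mod_mult_iff)

lemma character_power:
  "\<chi> \<in> dirichlet_characters a \<Longrightarrow> \<chi> (f ^ n) = \<chi> f ^ n"
  by (induction n) (auto simp: dirichlet_characters_def)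

lemma character_root_of_unity:
  assumes "\<chi> \<in> dirichlet_characters a" "a dvd f ^ E - 1"
  shows "\<chi> f ^ E = 1"
proof -
  have "\<chi> f ^ E = \<chi> (f ^ E)" using assms(1) by (simp add: character_power)
  also have "\<dots> = 1" using assms by (auto simp: dirichlet_characters_def)
  finally show ?thesis .
qed

lemma character_norm:
  fixes a :: "'a::{field,finite} poly"
  assumes "\<chi> \<in> dirichlet_characters a" "a \<noteq> 0"
  shows "norm (\<chi> f) = (if unit_mod a f then 1 else 0)"
proof (cases "unit_mod a f")
  case True
  obtain E where E: "E > 0" "a dvd f ^ E - 1" using unit_mod_exponent_exists assms(2) True by metis
  then show ?thesis
    using True character_root_of_unity[OF assms(1) E(2)] power_eq_1_iff[of "\<chi> f" E] by auto
qed (use assms in \<open>auto simp: dirichlet_characters_def\<close>)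

lemma finite_dirichlet_characters:
  fixes a :: "'a::{field,finite} poly"
  assumes "a \<noteq> 0"
  shows "finite (dirichlet_characters a)"
proof -
  obtain E where E: "E > 0" "\<And>f. unit_mod a f \<Longrightarrow> a dvd f ^ E - 1"
    using unit_mod_exponent_exists[OF assms] by blast
  let ?V = "insert 0 {z::complex. z ^ E = 1}"
  have val: "\<chi> f \<in> ?V" if "\<chi> \<in> dirichlet_characters a" for \<chi> f
  proof (cases "unit_mod a f")
    case True
    then show ?thesis using character_root_of_unity[OF that E(2)] by simp
  qed (use that in \<open>auto simp: dirichlet_characters_def\<close>)
  have "inj_on (\<lambda>\<chi>. restrict \<chi> (residues_mod a)) (dirichlet_characters a)"
  proof (rule inj_onI, rule ext)
    fix \<chi> \<psi> f
    assume *: "\<chi> \<in> dirichlet_characters a" "\<psi> \<in> dirichlet_characters a"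
      "restrict \<chi> (residues_mod a) = restrict \<psi> (residues_mod a)"
    have "a dvd f - f mod a" by (simp add: minus_mod_eq_mult_div)
    then have "\<chi> f = \<chi> (f mod a)" "\<psi> f = \<psi> (f mod a)"
      using *(1,2) unfolding dirichlet_characters_def by blast+
    moreover have "\<chi> (f mod a) = \<psi> (f mod a)"
      using fun_cong[OF *(3), of "f mod a"] assms by simp
    ultimately show "\<chi> f = \<psi> f" by simp
  qed
  moreover have "(\<lambda>\<chi>. restrict \<chi> (residues_mod a)) ` dirichlet_characters a \<subseteq> (residues_mod a \<rightarrow>\<^sub>E ?V)"
  proof (rule image_subsetI, rule PiE_I)
    fix \<chi> f assume \<chi>: "\<chi> \<in> dirichlet_characters a"
    show "restrict \<chi> (residues_mod a) f \<in> ?V" if "f \<in> residues_mod a"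
      using val[OF \<chi>, of f] that by simp
    show "restrict \<chi> (residues_mod a) f = undefined" if "f \<notin> residues_mod a"
      using that by simp
  qed
  moreover have "finite (residues_mod a \<rightarrow>\<^sub>E ?V)"
    using E(1) by (intro finite_PiE) (auto intro: finite_roots_unity)
  ultimately show ?thesis by (meson finite_imageD finite_subset)
qed

text \<open>A character on a subgroup \<open>H\<close> of the reduced residue classes, where \<open>H\<close> is represented by the set of
all polynomials in these classes.\<close>

definition partial_character :: "'a::field poly \<Rightarrow> 'a poly set \<Rightarrow> ('a poly \<Rightarrow> complex) \<Rightarrow> bool" where
  "partial_character a H \<chi> \<longleftrightarrow> 1 \<in> H \<and> \<chi> 1 = 1 \<and>
     (\<forall>f\<in>H. unit_mod a f \<and> \<chi> f \<noteq> 0) \<and>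
     (\<forall>f\<in>H. \<forall>g\<in>H. f * g \<in> H \<and> \<chi> (f * g) = \<chi> f * \<chi> g) \<and>
     (\<forall>f\<in>H. \<forall>g. a dvd f - g \<longrightarrow> g \<in> H \<and> \<chi> g = \<chi> f)"

lemma partial_character_power:
  assumes "partial_character a H \<chi>" "f \<in> H"
  shows "f ^ n \<in> H \<and> \<chi> (f ^ n) = \<chi> f ^ n"
proof -
  have "1 \<in> H" "\<chi> 1 = 1" and
    "\<And>g. g \<in> H \<Longrightarrow> f * g \<in> H" "\<And>g. g \<in> H \<Longrightarrow> \<chi> (f * g) = \<chi> f * \<chi> g"
    using assms unfolding partial_character_def by blast+
  then show ?thesis by (induction n) simp_all
qed

text \<open>If \<open>g\<^sup>d\<close> is the least power of \<open>g\<close> in \<open>H\<close>, then every relation \<open>h g\<^sup>i = h' g\<^sup>j\<close> comes from \<open>g\<^sup>d \<in> H\<close>, so any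
\<open>d\<close>-th root of \<open>\<chi>(g\<^sup>d)\<close> is an admissible value at \<open>g\<close>.\<close>

lemma partial_character_extend:
  fixes a :: "'a::{field,finite} poly"
  assumes a: "a \<noteq> 0" and H: "partial_character a H \<chi>" and g: "unit_mod a g"
    and d: "d > 0" "g ^ d \<in> H" "\<And>e. e > 0 \<Longrightarrow> g ^ e \<in> H \<Longrightarrow> d \<le> e"
    and \<zeta>: "\<zeta> ^ d = \<chi> (g ^ d)"
  shows "\<exists>H' \<chi>'. partial_character a H' \<chi>' \<and> H \<subseteq> H' \<and> (\<forall>f\<in>H. \<chi>' f = \<chi> f) \<and>
    g \<in> H' \<and> \<chi>' g = \<zeta>"
proof -
  obtain E where E: "E > 0" "\<And>f. unit_mod a f \<Longrightarrow> a dvd f ^ E - 1"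
    using unit_mod_exponent_exists[OF a] by blast
  have H1: "1 \<in> H" "\<chi> 1 = 1" and Hu: "\<And>f. f \<in> H \<Longrightarrow> unit_mod a f" "\<And>f. f \<in> H \<Longrightarrow> \<chi> f \<noteq> 0"
    and Hm: "\<And>f g. f \<in> H \<Longrightarrow> g \<in> H \<Longrightarrow> f * g \<in> H" "\<And>f g. f \<in> H \<Longrightarrow> g \<in> H \<Longrightarrow> \<chi> (f * g) = \<chi> f * \<chi> g"
    and Hc: "\<And>f g. f \<in> H \<Longrightarrow> a dvd f - g \<Longrightarrow> g \<in> H" "\<And>f g. f \<in> H \<Longrightarrow> a dvd f - g \<Longrightarrow> \<chi> g = \<chi> f"
    using H unfolding partial_character_def by blast+
  note Hp = partial_character_power[OF H]
  have Hdiv: "g' \<in> H" if "h \<in> H" "h * g' \<in> H" for h g'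
  proof -
    have "h ^ E = h ^ (E - 1) * h" using E(1) by (metis Suc_diff_1 power_Suc2)
    then have "h ^ (E - 1) * (h * g') - g' = (h ^ E - 1) * g'" by (simp add: algebra_simps)
    then have "a dvd h ^ (E - 1) * (h * g') - g'" using E(2)[OF Hu(1)[OF that(1)]] by simp
    then show ?thesis using Hc(1) Hm(1) Hp[OF that(1)] that(2) by blast
  qed
  have ddvd: "d dvd m \<and> \<chi> (g ^ m) = \<zeta> ^ m" if "g ^ m \<in> H" for m
  proof -
    have m: "g ^ m = (g ^ d) ^ (m div d) * g ^ (m mod d)"
      by (simp only: power_mult[symmetric] power_add[symmetric] mult_div_mod_eq)
    then have "g ^ (m mod d) \<in> H" using Hdiv[of "(g ^ d) ^ (m div d)"] Hp[OF d(2)] that by simp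
    then have "m mod d = 0" using d(3)[of "m mod d"] d(1) mod_less_divisor[OF d(1), of m] by (metis leD neq0_conv)
    then have "d dvd m" "g ^ m = (g ^ d) ^ (m div d)" using m by auto
    moreover have "\<zeta> ^ m = (\<zeta> ^ d) ^ (m div d)" using \<open>d dvd m\<close> by (simp flip: power_mult)
    ultimately show ?thesis using Hp[OF d(2), of "m div d"] \<zeta> by simp
  qed
  let ?rel = "\<lambda>f h i. h \<in> H \<and> a dvd f - h * g ^ i"
  let ?H = "{f. \<exists>h i. ?rel f h i}"
  have wd0: "\<chi> h * \<zeta> ^ i = \<chi> h' * \<zeta> ^ j" if "?rel f h i" "?rel f h' j" "i \<le> j" for f h i h' j
  proof -
    have "a dvd h * g ^ i - h' * g ^ j"
      using that by (meson dvd_diff_sym dvd_diff_trans)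
    also have "h' * g ^ j = g ^ i * (h' * g ^ (j - i))"
      using that(3) by (simp add: mult.left_commute flip: power_add)
    finally have "a dvd g ^ i * h - g ^ i * (h' * g ^ (j - i))" by (simp add: mult.commute)
    then have c: "a dvd h - h' * g ^ (j - i)" using unit_mod_cancel unit_mod_power[OF g] by blast
    then have in1: "h' * g ^ (j - i) \<in> H" using Hc(1) that(1) by blast
    then have in2: "g ^ (j - i) \<in> H" using Hdiv that(2) by blast
    have "\<chi> h = \<chi> (h' * g ^ (j - i))" using Hc(2) c that(1) by metis
    also have "\<dots> = \<chi> h' * \<zeta> ^ (j - i)" using Hm(2)[of h'] in2 that(2) ddvd by auto
    finally show ?thesis using that(3) by (simp add: mult.assoc flip: power_add)
  qed
  have wd: "\<chi> h * \<zeta> ^ i = \<chi> h' * \<zeta> ^ j" if "?rel f h i" "?rel f h' j" for f h i h' j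
    using wd0[OF that] wd0[OF that(2,1)] by (cases "i \<le> j") auto
  define \<chi>' where "\<chi>' f = (SOME z. \<exists>h i. ?rel f h i \<and> z = \<chi> h * \<zeta> ^ i)" for f
  have \<chi>': "\<chi>' f = \<chi> h * \<zeta> ^ i" if "?rel f h i" for f h i
  proof -
    have "\<exists>z. \<exists>h i. ?rel f h i \<and> z = \<chi> h * \<zeta> ^ i" using that by blast
    from someI_ex[OF this, folded \<chi>'_def] obtain h' i' where r: "?rel f h' i'" "\<chi>' f = \<chi> h' * \<zeta> ^ i'"
      by blast
    show ?thesis using wd[OF r(1) that] r(2) by simp
  qed
  have \<zeta>0: "\<zeta> \<noteq> 0" using \<zeta> Hu(2)[OF d(2)] d(1) by (metis power_0_left neq0_conv zero_power)
  have "partial_character a ?H \<chi>'"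
    unfolding partial_character_def
  proof (intro conjI ballI allI impI)
    have r1: "?rel 1 1 0" using H1 by simp
    show "1 \<in> ?H" using r1 by blast
    show "\<chi>' 1 = 1" using \<chi>'[OF r1] H1 by simp
  next
    fix f assume "f \<in> ?H"
    then obtain h i where r: "?rel f h i" by blast
    have "unit_mod a (h * g ^ i)" using Hu r unit_mod_power[OF g] by (simp add: unit_mod_mult_iff)
    then show "unit_mod a f" using unit_mod_cong dvd_diff_sym r by blast
    show "\<chi>' f \<noteq> 0" using \<chi>'[OF r] Hu(2) r \<zeta>0 by simp
  next
    fix f f' assume "f \<in> ?H" "f' \<in> ?H"
    then obtain h i h' i' where r: "?rel f h i" "?rel f' h' i'" by blast
    have "a dvd f * f' - h * g ^ i * (h' * g ^ i')" using r by (intro dvd_diff_mult) auto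
    then have r': "?rel (f * f') (h * h') (i + i')" using r Hm(1) by (simp add: power_add mult_ac)
    then show "f * f' \<in> ?H" by blast
    show "\<chi>' (f * f') = \<chi>' f * \<chi>' f'"
      using \<chi>'[OF r'] \<chi>'[OF r(1)] \<chi>'[OF r(2)] Hm(2) r by (simp add: power_add)
  next
    fix f f' assume "f \<in> ?H" "a dvd f - f'"
    then obtain h i where r: "?rel f h i" "?rel f' h i" by (blast intro: dvd_diff_trans dvd_diff_sym)
    then show "f' \<in> ?H" by blast
    show "\<chi>' f' = \<chi>' f" using \<chi>'[OF r(1)] \<chi>'[OF r(2)] by simp
  qed
  moreover have "f \<in> ?H \<and> \<chi>' f = \<chi> f" if "f \<in> H" for f
  proof -
    have r: "?rel f f 0" using that by simp
    then have "f \<in> ?H" by blast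
    then show ?thesis using \<chi>'[OF r] by simp
  qed
  moreover have rg: "?rel g 1 1" using H1 by simp
  then have "g \<in> ?H" by blast
  moreover have "\<chi>' g = \<zeta>" using \<chi>'[OF rg] H1 by simp
  ultimately show ?thesis by blast
qed

lemma partial_character_least_power:
  fixes a :: "'a::{field,finite} poly"
  assumes a: "a \<noteq> 0" and H: "partial_character a H \<chi>" and g: "unit_mod a g"
  obtains d where "d > 0" "g ^ d \<in> H" "\<And>e. e > 0 \<Longrightarrow> g ^ e \<in> H \<Longrightarrow> d \<le> e"
proof -
  obtain E where E: "E > 0" "a dvd g ^ E - 1" using unit_mod_exponent_exists[OF a] g by metis
  have "1 \<in> H" and cong: "\<And>f f'. f \<in> H \<Longrightarrow> a dvd f - f' \<Longrightarrow> f' \<in> H"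
    using H unfolding partial_character_def by blast+
  then have gE: "E > 0 \<and> g ^ E \<in> H" using cong[of 1 "g ^ E"] dvd_diff_sym[OF E(2)] E(1) by simp
  define d where "d = (LEAST e. e > 0 \<and> g ^ e \<in> H)"
  have "d > 0 \<and> g ^ d \<in> H" unfolding d_def by (rule LeastI[of _ E]) (rule gE)
  moreover have "d \<le> e" if "e > 0" "g ^ e \<in> H" for e
    unfolding d_def using that by (intro Least_le) simp
  ultimately show thesis using that by blast
qed

text \<open>Extending one element at a time, the number of missing residue classes decreases.\<close>

lemma partial_character_imp_character:
  fixes a :: "'a::{field,finite} poly"
  assumes a: "a \<noteq> 0" and H: "partial_character a H \<chi>" and g: "g \<in> H"
  shows "\<exists>\<psi>\<in>dirichlet_characters a. \<psi> g = \<chi> g"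
  using H g
proof (induction "card {f \<in> residues_mod a. unit_mod a f \<and> f \<notin> H}" arbitrary: H \<chi> rule: less_induct)
  case less
  have "\<exists>\<psi>\<in>dirichlet_characters a. \<psi> g = \<chi> g" if all: "\<forall>f. unit_mod a f \<longrightarrow> f \<in> H"
  proof -
    let ?\<psi> = "\<lambda>f. if unit_mod a f then \<chi> f else 0"
    have cong: "unit_mod a f \<longleftrightarrow> unit_mod a g" if "a dvd f - g" for f g
      using that unit_mod_cong dvd_diff_sym by blast
    have "\<chi> 1 = 1" "unit_mod a g" and m: "\<And>f g. f \<in> H \<Longrightarrow> g \<in> H \<Longrightarrow> \<chi> (f * g) = \<chi> f * \<chi> g"
      and c: "\<And>f g. f \<in> H \<Longrightarrow> a dvd f - g \<Longrightarrow> \<chi> g = \<chi> f"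
      using less.prems unfolding partial_character_def by blast+
    have in_chars: "?\<psi> \<in> dirichlet_characters a"
      unfolding dirichlet_characters_def mem_Collect_eq
    proof (intro conjI allI impI)
      show "?\<psi> 1 = 1" using \<open>\<chi> 1 = 1\<close> by simp
      show "?\<psi> (f * f') = ?\<psi> f * ?\<psi> f'" for f f'
        using m[of f f'] all by (simp add: unit_mod_mult_iff)
      show "?\<psi> f = ?\<psi> f'" if "a dvd f - f'" for f f'
        using c[of f f'] cong[OF that] all that by simp
      show "?\<psi> f = 0" if "\<not> unit_mod a f" for f using that by simp
    qed
    show ?thesis
      by (rule bexI[OF _ in_chars]) (simp add: \<open>unit_mod a g\<close>)
  qed
  moreover have "\<exists>\<psi>\<in>dirichlet_characters a. \<psi> g = \<chi> g" if f: "unit_mod a f" "f \<notin> H" for f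
  proof -
    obtain d where d: "d > 0" "f ^ d \<in> H" "\<And>e. e > 0 \<Longrightarrow> f ^ e \<in> H \<Longrightarrow> d \<le> e"
      using partial_character_least_power[OF a less.prems(1) f(1)] by blast
    obtain \<zeta> where \<zeta>: "\<zeta> ^ d = \<chi> (f ^ d)"
      using d(1) using nth_root_exists[of d "\<chi> (f ^ d)"] by blast
    obtain H' \<chi>' where H': "partial_character a H' \<chi>'" "H \<subseteq> H'" "\<forall>f\<in>H. \<chi>' f = \<chi> f" "f \<in> H'"
      using partial_character_extend[OF a less.prems(1) f(1) d \<zeta>] by blast
    have closed: "g' \<in> K" if "partial_character a K \<phi>" "f' \<in> K" "a dvd f' - g'" for K \<phi> f' g'
      using that unfolding partial_character_def by blast
    have res: "f mod a \<in> residues_mod a" "a dvd f - f mod a" using a by (simp_all add: minus_mod_eq_mult_div)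
    have "unit_mod a (f mod a)" using unit_mod_cong[OF res(2) f(1)] .
    moreover have "f mod a \<in> H'" using closed[OF H'(1) H'(4) res(2)] .
    moreover have "f mod a \<notin> H" using closed[OF less.prems(1) _ dvd_diff_sym[OF res(2)]] f(2) by blast
    moreover note res(1)
    ultimately have "{f \<in> residues_mod a. unit_mod a f \<and> f \<notin> H'} \<subset>
        {f \<in> residues_mod a. unit_mod a f \<and> f \<notin> H}"
      using H'(2) by blast
    then have "card {f \<in> residues_mod a. unit_mod a f \<and> f \<notin> H'} <
        card {f \<in> residues_mod a. unit_mod a f \<and> f \<notin> H}"
      by (intro psubset_card_mono) auto
    then obtain \<psi> where "\<psi> \<in> dirichlet_characters a" "\<psi> g = \<chi>' g"
      using less.hyps[OF _ H'(1)] H'(2) less.prems(2) by blast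
    then show ?thesis using H'(3) less.prems(2) by auto
  qed
  ultimately show ?case by blast
qed

text \<open>On the subgroup generated by \<open>g\<close> there is a character with value \<open>cis (2 * pi / d)\<close> at \<open>g\<close>, where \<open>d > 1\<close> is
the order of \<open>g\<close>; it extends to all residue classes.\<close>

lemma character_separates:
  fixes a :: "'a::{field,finite} poly"
  assumes a: "a \<noteq> 0" and g: "unit_mod a g" "\<not> a dvd g - 1"
  shows "\<exists>\<psi>\<in>dirichlet_characters a. \<psi> g \<noteq> 1"
proof -
  let ?H = "{f. a dvd f - 1}"
  have u: "unit_mod a f" if "a dvd f - 1" for f
    using unit_mod_cong[OF dvd_diff_sym[OF that]] by simp
  have m: "a dvd f * g - 1" if "a dvd f - 1" "a dvd g - 1" for f g
    using dvd_diff_mult[OF that] by simp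
  have c: "a dvd g - 1" if "a dvd f - 1" "a dvd f - g" for f g
    using dvd_diff_trans[OF dvd_diff_sym[OF that(2)] that(1)] .
  have H: "partial_character a ?H (\<lambda>_. 1)"
    unfolding partial_character_def using u m c by auto
  obtain d where d: "d > 0" "g ^ d \<in> ?H" "\<And>e. e > 0 \<Longrightarrow> g ^ e \<in> ?H \<Longrightarrow> d \<le> e"
    using partial_character_least_power[OF a H g(1)] by blast
  have "d \<noteq> 1" using d(2) g(2) by auto
  then have "d > 1" using d(1) by simp
  define \<zeta> where "\<zeta> = cis (2 * pi / d)"
  have "\<zeta> ^ d = 1" using d(1) by (simp add: \<zeta>_def DeMoivre)
  moreover have "\<zeta> \<noteq> 1"
  proof
    assume "\<zeta> = 1"
    then have "cos (2 * pi / d) = 1" by (simp add: \<zeta>_def complex_eq_iff)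
    then obtain m :: int where m: "2 * pi / d = m * 2 * pi" by (auto simp: cos_one_2pi_int)
    have "0 < 2 * pi / d" "2 * pi / d < 2 * pi" using \<open>d > 1\<close> by (auto simp: field_simps)
    then have "0 < real_of_int m * (2 * pi)" "real_of_int m * (2 * pi) < 1 * (2 * pi)"
      unfolding m by (simp_all add: mult.assoc)
    then have "0 < m" "m < 1" using pi_gt_zero by (simp_all add: zero_less_mult_iff)
    then show False by simp
  qed
  ultimately obtain H' \<chi>' where H': "partial_character a H' \<chi>'" "g \<in> H'" "\<chi>' g = \<zeta>"
    using partial_character_extend[OF a H g(1) d, of \<zeta>] by auto
  obtain \<psi> where "\<psi> \<in> dirichlet_characters a" "\<psi> g = \<chi>' g"
    using partial_character_imp_character[OF a H'(1,2)] by blast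
  then show ?thesis using H'(3) \<open>\<zeta> \<noteq> 1\<close> by (intro bexI[of _ \<psi>]) auto
qed

lemma character_mult_closed:
  "\<chi> \<in> dirichlet_characters a \<Longrightarrow> \<psi> \<in> dirichlet_characters a \<Longrightarrow> (\<lambda>f. \<chi> f * \<psi> f) \<in> dirichlet_characters a"
  by (auto simp: dirichlet_characters_def)

lemma character_cnj_closed:
  "\<chi> \<in> dirichlet_characters a \<Longrightarrow> (\<lambda>f. cnj (\<chi> f)) \<in> dirichlet_characters a"
  by (auto simp: dirichlet_characters_def)

text \<open>Multiplication by a character \<open>\<psi>\<close> permutes the characters and multiplies the sum by \<open>\<psi> g\<close>; if \<open>g\<close> is
not \<open>1\<close> modulo \<open>a\<close>, then \<open>\<psi>\<close> can be chosen such that this factor is not \<open>1\<close>.\<close>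

lemma character_orthogonality:
  fixes a :: "'a::{field,finite} poly"
  assumes a: "a \<noteq> 0"
  shows "(\<Sum>\<chi>\<in>dirichlet_characters a. \<chi> g) =
    (if a dvd g - 1 then of_nat (card (dirichlet_characters a)) else 0)"
proof -
  let ?X = "dirichlet_characters a"
  let ?S = "\<Sum>\<chi>\<in>?X. \<chi> g"
  show ?thesis
  proof (cases "a dvd g - 1")
    case True
    then have "\<chi> g = 1" if "\<chi> \<in> ?X" for \<chi>
      using that by (auto simp: dirichlet_characters_def)
    then have "?S = (\<Sum>\<chi>\<in>?X. 1)"
      by (intro sum.cong) auto
    then show ?thesis using True by simp
  next
    case False
    have "?S = 0"
    proof (cases "unit_mod a g")
      case True
      then obtain \<psi> where \<psi>: "\<psi> \<in> ?X" "\<psi> g \<noteq> 1"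
        using character_separates[OF a True False] by blast
      have cancel: "\<psi> f * cnj (\<psi> f) * \<chi> f = \<chi> f" "cnj (\<psi> f) * \<psi> f * \<chi> f = \<chi> f"
        if "\<chi> \<in> ?X" for \<chi> f
      proof -
        have "unit_mod a f \<or> \<chi> f = 0" using that by (auto simp: dirichlet_characters_def)
        moreover have "\<psi> f * cnj (\<psi> f) = 1" if "unit_mod a f"
          using character_norm[OF \<psi>(1) a, of f] that by (simp add: complex_norm_square[symmetric])
        ultimately show "\<psi> f * cnj (\<psi> f) * \<chi> f = \<chi> f" "cnj (\<psi> f) * \<psi> f * \<chi> f = \<chi> f"
          by (auto simp: mult.commute)
      qed
      have "?S = (\<Sum>\<chi>\<in>?X. \<psi> g * \<chi> g)"
        by (rule sum.reindex_bij_witness[of _ "\<lambda>\<chi> f. \<psi> f * \<chi> f" "\<lambda>\<chi> f. cnj (\<psi> f) * \<chi> f"])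
           (use cancel character_mult_closed[OF \<psi>(1)] character_mult_closed[OF character_cnj_closed[OF \<psi>(1)]] in
             \<open>auto simp: mult.assoc[symmetric]\<close>)
      also have "\<dots> = \<psi> g * ?S"
        by (simp add: sum_distrib_left)
      finally have "(\<psi> g - 1) * ?S = 0"
        by (simp add: left_diff_distrib)
      then show ?thesis using \<psi>(2) by simp
    next
      case False
      then show ?thesis by (auto simp: dirichlet_characters_def intro: sum.neutral)
    qed
    then show ?thesis using False by simp
  qed
qed

text \<open>In degrees \<open>n \<ge> degree a\<close> a monic polynomial may have any residue modulo \<open>a\<close>, so the residues can be
multiplied by some \<open>g\<close> with \<open>\<chi> g \<noteq> 1\<close>.  Hence \<open>L(u, \<chi>)\<close> is a polynomial of degree less than \<open>degree a\<close>.\<close>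

lemma coeff_sum_nonprincipal_zero:
  fixes a :: "'a::{field,finite} poly"
  assumes a: "a \<noteq> 0" and \<chi>: "\<chi> \<in> dirichlet_characters a" "\<chi> \<noteq> principal_character a"
    and n: "degree a \<le> n"
  shows "coeff_sum \<chi> n = 0"
proof -
  have mult: "\<chi> (f * g) = \<chi> f * \<chi> g" and cong: "a dvd f - g \<Longrightarrow> \<chi> f = \<chi> g" for f g
    using \<chi>(1) by (auto simp: dirichlet_characters_def)
  obtain g where "\<chi> g \<noteq> principal_character a g" using \<chi>(2) by blast
  then have g: "unit_mod a g" "\<chi> g \<noteq> 1"
    using \<chi>(1) by (auto simp: principal_character_def dirichlet_characters_def split: if_splits)
  then obtain h where h: "a dvd g * h - 1" by (auto simp: unit_mod_def)
  \<comment> \<open>\<open>\<sigma> g\<close> multiplies the residue by \<open>g\<close> and does not touch the coefficients from \<open>degree a\<close> on.\<close>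
  define \<sigma> where "\<sigma> g f = f - f mod a + g * f mod a" for g f
  have \<sigma>mod: "\<sigma> g f mod a = g * f mod a" for g f
    unfolding \<sigma>_def by (simp add: mod_eq_dvd_iff minus_mod_eq_mult_div)
  have \<sigma>monic: "\<sigma> g f \<in> monics n" if "f \<in> monics n" for g f
  proof -
    let ?r = "g * f mod a - f mod a"
    have "g * f mod a \<in> residues_mod a" "f mod a \<in> residues_mod a" using a by auto
    then have small: "coeff ?r k = 0" if "k \<ge> degree a" for k
      using that by (auto simp: residues_mod_def coeff_eq_0)
    have eq: "\<sigma> g f = f + ?r" by (simp add: \<sigma>_def)
    have "coeff (f + ?r) k = 0" if "k > n" for k
      using that \<open>f \<in> monics n\<close> small[of k] n by (auto simp: monics_def coeff_eq_0)
    moreover have "coeff (f + ?r) n = 1"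
      using \<open>f \<in> monics n\<close> small[of n] n by (auto simp: monics_def)
    ultimately show ?thesis unfolding eq monics_def
      by (metis (mono_tags, lifting) degree_le le_antisym le_degree mem_Collect_eq one_neq_zero)
  qed
  have \<sigma>\<sigma>: "\<sigma> h' (\<sigma> g' f) = f" if "a dvd g' * h' - 1" for f g' h'
  proof -
    have "h' * \<sigma> g' f mod a = h' * (\<sigma> g' f mod a) mod a" by (simp add: mod_mult_right_eq)
    also have "\<dots> = h' * (g' * f) mod a" unfolding \<sigma>mod by (simp add: mod_mult_right_eq)
    also have "\<dots> = f mod a"
    proof -
      have "h' * (g' * f) - f = (g' * h' - 1) * f" by (simp add: algebra_simps)
      then show ?thesis using that by (simp add: mod_eq_dvd_iff)
    qed
    finally have "h' * \<sigma> g' f mod a = f mod a" .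
    then show ?thesis unfolding \<sigma>_def[of h'] \<sigma>mod by (simp add: \<sigma>_def)
  qed
  have "coeff_sum \<chi> n = (\<Sum>f\<in>monics n. \<chi> (\<sigma> g f))"
    unfolding coeff_sum_def
    by (rule sum.reindex_bij_witness[of _ "\<sigma> g" "\<sigma> h"])
       (use h \<sigma>monic \<sigma>\<sigma>[of g h] \<sigma>\<sigma>[of h g] in \<open>auto simp: mult.commute[of h g]\<close>)
  also have "\<dots> = (\<Sum>f\<in>monics n. \<chi> g * \<chi> f)"
  proof (rule sum.cong[OF refl])
    fix f
    have "a dvd \<sigma> g f - g * f" using \<sigma>mod[of g f] by (simp only: mod_eq_dvd_iff)
    then show "\<chi> (\<sigma> g f) = \<chi> g * \<chi> f" using cong mult by metis
  qed
  also have "\<dots> = \<chi> g * coeff_sum \<chi> n"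
    by (simp add: coeff_sum_def sum_distrib_left)
  finally have "(\<chi> g - 1) * coeff_sum \<chi> n = 0"
    by (simp add: left_diff_distrib)
  then show ?thesis using g(2) by simp
qed

section \<open>Power sums and logarithmic derivatives\<close>

lemma convergent_subsequence_complex:
  fixes f :: "nat \<Rightarrow> complex"
  assumes f: "\<And>n. norm (f n) \<le> 1"
  shows "\<exists>r :: nat \<Rightarrow> nat. strict_mono r \<and> convergent (\<lambda>n. f (r n))"
proof -
  have bRe: "\<bar>Re (f n)\<bar> \<le> 1" and bIm: "\<bar>Im (f n)\<bar> \<le> 1" for n
    using f[of n] abs_Re_le_cmod[of "f n"] abs_Im_le_cmod[of "f n"] by linarith+
  obtain r :: "nat \<Rightarrow> nat" where r: "strict_mono r" "monoseq (\<lambda>n. Re (f (r n)))"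
    using seq_monosub[of "\<lambda>n. Re (f n)"] by blast
  obtain s :: "nat \<Rightarrow> nat" where s: "strict_mono s" "monoseq (\<lambda>n. Im (f (r (s n))))"
    using seq_monosub[of "\<lambda>n. Im (f (r n))"] by blast
  have "convergent (\<lambda>n. Re (f (r n)))"
    using bRe by (intro Bseq_monoseq_convergent BseqI'[of _ 1] r(2)) simp
  then have "convergent (\<lambda>n. Re (f (r (s n))))"
    using convergent_subseq_convergent[OF _ s(1), of "\<lambda>n. Re (f (r n))"] by (simp add: o_def)
  moreover have "convergent (\<lambda>n. Im (f (r (s n))))"
    using bIm by (intro Bseq_monoseq_convergent BseqI'[of _ 1] s(2)) simp
  ultimately obtain x y where "(\<lambda>n. Re (f (r (s n)))) \<longlonglongrightarrow> x" "(\<lambda>n. Im (f (r (s n)))) \<longlonglongrightarrow> y"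
    by (auto simp: convergent_def)
  then have "(\<lambda>n. Complex (Re (f (r (s n)))) (Im (f (r (s n))))) \<longlonglongrightarrow> Complex x y"
    by (rule tendsto_Complex)
  then have "convergent (\<lambda>n. f ((r \<circ> s) n))" by (auto simp: convergent_def)
  then show ?thesis using strict_mono_o[OF r(1) s(1)] by blast
qed

text \<open>Compactness of the unit circle, applied to one number after the other.\<close>

lemma simultaneous_convergent_powers:
  fixes U :: "complex set"
  assumes "finite U" "\<And>u. u \<in> U \<Longrightarrow> norm u = 1"
  shows "\<exists>r :: nat \<Rightarrow> nat. strict_mono r \<and> (\<forall>u\<in>U. convergent (\<lambda>n. u ^ r n))"
  using assms
proof (induction U rule: finite_induct)
  case empty
  then show ?case by (auto intro: exI[of _ id] simp: strict_mono_def)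
next
  case (insert u U)
  then obtain r :: "nat \<Rightarrow> nat" where r: "strict_mono r" "\<forall>u\<in>U. convergent (\<lambda>n. u ^ r n)" by auto
  obtain s where s: "strict_mono s" "convergent (\<lambda>n. u ^ r (s n))"
    using convergent_subsequence_complex[of "\<lambda>n. u ^ r n"] insert.prems[of u] by (auto simp: norm_power)
  have "convergent (\<lambda>n. v ^ r (s n))" if "v \<in> U" for v
    using r(2) that convergent_subseq_convergent[OF _ s(1), of "\<lambda>n. v ^ r n"] by (auto simp: o_def)
  then show ?case using strict_mono_o[OF r(1) s(1)] s(2)
    by (intro exI[of _ "r \<circ> s"]) (auto simp: o_def)
qed

text \<open>Along a sequence of exponents with convergent powers, differences of late exponents give powers
close to \<open>1\<close>.\<close>

lemma simultaneous_power_recurrence: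
  fixes U :: "complex set"
  assumes U: "finite U" "\<And>u. u \<in> U \<Longrightarrow> norm u = 1" and "\<epsilon> > 0"
  shows "\<exists>n\<ge>N. \<forall>u\<in>U. norm (u ^ n - 1) < \<epsilon>"
proof -
  obtain r :: "nat \<Rightarrow> nat" where r: "strict_mono r" "\<forall>u\<in>U. convergent (\<lambda>n. u ^ r n)"
    using simultaneous_convergent_powers[OF U] by blast
  have "\<forall>u\<in>U. \<exists>M. \<forall>m\<ge>M. \<forall>n\<ge>M. norm (u ^ r m - u ^ r n) < \<epsilon>"
    using r(2) \<open>\<epsilon> > 0\<close> by (meson CauchyD convergent_Cauchy)
  then obtain M where M: "\<And>u m n. u \<in> U \<Longrightarrow> m \<ge> M u \<Longrightarrow> n \<ge> M u \<Longrightarrow> norm (u ^ r m - u ^ r n) < \<epsilon>"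
    by metis
  define m where "m = Max (insert 0 (M ` U))"
  have m: "M u \<le> m" if "u \<in> U" for u using that U(1) by (auto simp: m_def)
  have gap: "r (m + k) \<ge> r m + k" for k
  proof (induction k)
    case (Suc k)
    then show ?case using strict_monoD[OF r(1), of "m + k" "m + Suc k"] by simp
  qed simp
  show ?thesis
  proof (intro exI conjI ballI)
    show "r (m + N) - r m \<ge> N" using gap[of N] by simp
    fix u assume u: "u \<in> U"
    have "u ^ r (m + N) - u ^ r m = u ^ r m * (u ^ (r (m + N) - r m) - 1)"
      using gap[of N] by (simp add: algebra_simps flip: power_add)
    then have "norm (u ^ (r (m + N) - r m) - 1) = norm (u ^ r (m + N) - u ^ r m)"
      using U(2)[OF u] by (simp add: norm_mult norm_power)
    then show "norm (u ^ (r (m + N) - r m) - 1) < \<epsilon>"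
      using M[OF u] m[OF u] by simp
  qed
qed

lemma eventually_less_power:
  fixes x :: real
  assumes "x > 1"
  shows "eventually (\<lambda>n. B < x ^ n) sequentially"
proof -
  obtain N where N: "B < x ^ N" using real_arch_pow[OF assms] by blast
  have "B < x ^ n" if "n \<ge> N" for n
    using N power_increasing[OF that, of x] assms by linarith
  then show ?thesis by (auto simp: eventually_sequentially)
qed

text \<open>There are arbitrarily large exponents \<open>n\<close> for which all \<open>(\<rho> / |\<rho>|)\<^sup>n\<close> are close to \<open>1\<close>, so that no cancellation
takes place.  For these, an element with \<open>|\<rho>| > q\<close> makes the sum grow too fast, and two
elements with \<open>|\<rho>| \<ge> q\<close> contribute at least \<open>3 / 2 * q\<^sup>n\<close>.\<close>

lemma power_sum_growth:
  fixes \<Omega> :: "complex multiset" and q :: real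
  assumes q: "q > 1" and bound: "\<And>n. n \<ge> 1 \<Longrightarrow> Re (\<Sum>\<rho>\<in>#\<Omega>. \<rho> ^ n) \<le> q ^ n + C"
  shows "\<rho> \<in># \<Omega> \<Longrightarrow> norm \<rho> \<le> q" and "size {#\<rho> \<in># \<Omega>. norm \<rho> \<ge> q#} \<le> 1"
proof -
  have sub: "\<exists>n\<ge>N. 3 / 4 * (\<Sum>\<rho>\<in>#B. norm \<rho> ^ n) \<le> q ^ n + C" if B: "B \<subseteq># \<Omega>" for B N
  proof -
    let ?U = "(\<lambda>\<rho>. sgn \<rho>) ` (set_mset \<Omega> - {0})"
    obtain n where n: "n \<ge> max N 1" "\<And>u. u \<in> ?U \<Longrightarrow> norm (u ^ n - 1) < 1 / 4"
    proof -
      have "norm u = 1" if "u \<in> ?U" for u using that by (auto simp: norm_sgn split: if_splits)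
      then show thesis using simultaneous_power_recurrence[of ?U "1/4" "max N 1"] that by auto
    qed
    have re: "3 / 4 * norm \<rho> ^ n \<le> Re (\<rho> ^ n)" if "\<rho> \<in># \<Omega>" for \<rho>
    proof (cases "\<rho> = 0")
      case False
      have "\<rho> = of_real (norm \<rho>) * sgn \<rho>" using False by (simp add: sgn_eq)
      then have "\<rho> ^ n = of_real (norm \<rho> ^ n) * sgn \<rho> ^ n"
        by (metis of_real_power power_mult_distrib)
      then have "Re (\<rho> ^ n) = norm \<rho> ^ n * Re (sgn \<rho> ^ n)"
        by (simp del: of_real_power)
      moreover have "Re (sgn \<rho> ^ n) \<ge> 3 / 4"
      proof -
        have "norm (sgn \<rho> ^ n - 1) < 1 / 4" using n(2)[of "sgn \<rho>"] that False by auto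
        then have "\<bar>Re (sgn \<rho> ^ n - 1)\<bar> < 1 / 4"
          using abs_Re_le_cmod[of "sgn \<rho> ^ n - 1"] by linarith
        then show ?thesis by (simp add: abs_if split: if_splits)
      qed
      ultimately show ?thesis
        using mult_left_mono[of "3/4" "Re (sgn \<rho> ^ n)" "norm \<rho> ^ n"] by (simp add: mult.commute)
    qed (use n in \<open>simp add: power_0_left\<close>)
    obtain A where A: "\<Omega> = B + A" using B by (auto simp: mset_subset_eq_exists_conv)
    have Re_sum: "Re (\<Sum>\<rho>\<in>#A. \<rho> ^ n) = (\<Sum>\<rho>\<in>#A. Re (\<rho> ^ n))" for A
      by (induction A) auto
    have le: "(\<Sum>\<rho>\<in>#A. 3 / 4 * norm \<rho> ^ n) \<le> (\<Sum>\<rho>\<in>#A. Re (\<rho> ^ n))" if "A \<subseteq># \<Omega>" for A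
      using re that by (intro sum_mset_mono) (auto dest: mset_subset_eqD)
    have "3 / 4 * (\<Sum>\<rho>\<in>#B. norm \<rho> ^ n) = (\<Sum>\<rho>\<in>#B. 3 / 4 * norm \<rho> ^ n)"
      by (induction B) (simp_all add: algebra_simps)
    also have "\<dots> \<le> (\<Sum>\<rho>\<in>#B. 3 / 4 * norm \<rho> ^ n) + (\<Sum>\<rho>\<in>#A. 3 / 4 * norm \<rho> ^ n)"
    proof -
      have "0 \<le> (\<Sum>\<rho>\<in>#A. 3 / 4 * norm \<rho> ^ n)" by (induction A) auto
      then show ?thesis by simp
    qed
    also have "\<dots> = (\<Sum>\<rho>\<in>#\<Omega>. 3 / 4 * norm \<rho> ^ n)" unfolding A by simp
    also have "\<dots> \<le> Re (\<Sum>\<rho>\<in>#\<Omega>. \<rho> ^ n)" unfolding Re_sum by (rule le) simp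
    also have "\<dots> \<le> q ^ n + C" using bound n(1) by simp
    finally show ?thesis using n(1) by auto
  qed
  have C: "eventually (\<lambda>n. C < \<delta> * q ^ n) sequentially" if "\<delta> > 0" for \<delta>
  proof -
    have ?thesis using eventually_less_power[OF q, of "C / \<delta>"] that by (simp add: field_simps)
    then show ?thesis .
  qed
  show "norm \<rho> \<le> q" if mem: "\<rho> \<in># \<Omega>"
  proof (rule ccontr)
    assume "\<not> norm \<rho> \<le> q"
    then have gt: "norm \<rho> / q > 1" using q by simp
    have "eventually (\<lambda>n. (norm \<rho> / q) ^ n > 4) sequentially"
      using eventually_less_power[OF gt] by simp
    moreover have "eventually (\<lambda>n. C < q ^ n) sequentially" using C[of 1] by simp
    ultimately have "eventually (\<lambda>n. (norm \<rho> / q) ^ n > 4 \<and> C < q ^ n) sequentially"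
      by (rule eventually_conj)
    then obtain N where N: "\<And>n. n \<ge> N \<Longrightarrow> (norm \<rho> / q) ^ n > 4 \<and> C < q ^ n"
      by (auto simp: eventually_sequentially)
    obtain n where n: "n \<ge> N" "3 / 4 * norm \<rho> ^ n \<le> q ^ n + C"
      using sub[of "{#\<rho>#}" N] mem by auto
    have "norm \<rho> ^ n > 4 * q ^ n" using N[OF n(1)] q by (simp add: power_divide field_simps)
    moreover have "q ^ n > 0" using q by simp
    ultimately show False using n(2) N[OF n(1)] by linarith
  qed
  show "size {#\<rho> \<in># \<Omega>. norm \<rho> \<ge> q#} \<le> 1"
  proof (rule ccontr)
    let ?B = "{#\<rho> \<in># \<Omega>. norm \<rho> \<ge> q#}"
    assume "\<not> size ?B \<le> 1"
    then have 2: "real (size ?B) \<ge> 2" by simp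
    from C[of "1/4"] obtain N where N: "\<And>n. n \<ge> N \<Longrightarrow> C < q ^ n / 4"
      by (auto simp: eventually_sequentially)
    obtain n where n: "n \<ge> N" "3 / 4 * (\<Sum>\<rho>\<in>#?B. norm \<rho> ^ n) \<le> q ^ n + C"
      using sub[of ?B N] by auto
    have "(\<Sum>\<rho>\<in>#?B. q ^ n) \<le> (\<Sum>\<rho>\<in>#?B. norm \<rho> ^ n)"
      using q by (intro sum_mset_mono power_mono) auto
    then have "real (size ?B) * q ^ n \<le> (\<Sum>\<rho>\<in>#?B. norm \<rho> ^ n)" by simp
    moreover have "2 * q ^ n \<le> real (size ?B) * q ^ n" using 2 q by (intro mult_right_mono) auto
    moreover have "q ^ n > 0" using q by simp
    ultimately show False using n(2) N[OF n(1)] by linarith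
  qed
qed

text \<open>The identity \<open>u L' = C L\<close> between the power series with coefficients \<open>l\<close> and \<open>c\<close>, normalized by
\<open>L(0) = 1\<close>.\<close>

definition log_derivative_pair :: "(nat \<Rightarrow> 'c::field) \<Rightarrow> (nat \<Rightarrow> 'c) \<Rightarrow> bool" where
  "log_derivative_pair l c \<longleftrightarrow> l 0 = 1 \<and> (\<forall>n. of_nat n * l n = (\<Sum>j=1..n. c j * l (n - j)))"

lemma log_derivative_pair_fps:
  assumes "l 0 = 1"
  shows "log_derivative_pair l c \<longleftrightarrow>
    Abs_fps (\<lambda>n. if n = 0 then 0 else c n) * Abs_fps l = fps_X * fps_deriv (Abs_fps l)"
proof -
  have "(\<Sum>i=0..n. (if i = 0 then 0 else c i) * l (n - i)) = (\<Sum>j=1..n. c j * l (n - j))" for n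
    by (simp add: sum.atLeast_Suc_atMost)
  moreover have "(fps_X * fps_deriv (Abs_fps l)) $ n = of_nat n * l n" for n
    by (cases n) auto
  ultimately show ?thesis using assms
    by (auto simp: log_derivative_pair_def fps_eq_iff fps_mult_nth)
qed

lemma log_derivative_pair_unique:
  assumes "log_derivative_pair l c" "log_derivative_pair l c'" "n \<ge> 1"
  shows "c n = c' n"
proof -
  let ?F = "\<lambda>c. Abs_fps (\<lambda>n. if n = 0 then 0 else c n)"
  have l: "l 0 = 1" using assms by (simp add: log_derivative_pair_def)
  then have "?F c * Abs_fps l = ?F c' * Abs_fps l"
    using assms by (simp add: log_derivative_pair_fps)
  moreover have "Abs_fps l \<noteq> 0" using l by (auto simp: fps_eq_iff intro!: exI[of _ 0])
  ultimately have "?F c = ?F c'" by simp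
  then show ?thesis using assms(3) by (auto simp: fps_eq_iff dest: spec[of _ n])
qed

lemma log_derivative_pair_convolution:
  assumes "log_derivative_pair l c" "log_derivative_pair l' c'"
  shows "log_derivative_pair (\<lambda>n. \<Sum>i=0..n. l i * l' (n - i)) (\<lambda>n. c n + c' n)"
proof -
  let ?F = "\<lambda>c. Abs_fps (\<lambda>n. if n = 0 then 0 else c n)"
  have l: "l 0 = 1" "l' 0 = 1" using assms by (auto simp: log_derivative_pair_def)
  have eq: "?F c * Abs_fps l = fps_X * fps_deriv (Abs_fps l)"
    "?F c' * Abs_fps l' = fps_X * fps_deriv (Abs_fps l')"
    using assms l by (simp_all add: log_derivative_pair_fps)
  have "?F (\<lambda>n. c n + c' n) = ?F c + ?F c'" by (auto simp: fps_eq_iff)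
  moreover have "Abs_fps (\<lambda>n. \<Sum>i=0..n. l i * l' (n - i)) = Abs_fps l * Abs_fps l'"
    by (simp add: fps_eq_iff fps_mult_nth)
  moreover have "(?F c + ?F c') * (Abs_fps l * Abs_fps l') =
    (?F c * Abs_fps l) * Abs_fps l' + (?F c' * Abs_fps l') * Abs_fps l"
    by (simp add: algebra_simps)
  ultimately show ?thesis using l eq
    by (subst log_derivative_pair_fps) (simp_all add: algebra_simps)
qed

lemma log_derivative_pair_twist:
  assumes "log_derivative_pair l c"
  shows "log_derivative_pair (\<lambda>n. w ^ n * l n) (\<lambda>n. w ^ n * c n)"
proof -
  have "(\<Sum>j=1..n. w ^ j * c j * (w ^ (n - j) * l (n - j))) = w ^ n * (\<Sum>j=1..n. c j * l (n - j))" for n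
    unfolding sum_distrib_left
  proof (rule sum.cong[OF refl])
    fix j assume "j \<in> {1..n}"
    then have "w ^ n = w ^ j * w ^ (n - j)" by (simp flip: power_add)
    then show "w ^ j * c j * (w ^ (n - j) * l (n - j)) = w ^ n * (c j * l (n - j))" by simp
  qed
  then show ?thesis using assms by (auto simp: log_derivative_pair_def mult.left_commute)
qed

lemma log_derivative_prod_linear:
  fixes R :: "complex multiset"
  shows "fps_X * fps_deriv (\<Prod>\<rho>\<in>#R. 1 - fps_const \<rho> * fps_X) =
    - Abs_fps (\<lambda>n. if n = 0 then 0 else \<Sum>\<rho>\<in>#R. \<rho> ^ n) * (\<Prod>\<rho>\<in>#R. 1 - fps_const \<rho> * fps_X)"
proof (induction R)
  case empty
  show ?case by (simp add: fps_eq_iff)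
next
  case (add x R)
  let ?P = "\<Prod>\<rho>\<in>#R. 1 - fps_const \<rho> * fps_X"
  let ?G = "\<lambda>R. Abs_fps (\<lambda>n. if n = 0 then 0 else \<Sum>\<rho>\<in>#R. \<rho> ^ n)"
  have 1: "?G {#x#} * (1 - fps_const x * fps_X) = fps_const x * fps_X"
  proof (rule fps_ext)
    fix n
    have "?G {#x#} * (1 - fps_const x * fps_X) = ?G {#x#} - fps_const x * (?G {#x#} * fps_X)"
      by (simp only: right_diff_distrib mult_1_right mult.left_commute mult.assoc)
    then show "(?G {#x#} * (1 - fps_const x * fps_X)) $ n = (fps_const x * fps_X) $ n"
      by (cases n; cases "n - 1") auto
  qed
  have 2: "?G (add_mset x R) = ?G {#x#} + ?G R" by (auto simp: fps_eq_iff)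
  have "fps_X * fps_deriv ((1 - fps_const x * fps_X) * ?P) =
    (1 - fps_const x * fps_X) * (fps_X * fps_deriv ?P) - fps_const x * fps_X * ?P"
    by (simp add: algebra_simps)
  also have "\<dots> = - (?G R * ((1 - fps_const x * fps_X) * ?P)) - (?G {#x#} * (1 - fps_const x * fps_X)) * ?P"
    unfolding add 1 by (simp add: algebra_simps)
  also have "\<dots> = - ?G (add_mset x R) * ((1 - fps_const x * fps_X) * ?P)"
    unfolding 2 by (simp add: algebra_simps)
  finally show ?case by simp
qed

text \<open>A polynomial with constant coefficient \<open>1\<close> is a product of factors \<open>1 - \<rho> u\<close>, and the logarithmic derivative
of such a factor is minus a geometric series.  The \<open>\<rho>\<close> are the roots of the reversed polynomial,
taken in degree \<open>D\<close>; it may have the root \<open>0\<close>, which does not affect the power sums.\<close>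

lemma log_derivative_power_sums:
  fixes l c :: "nat \<Rightarrow> complex"
  assumes pair: "log_derivative_pair l c" and van: "\<And>n. n \<ge> D \<Longrightarrow> l n = 0"
  shows "\<exists>R. (\<forall>n\<ge>1. c n = - (\<Sum>\<rho>\<in>#R. \<rho> ^ n)) \<and>
    (\<forall>\<rho>. \<rho> \<noteq> 0 \<longrightarrow> (\<rho> \<in># R \<longleftrightarrow> (\<Sum>j<D. l j / \<rho> ^ j) = 0))"
proof -
  have l0: "l 0 = 1" using pair by (simp add: log_derivative_pair_def)
  define p where "p = (\<Sum>i\<le>D. monom (l i) (D - i))"
  have cp: "coeff p k = (if k \<le> D then l (D - k) else 0)" for k
  proof -
    have "coeff p k = (\<Sum>i\<le>D. if i = D - k \<and> k \<le> D then l i else 0)"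
      unfolding p_def coeff_sum by (rule sum.cong) auto
    then show ?thesis by (cases "k \<le> D") (auto simp: sum.delta)
  qed
  have deg: "degree p = D"
    by (rule antisym) (auto intro: degree_le le_degree simp: cp l0)
  then have lc: "lead_coeff p = 1" by (simp add: cp l0)
  let ?R = "proots p"
  have p: "p = (\<Prod>\<rho>\<in>#?R. [:-\<rho>, 1:])" using complex_poly_decompose_multiset[of p] lc by simp
  have "reflect_poly [:- x, 1:] = [:1, - x:]" for x :: complex
    by (simp add: reflect_poly_def cCons_def)
  then have "reflect_poly (\<Prod>\<rho>\<in>#R. [:-\<rho>, 1:]) = (\<Prod>\<rho>\<in>#R. [:1, -\<rho>:])" for R :: "complex multiset"
    by (induction R) (simp_all add: reflect_poly_mult del: mult_pCons_left)
  then have "reflect_poly p = (\<Prod>\<rho>\<in>#?R. [:1, -\<rho>:])" using p by metis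
  moreover have "fps_of_poly (\<Prod>\<rho>\<in>#R. [:1, -\<rho>:]) = (\<Prod>\<rho>\<in>#R. 1 - fps_const \<rho> * fps_X)" for R :: "complex multiset"
    by (induction R) (simp_all add: fps_of_poly_mult fps_of_poly_pCons mult.commute[of fps_X] del: mult_pCons_left)
  moreover have "fps_of_poly (reflect_poly p) = Abs_fps l"
    using van by (auto simp: fps_eq_iff coeff_reflect_poly deg cp)
  ultimately have L: "Abs_fps l = (\<Prod>\<rho>\<in>#?R. 1 - fps_const \<rho> * fps_X)" by simp
  have "log_derivative_pair l (\<lambda>n. - (\<Sum>\<rho>\<in>#?R. \<rho> ^ n))"
  proof -
    have "Abs_fps (\<lambda>n. if n = 0 then 0 else - (\<Sum>\<rho>\<in>#?R. \<rho> ^ n)) =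
        - Abs_fps (\<lambda>n. if n = 0 then 0 else \<Sum>\<rho>\<in>#?R. \<rho> ^ n)" by (simp add: fps_eq_iff)
    then show ?thesis
      unfolding log_derivative_pair_fps[of l "\<lambda>n. - (\<Sum>\<rho>\<in>#?R. \<rho> ^ n)", OF l0] L using log_derivative_prod_linear[of ?R] by simp
  qed
  then have c: "c n = - (\<Sum>\<rho>\<in>#?R. \<rho> ^ n)" if "n \<ge> 1" for n
    using log_derivative_pair_unique[OF pair] that by blast
  have root: "\<rho> \<in># ?R \<longleftrightarrow> (\<Sum>j<D. l j / \<rho> ^ j) = 0" if "\<rho> \<noteq> 0" for \<rho>
  proof -
    have "p \<noteq> 0" using lc by auto
    then have "\<rho> \<in># ?R \<longleftrightarrow> poly p \<rho> = 0" by simp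
    also have "poly p \<rho> = (\<Sum>i\<le>D. l i * \<rho> ^ (D - i))" by (simp add: p_def poly_sum poly_monom)
    also have "\<dots> = (\<Sum>i\<le>D. \<rho> ^ D * (l i / \<rho> ^ i))"
      using that by (intro sum.cong) (auto simp: power_diff)
    also have "\<dots> = \<rho> ^ D * (\<Sum>i<D. l i / \<rho> ^ i)"
      using van[of D] by (simp add: sum_distrib_left lessThan_Suc_atMost[symmetric])
    finally show ?thesis using that by simp
  qed
  show ?thesis using c root by blast
qed

section \<open>Irreducible polynomials in a residue class\<close>

lemma coeff_sum_0: "\<chi> 1 = 1 \<Longrightarrow> coeff_sum \<chi> 0 = 1"
proof -
  have "monics 0 = {1 :: 'a::{field,finite} poly}"
    by (auto simp: monics_def one_pCons elim!: degree_eq_zeroE)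
  then show "\<chi> 1 = 1 \<Longrightarrow> coeff_sum \<chi> 0 = 1" by (simp add: coeff_sum_def)
qed

lemma character_log_derivative_pair:
  "\<chi> \<in> dirichlet_characters a \<Longrightarrow> log_derivative_pair (coeff_sum \<chi>) (prime_power_sum \<chi>)"
  by (auto simp: log_derivative_pair_def coeff_sum_0 coeff_sum_recursion dirichlet_characters_def)

lemma geometric_log_derivative_pair: "log_derivative_pair (\<lambda>n. w ^ n) (\<lambda>n. w ^ n)"
proof -
  have "(\<Sum>j=1..n. w ^ j * w ^ (n - j)) = (\<Sum>j=1..n. w ^ n)" for n
    by (rule sum.cong) (auto simp flip: power_add)
  then show ?thesis by (auto simp: log_derivative_pair_def)
qed

text \<open>The prime number theorem for polynomials in its exact form: the zeta function \<open>1 / (1 - q u)\<close> has the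
logarithmic derivative \<open>\<Sum> q\<^sup>n u\<^sup>n\<close>.\<close>

lemma prime_power_sum_one:
  assumes "n \<ge> 1"
  shows "prime_power_sum (\<lambda>_ :: 'a::{field,finite} poly. 1) n = of_nat CARD('a) ^ n"
proof -
  let ?one = "\<lambda>_ :: 'a poly. 1 :: complex"
  have "log_derivative_pair (coeff_sum ?one) (prime_power_sum ?one)"
    by (auto simp: log_derivative_pair_def coeff_sum_0 coeff_sum_recursion)
  moreover have "coeff_sum ?one = (\<lambda>n. of_nat CARD('a) ^ n)"
    by (simp add: coeff_sum_def card_monics fun_eq_iff)
  ultimately have "log_derivative_pair (\<lambda>n. of_nat CARD('a) ^ n) (prime_power_sum ?one)" by simp
  then show ?thesis using log_derivative_pair_unique[OF _ geometric_log_derivative_pair assms] by blast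
qed

text \<open>The principal character only ignores the powers of the finitely many irreducible divisors of \<open>a\<close>.\<close>

lemma prime_power_sum_principal:
  fixes a :: "'a::{field,finite} poly"
  assumes a: "a \<noteq> 0"
  shows "\<exists>C. \<forall>n\<ge>1. \<exists>r. 0 \<le> r \<and> r \<le> C \<and>
    prime_power_sum (principal_character a) n = of_real (real CARD('a) ^ n - r)"
proof -
  let ?D = "{P \<in> monic_irreducibles. P dvd a}"
  have "?D \<subseteq> {f. f = 0 \<or> degree f < Suc (degree a)}"
  proof
    fix P assume "P \<in> ?D"
    then have "degree P \<le> degree a" using dvd_imp_degree_le[of P a] a by simp
    then show "P \<in> {f. f = 0 \<or> degree f < Suc (degree a)}" by simp
  qed
  then have fin: "finite ?D" using card_polys_degree_less(2) finite_subset by blast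
  define C where "C = (\<Sum>P\<in>?D. real (degree P))"
  have "\<exists>r. 0 \<le> r \<and> r \<le> C \<and>
    prime_power_sum (principal_character a) n = of_real (real CARD('a) ^ n - r)" if n: "n \<ge> 1" for n
  proof -
    let ?B = "{x \<in> prime_powers n. \<not> unit_mod a (fst x)}"
    define r where "r = (\<Sum>x\<in>?B. real (degree (fst x)))"
    have 1: "principal_character a f ^ i = (if unit_mod a f then 1 else 0)" if "i \<ge> 1" for f i
      using that by (auto simp: principal_character_def power_0_left)
    have "of_nat CARD('a) ^ n = (\<Sum>x\<in>prime_powers n. of_nat (degree (fst (x :: 'a poly \<times> nat))) :: complex)"
      using prime_power_sum_one[OF n, where 'a = 'a] by (simp add: prime_power_sum_def case_prod_beta)
    also have "\<dots> = (\<Sum>x\<in>prime_powers n. of_nat (degree (fst x)) * principal_character a (fst x) ^ snd x) +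
        (\<Sum>x\<in>prime_powers n. if \<not> unit_mod a (fst x) then of_nat (degree (fst x)) else 0)"
      unfolding sum.distrib[symmetric] by (rule sum.cong) (auto simp: 1 prime_powers_def principal_character_def power_0_left)
    also have "(\<Sum>x\<in>prime_powers n. if \<not> unit_mod a (fst x) then of_nat (degree (fst x)) else 0) = (of_real r :: complex)"
      unfolding r_def by (simp only: sum.inter_filter[OF finite_prime_powers, symmetric] of_real_sum of_real_of_nat_eq)
    finally have "prime_power_sum (principal_character a) n = of_real (real CARD('a) ^ n - r)"
      by (simp add: prime_power_sum_def case_prod_beta)
    moreover have "r \<le> C"
    proof -
      have inj: "inj_on fst ?B"
        using monic_irreducible_degree by (fastforce simp: inj_on_def prime_powers_def)
      have "fst ` ?B \<subseteq> ?D"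
      proof
        fix P assume "P \<in> fst ` ?B"
        then have "P \<in> monic_irreducibles" "\<not> unit_mod a P" by (auto simp: prime_powers_def)
        then show "P \<in> ?D" using irreducible_unit_mod(2)[of P a] by (auto simp: monic_irreducibles_def)
      qed
      then have "(\<Sum>P\<in>fst ` ?B. real (degree P)) \<le> C"
        unfolding C_def using fin by (intro sum_mono2) auto
      then show ?thesis unfolding r_def by (simp add: sum.reindex[OF inj])
    qed
    moreover have "0 \<le> r" unfolding r_def by (intro sum_nonneg) auto
    ultimately show ?thesis by blast
  qed
  then show ?thesis by blast
qed

text \<open>The coefficients \<open>r n\<close> of \<open>L(\<omega> u, \<chi>) / (1 - q u)\<close> satisfy the recursion whose weights \<open>s n\<close> are sums of terms
\<open>degree P * (1 + \<omega>\<^sup>n \<chi>(P)\<^sup>i)\<close>.  As \<open>\<omega>\<^sup>n \<chi>(P)\<^sup>i\<close> is real and at least \<open>-1\<close>, all \<open>s n\<close> and hence all \<open>r n\<close> are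
nonnegative.  In even degree the powers of the polynomial \<open>T\<close> contribute a positive term to \<open>s n\<close>,
so \<open>r n > 0\<close>.  A zero of \<open>L(u, \<chi>)\<close> at \<open>\<omega> / q\<close> would cancel the pole and make \<open>r n\<close> vanish for large \<open>n\<close>.\<close>

lemma real_character_no_extremal_root:
  fixes a :: "'a::{field,finite} poly"
  assumes a: "a \<noteq> 0" and \<chi>: "\<chi> \<in> dirichlet_characters a" "\<chi> \<noteq> principal_character a"
    and real: "\<And>f. cnj (\<chi> f) = \<chi> f" and \<omega>: "\<omega> = 1 \<or> \<omega> = - 1"
  shows "(\<Sum>j<degree a. coeff_sum \<chi> j / (\<omega> * of_nat CARD('a)) ^ j) \<noteq> 0"
proof
  let ?q = "of_nat CARD('a) :: complex"
  have q0: "?q \<noteq> 0" by simp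
  assume zero: "(\<Sum>j<degree a. coeff_sum \<chi> j / (\<omega> * ?q) ^ j) = 0"
  define r where "r n = (\<Sum>i=0..n. \<omega> ^ i * coeff_sum \<chi> i * ?q ^ (n - i))" for n
  define s where "s n = \<omega> ^ n * prime_power_sum \<chi> n + ?q ^ n" for n
  have pair: "log_derivative_pair r s"
    unfolding r_def s_def
    by (rule log_derivative_pair_convolution log_derivative_pair_twist
        character_log_derivative_pair[OF \<chi>(1)] geometric_log_derivative_pair)+
  have \<omega>real: "\<omega> \<in> \<real>" "norm \<omega> = 1" using \<omega> by auto
  have \<chi>real: "\<chi> f \<in> \<real>" for f using real[of f] by (simp add: Reals_cnj_iff)
  have term_nonneg: "1 + \<omega> ^ n * \<chi> P ^ i \<in> \<real> \<and> Re (1 + \<omega> ^ n * \<chi> P ^ i) \<ge> 0" for n P i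
  proof -
    have "norm (\<omega> ^ n * \<chi> P ^ i) \<le> 1"
      using \<omega>real character_norm[OF \<chi>(1) a, of P] by (auto simp: norm_mult norm_power power_le_one)
    then have "Re (\<omega> ^ n * \<chi> P ^ i) \<ge> - 1" using abs_Re_le_cmod[of "\<omega> ^ n * \<chi> P ^ i"] by linarith
    then show ?thesis using \<omega>real \<chi>real by auto
  qed
  have s_eq: "s n = (\<Sum>x\<in>prime_powers n. of_nat (degree (fst x)) * (1 + \<omega> ^ n * \<chi> (fst x) ^ snd x))"
    if "n \<ge> 1" for n
    using prime_power_sum_one[OF that, where 'a = 'a]
    by (simp add: s_def prime_power_sum_def case_prod_beta sum_distrib_left algebra_simps sum.distrib)
  have s_nonneg: "s n \<in> \<real> \<and> Re (s n) \<ge> 0" if "n \<ge> 1" for n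
    unfolding s_eq[OF that] Re_sum using term_nonneg
    by (intro conjI sum_in_Reals sum_nonneg Reals_mult) auto
  have r_nonneg: "r n \<in> \<real> \<and> Re (r n) \<ge> 0" for n
  proof (induction n rule: less_induct)
    case (less n)
    show ?case
    proof (cases "n = 0")
      case True
      then show ?thesis using pair by (simp add: log_derivative_pair_def)
    next
      case False
      have rn: "of_nat n * r n = (\<Sum>j=1..n. s j * r (n - j))"
        using pair by (simp add: log_derivative_pair_def)
      have t: "s j * r (n - j) \<in> \<real> \<and> Re (s j * r (n - j)) \<ge> 0" if "j \<in> {1..n}" for j
        using s_nonneg[of j] less[of "n - j"] that by (auto simp: complex_is_Real_iff)
      have "of_nat n * r n \<in> \<real>" unfolding rn using t by (intro sum_in_Reals) auto
      moreover have "Re (of_nat n * r n) \<ge> 0" unfolding rn Re_sum using t by (intro sum_nonneg) auto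
      ultimately show ?thesis using False by (auto simp: complex_is_Real_iff zero_le_mult_iff)
    qed
  qed
  define n where "n = 2 * Suc (degree a)"
  have n: "n \<ge> 1" "even n" "n \<ge> degree a" by (auto simp: n_def)
  have "Re (s n) > 0"
  proof -
    let ?X = "[:0, 1:] :: 'a poly"
    have X: "(?X, n) \<in> prime_powers n"
      using irreducible_linear_field_poly[of "1 :: 'a" 0] n(1) by (simp add: prime_powers_def monic_irreducibles_def)
    have "Im (\<chi> ?X) = 0" using \<chi>real[of ?X] by (simp add: complex_is_Real_iff)
    then have "\<chi> ?X = of_real (Re (\<chi> ?X))" by (simp add: complex_eq_iff)
    then have "Re (\<chi> ?X ^ n) = Re (\<chi> ?X) ^ n" by (metis Re_complex_of_real of_real_power)
    also have "\<dots> \<ge> 0" using n(2) by (simp add: zero_le_even_power)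
    finally have "Re (1 + \<omega> ^ n * \<chi> ?X ^ n) > 0" using \<omega> n(2) by auto
    then have "0 < Re (of_nat (degree (fst (?X, n))) * (1 + \<omega> ^ n * \<chi> (fst (?X, n)) ^ snd (?X, n)))"
      by simp
    moreover have "0 \<le> Re (of_nat (degree (fst x)) * (1 + \<omega> ^ n * \<chi> (fst x) ^ snd x))" for x
      using term_nonneg[of n "fst x" "snd x"] by (auto simp: complex_is_Real_iff)
    ultimately show ?thesis unfolding s_eq[OF n(1)] Re_sum
      by (intro sum_pos2[OF finite_prime_powers X])
  qed
  moreover have "Re (s n) \<le> Re (of_nat n * r n)"
  proof -
    have "Re (s n * r (n - n)) \<le> (\<Sum>j=1..n. Re (s j * r (n - j)))"
      using s_nonneg r_nonneg n(1)
      by (intro member_le_sum) (auto simp: complex_is_Real_iff)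
    also have "\<dots> = Re (of_nat n * r n)"
      using pair by (simp only: log_derivative_pair_def Re_sum)
    finally show ?thesis using pair by (simp only: log_derivative_pair_def diff_self_eq_0 mult_1_right)
  qed
  moreover have "r n = 0"
  proof -
    have "r n = (\<Sum>i\<in>{0..n}. ?q ^ n * (coeff_sum \<chi> i / (\<omega> * ?q) ^ i))"
      unfolding r_def
    proof (rule sum.cong[OF refl])
      fix i assume "i \<in> {0..n}"
      then have "?q ^ n = ?q ^ i * ?q ^ (n - i)" by (simp flip: power_add)
      moreover have "\<omega> ^ i * \<omega> ^ i = 1" using \<omega> by (auto simp flip: power_mult_distrib)
      then have "inverse (\<omega> ^ i) = \<omega> ^ i" by (rule inverse_unique)
      ultimately show "\<omega> ^ i * coeff_sum \<chi> i * ?q ^ (n - i) = ?q ^ n * (coeff_sum \<chi> i / (\<omega> * ?q) ^ i)"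
        using q0 by (simp add: power_mult_distrib divide_inverse mult_ac)
    qed
    also have "\<dots> = (\<Sum>i<degree a. ?q ^ n * (coeff_sum \<chi> i / (\<omega> * ?q) ^ i))"
      using n(3) coeff_sum_nonprincipal_zero[OF a \<chi>] by (intro sum.mono_neutral_right) auto
    also have "\<dots> = ?q ^ n * (\<Sum>i<degree a. coeff_sum \<chi> i / (\<omega> * ?q) ^ i)"
      by (simp only: sum_distrib_left)
    finally show ?thesis using zero by simp
  qed
  ultimately show False by simp
qed

lemma coeff_sum_cnj: "coeff_sum (\<lambda>f. cnj (\<chi> f)) n = cnj (coeff_sum \<chi> n)"
  by (simp add: coeff_sum_def)

text \<open>The multisets of all nonprincipal characters are merged into one: by orthogonality the total sum
over all characters counts prime powers congruent to \<open>1\<close>, so it is nonnegative, and the growth lemma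
applies to the merged multiset.  The pair of a character and an extremal number is then
unique, hence fixed by complex conjugation.\<close>

lemma nonprincipal_power_sums_small:
  fixes a :: "'a::{field,finite} poly"
  assumes a: "a \<noteq> 0"
  shows "\<exists>\<Omega> :: ('a poly \<Rightarrow> complex) \<Rightarrow> complex multiset.
    (\<forall>\<chi>\<in>dirichlet_characters a - {principal_character a}.
      (\<forall>n\<ge>1. prime_power_sum \<chi> n = - (\<Sum>\<rho>\<in>#\<Omega> \<chi>. \<rho> ^ n)) \<and>
      (\<forall>\<rho>\<in>#\<Omega> \<chi>. norm \<rho> < real CARD('a)))"
proof -
  let ?q = "real CARD('a)"
  have q: "?q > 1" using card_field_gt_1[where 'a = 'a] by simp
  let ?X = "dirichlet_characters a" and ?X' = "dirichlet_characters a - {principal_character a}"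
  have finX: "finite ?X" by (rule finite_dirichlet_characters[OF a])
  have "\<exists>R. (\<forall>n\<ge>1. prime_power_sum \<chi> n = - (\<Sum>\<rho>\<in>#R. \<rho> ^ n)) \<and>
      (\<forall>\<rho>. \<rho> \<noteq> 0 \<longrightarrow> (\<rho> \<in># R \<longleftrightarrow> (\<Sum>j<degree a. coeff_sum \<chi> j / \<rho> ^ j) = 0))" if "\<chi> \<in> ?X'" for \<chi>
  proof -
    have \<chi>: "\<chi> \<in> ?X" "\<chi> \<noteq> principal_character a" using that by auto
    show ?thesis
      by (rule log_derivative_power_sums[OF character_log_derivative_pair[OF \<chi>(1)]
            coeff_sum_nonprincipal_zero[OF a \<chi>]])
  qed
  then have "\<exists>\<Omega>. \<forall>\<chi>\<in>?X'. (\<forall>n\<ge>1. prime_power_sum \<chi> n = - (\<Sum>\<rho>\<in>#\<Omega> \<chi>. \<rho> ^ n)) \<and>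
      (\<forall>\<rho>. \<rho> \<noteq> 0 \<longrightarrow> (\<rho> \<in># \<Omega> \<chi> \<longleftrightarrow> (\<Sum>j<degree a. coeff_sum \<chi> j / \<rho> ^ j) = 0))"
    by (intro bchoice ballI)
  then obtain \<Omega> where \<Omega>: "\<And>\<chi> n. \<chi> \<in> ?X' \<Longrightarrow> n \<ge> 1 \<Longrightarrow> prime_power_sum \<chi> n = - (\<Sum>\<rho>\<in>#\<Omega> \<chi>. \<rho> ^ n)"
    and root: "\<And>\<chi> \<rho>. \<chi> \<in> ?X' \<Longrightarrow> \<rho> \<noteq> 0 \<Longrightarrow>
      \<rho> \<in># \<Omega> \<chi> \<longleftrightarrow> (\<Sum>j<degree a. coeff_sum \<chi> j / \<rho> ^ j) = 0"
    by blast
  obtain C where C: "\<And>n. n \<ge> 1 \<Longrightarrow> \<exists>r. 0 \<le> r \<and> r \<le> C \<and>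
    prime_power_sum (principal_character a) n = of_real (?q ^ n - r)"
    using prime_power_sum_principal[OF a] by blast
  let ?T = "\<Sum>\<chi>\<in>?X'. \<Omega> \<chi>"
  have sum_T: "(\<Sum>\<rho>\<in>#(\<Sum>\<chi>\<in>Y. \<Omega> \<chi>). \<rho> ^ n) = (\<Sum>\<chi>\<in>Y. \<Sum>\<rho>\<in>#\<Omega> \<chi>. \<rho> ^ n)" if "finite Y" for n Y
    using that by (induction Y rule: finite_induct) auto
  have bound: "Re (\<Sum>\<rho>\<in>#?T. \<rho> ^ n) \<le> ?q ^ n + 0" if n: "n \<ge> 1" for n
  proof -
    have "(\<Sum>\<chi>\<in>?X. prime_power_sum \<chi> n) =
      (\<Sum>x\<in>prime_powers n. of_nat (degree (fst x)) * (\<Sum>\<chi>\<in>?X. \<chi> (fst x ^ snd x)))"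
      unfolding prime_power_sum_def case_prod_beta sum_distrib_left
      by (subst sum.swap) (intro sum.cong refl, simp add: character_power)
    also have "Re \<dots> \<ge> 0"
      unfolding Re_sum by (intro sum_nonneg) (simp add: character_orthogonality[OF a])
    finally have "0 \<le> Re (\<Sum>\<chi>\<in>?X. prime_power_sum \<chi> n)" .
    also have "(\<Sum>\<chi>\<in>?X. prime_power_sum \<chi> n) =
      prime_power_sum (principal_character a) n + (\<Sum>\<chi>\<in>?X'. prime_power_sum \<chi> n)"
      by (rule sum.remove[OF finX principal_character_in])
    also have "(\<Sum>\<chi>\<in>?X'. prime_power_sum \<chi> n) = - (\<Sum>\<rho>\<in>#?T. \<rho> ^ n)"
      using \<Omega>[OF _ n] finX by (simp add: sum_T sum_negf)
    finally show ?thesis using C[OF n] by auto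
  qed
  have le: "norm \<rho> \<le> ?q" if "\<rho> \<in># ?T" for \<rho> using power_sum_growth(1)[OF q bound that] .
  have one: "size {#\<rho> \<in># ?T. norm \<rho> \<ge> ?q#} \<le> 1" by (rule power_sum_growth(2)[OF q bound])
  have "norm \<rho> < ?q" if \<chi>: "\<chi> \<in> ?X'" and \<rho>: "\<rho> \<in># \<Omega> \<chi>" for \<chi> \<rho>
  proof (rule ccontr)
    assume neg: "\<not> norm \<rho> < ?q"
    have sub: "\<Omega> \<chi> \<subseteq># ?T"
      using \<chi> finX by (subst sum.remove[of _ \<chi>]) auto
    then have "\<rho> \<in># ?T" using \<rho> by (meson mset_subset_eqD)
    then have norm: "norm \<rho> = ?q" using le neg by force
    then have \<rho>0: "\<rho> \<noteq> 0" using q by auto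
    let ?\<chi>' = "\<lambda>f. cnj (\<chi> f)"
    have prin: "cnj (principal_character a f) = principal_character a f" for f
      by (simp add: principal_character_def)
    have \<chi>': "?\<chi>' \<in> ?X'"
    proof -
      have "?\<chi>' \<noteq> principal_character a"
      proof
        assume eq: "?\<chi>' = principal_character a"
        have "\<chi> f = principal_character a f" for f
          using fun_cong[OF eq, of f] prin[of f] by (metis complex_cnj_cnj)
        then show False using \<chi> by auto
      qed
      then show ?thesis using \<chi> character_cnj_closed by blast
    qed
    have "(\<Sum>j<degree a. coeff_sum ?\<chi>' j / cnj \<rho> ^ j) = cnj (\<Sum>j<degree a. coeff_sum \<chi> j / \<rho> ^ j)"
      by (simp add: coeff_sum_cnj)
    also have "(\<Sum>j<degree a. coeff_sum \<chi> j / \<rho> ^ j) = 0" using root[OF \<chi> \<rho>0] \<rho> by blast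
    also have "cnj 0 = 0" by simp
    finally have \<rho>': "cnj \<rho> \<in># \<Omega> ?\<chi>'"
      using root[OF \<chi>', of "cnj \<rho>"] \<rho>0 by (simp only: complex_cnj_zero_iff not_False_eq_True)
    have two: False if "{#\<rho>, cnj \<rho>#} \<subseteq># ?T"
    proof -
      have "{#\<rho>, cnj \<rho>#} \<subseteq># {#\<rho> \<in># ?T. norm \<rho> \<ge> ?q#}"
        using multiset_filter_mono[OF that, of "\<lambda>\<rho>. norm \<rho> \<ge> ?q"] norm by simp
      from size_mset_mono[OF this] one show False by simp
    qed
    have eq\<chi>: "?\<chi>' = \<chi>"
    proof (rule ccontr)
      assume ne: "?\<chi>' \<noteq> \<chi>"
      define U where "U = (\<Sum>\<chi>\<in>?X' - {\<chi>} - {?\<chi>'}. \<Omega> \<chi>)"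
      have "?T = \<Omega> \<chi> + (\<Sum>\<chi>\<in>?X' - {\<chi>}. \<Omega> \<chi>)"
        using \<chi> finX by (intro sum.remove) simp_all
      also have "(\<Sum>\<chi>\<in>?X' - {\<chi>}. \<Omega> \<chi>) = \<Omega> ?\<chi>' + U"
        unfolding U_def using \<chi>' ne finX by (intro sum.remove) simp_all
      finally have T: "?T = (\<Omega> \<chi> + \<Omega> ?\<chi>') + U" by (simp only: add.assoc)
      have "{#\<rho>#} + {#cnj \<rho>#} \<subseteq># \<Omega> \<chi> + \<Omega> ?\<chi>'"
        using \<rho> \<rho>' by (intro subset_mset.add_mono) simp_all
      also have "\<dots> \<subseteq># ?T" unfolding T by (rule mset_subset_eq_add_left)
      finally have "{#\<rho>, cnj \<rho>#} \<subseteq># ?T" by (simp add: add_mset_commute)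
      then show False by (rule two)
    qed
    have eq\<rho>: "cnj \<rho> = \<rho>"
    proof (rule ccontr)
      assume ne: "cnj \<rho> \<noteq> \<rho>"
      have "cnj \<rho> \<in># \<Omega> \<chi>" using \<rho>' eq\<chi> by simp
      then have "{#\<rho>, cnj \<rho>#} \<subseteq># \<Omega> \<chi>" using ne \<rho> by (simp add: insert_subset_eq_iff in_diff_count)
      then show False using two sub by (meson subset_mset.dual_order.trans)
    qed
    have "\<rho> = of_real (Re \<rho>)" using eq\<rho> by (simp add: complex_eq_iff)
    moreover from this have "\<bar>Re \<rho>\<bar> = ?q" using norm by (metis norm_of_real)
    ultimately have "\<rho> = 1 * of_nat CARD('a) \<or> \<rho> = (- 1) * of_nat CARD('a)"
      by (auto simp: abs_if complex_eq_iff split: if_splits)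
    then obtain \<omega> :: complex where "\<omega> = 1 \<or> \<omega> = - 1" "\<rho> = \<omega> * of_nat CARD('a)" by blast
    then show False
      using real_character_no_extremal_root[OF a, of \<chi> \<omega>] \<chi> root[OF \<chi> \<rho>0] \<rho> fun_cong[OF eq\<chi>] by auto
  qed
  then show ?thesis using \<Omega> by blast
qed

text \<open>Kornblum's theorem in prime degrees.  By orthogonality, the prime powers of degree \<open>n\<close> in the class of \<open>b\<close>
have total weight \<open>q\<^sup>n / h\<close> up to a smaller error, with \<open>h\<close> the number of characters.  In prime degree the
only proper prime powers are \<open>n\<close>-th powers of linear polynomials, whose weight is at most \<open>q\<close>.\<close>

theorem irreducible_in_residue_class:
  fixes a b :: "'a::{field,finite} poly"
  assumes a: "a \<noteq> 0" and b: "unit_mod a b"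
  shows "\<exists>N. \<forall>n\<ge>N. prime n \<longrightarrow> (\<exists>P. irreducible P \<and> degree P = n \<and> a dvd P - b)"
proof -
  let ?q = "real CARD('a)"
  have q: "?q > 1" using card_field_gt_1[where 'a = 'a] by simp
  let ?X = "dirichlet_characters a" and ?X' = "dirichlet_characters a - {principal_character a}"
  have finX: "finite ?X" by (rule finite_dirichlet_characters[OF a])
  obtain \<Omega> where \<Omega>: "\<And>\<chi> n. \<chi> \<in> ?X' \<Longrightarrow> n \<ge> 1 \<Longrightarrow> prime_power_sum \<chi> n = - (\<Sum>\<rho>\<in>#\<Omega> \<chi>. \<rho> ^ n)"
    and small: "\<And>\<chi> \<rho>. \<chi> \<in> ?X' \<Longrightarrow> \<rho> \<in># \<Omega> \<chi> \<Longrightarrow> norm \<rho> < ?q"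
    using nonprincipal_power_sums_small[OF a] by metis
  obtain C where C: "\<And>n. n \<ge> 1 \<Longrightarrow> \<exists>r. 0 \<le> r \<and> r \<le> C \<and>
    prime_power_sum (principal_character a) n = of_real (?q ^ n - r)"
    using prime_power_sum_principal[OF a] by blast
  obtain b' where b': "a dvd b * b' - 1" using b by (auto simp: unit_mod_def)
  have ub': "unit_mod a b'" using b' by (auto simp: unit_mod_def mult.commute intro: exI[of _ b])
  define h where "h = real (card ?X)"
  let ?S = "\<lambda>n. \<Sum>\<chi>\<in>?X'. \<Sum>\<rho>\<in>#\<Omega> \<chi>. (norm \<rho> / ?q) ^ n"
  have "(\<lambda>n. (\<Sum>\<rho>\<in>#R. (norm \<rho> / ?q) ^ n)) \<longlonglongrightarrow> 0" if "\<forall>\<rho>\<in>#R. norm \<rho> < ?q" for R :: "complex multiset"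
    using that
  proof (induction R)
    case (add x R)
    have "(\<lambda>n. (norm x / ?q) ^ n) \<longlonglongrightarrow> 0" using add.prems q by (intro LIMSEQ_power_zero) simp
    then show ?case using tendsto_add[OF _ add.IH, of "\<lambda>n. (norm x / ?q) ^ n" 0] add.prems by simp
  qed simp
  then have "?S \<longlonglongrightarrow> (\<Sum>\<chi>\<in>?X'. 0)"
    using small by (intro tendsto_sum) blast
  then have "eventually (\<lambda>n. ?S n < 1 / 2) sequentially"
    by (intro order_tendstoD(2)[where y = 0]) auto
  moreover have "eventually (\<lambda>n. 2 * (C + h * ?q) < ?q ^ n) sequentially"
    by (rule eventually_less_power[OF q])
  ultimately have "eventually (\<lambda>n. ?S n < 1 / 2 \<and>
      2 * (C + h * ?q) < ?q ^ n) sequentially"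
    by (rule eventually_conj)
  then obtain N where N: "\<And>n. n \<ge> N \<Longrightarrow> ?S n < 1 / 2"
    "\<And>n. n \<ge> N \<Longrightarrow> 2 * (C + h * ?q) < ?q ^ n"
    by (auto simp: eventually_sequentially)
  have "\<exists>P. irreducible P \<and> degree P = n \<and> a dvd P - b" if n: "n \<ge> N" "prime n" for n
  proof (rule ccontr)
    assume none: "\<nexists>P. irreducible P \<and> degree P = n \<and> a dvd P - b"
    have n1: "n \<ge> 1" using n(2) prime_ge_1_nat by blast
    let ?B = "{x \<in> prime_powers n. a dvd b' * fst x ^ snd x - 1}"
    let ?W = "\<Sum>x\<in>?B. real (degree (fst x))"
    let ?Y = "\<Sum>\<chi>\<in>?X'. \<chi> b' * prime_power_sum \<chi> n"
    let ?Z = "\<Sum>\<chi>\<in>?X. \<chi> b' * prime_power_sum \<chi> n"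
    have conv: "a dvd f - b" if "a dvd b' * f - 1" for f
    proof -
      have "a dvd b' * f - b' * b" using dvd_diff_trans[OF that dvd_diff_sym] b' by (simp add: mult.commute)
      then show ?thesis using unit_mod_cancel[OF ub'] by blast
    qed
    have B: "?B \<subseteq> monics 1 \<times> {n}"
    proof
      fix x assume x: "x \<in> ?B"
      then have P: "fst x \<in> monic_irreducibles" "snd x * degree (fst x) = n" "a dvd fst x ^ snd x - b"
        using conv by (auto simp: prime_powers_def)
      have "snd x \<noteq> 1"
      proof
        assume 1: "snd x = 1"
        then have "irreducible (fst x) \<and> degree (fst x) = n \<and> a dvd fst x - b"
          using P by (auto simp: monic_irreducibles_def)
        then show False using none by blast
      qed
      then have "degree (fst x) = 1" using P(2) n(2) by (metis prime_product)
      then have "snd x = n" using P(2) by simp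
      then show "x \<in> monics 1 \<times> {n}" using P(1) \<open>degree (fst x) = 1\<close>
        by (cases x) (auto simp: monics_def monic_irreducibles_def)
    qed
    have finB: "finite ?B" by simp
    have "?W \<le> (\<Sum>x\<in>(monics 1 :: 'a poly set) \<times> {n}. real (degree (fst x)))"
      using B by (intro sum_mono2) auto
    also have "\<dots> = (\<Sum>x\<in>(monics 1 :: 'a poly set) \<times> {n}. 1 :: real)"
      by (intro sum.cong) (auto simp: monics_def)
    also have "\<dots> = ?q" by (simp add: card_cartesian_product card_monics)
    finally have Bq: "?W \<le> ?q" .
    have "?Z =
      (\<Sum>x\<in>prime_powers n. of_nat (degree (fst x)) * (\<Sum>\<chi>\<in>?X. \<chi> (b' * fst x ^ snd x)))"
    proof -
      have "\<chi> (b' * f ^ i) = \<chi> b' * \<chi> f ^ i" if "\<chi> \<in> ?X" for \<chi> f i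
        using that character_power[OF that, of f i] by (auto simp: dirichlet_characters_def)
      then show ?thesis
        unfolding prime_power_sum_def case_prod_beta sum_distrib_left
        by (subst sum.swap) (intro sum.cong refl, simp)
    qed
    also have "\<dots> = (\<Sum>x\<in>prime_powers n. if a dvd b' * fst x ^ snd x - 1 then of_real (h * real (degree (fst x))) else 0)"
      unfolding character_orthogonality[OF a] by (intro sum.cong) (auto simp: h_def)
    also have "\<dots> = of_real (h * ?W)"
      by (simp only: sum.inter_filter[OF finite_prime_powers, symmetric] of_real_sum sum_distrib_left)
    finally have total: "?Z = of_real (h * ?W)" .
    obtain r where r: "0 \<le> r" "r \<le> C" "prime_power_sum (principal_character a) n = of_real (?q ^ n - r)"
      using C[OF n1] by blast
    have "?Z =
      principal_character a b' * prime_power_sum (principal_character a) n + ?Y"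
      by (rule sum.remove[OF finX principal_character_in])
    then have main: "of_real (?q ^ n - r) = of_real (h * ?W) - ?Y"
      using total r(3) ub' by (simp add: principal_character_def)
    have norm_le: "norm (\<Sum>\<rho>\<in>#R. \<rho> ^ n) \<le> (\<Sum>\<rho>\<in>#R. norm \<rho> ^ n)" for R :: "complex multiset"
    proof (induction R)
      case (add x R)
      then show ?case using norm_triangle_ineq[of "x ^ n" "\<Sum>\<rho>\<in>#R. \<rho> ^ n"] by (simp add: norm_power)
    qed simp
    have "norm ?Y \<le> (\<Sum>\<chi>\<in>?X'. (\<Sum>\<rho>\<in>#\<Omega> \<chi>. norm \<rho> ^ n))"
    proof (rule sum_norm_le)
      fix \<chi> assume \<chi>: "\<chi> \<in> ?X'"
      have "norm (\<chi> b' * prime_power_sum \<chi> n) = norm (prime_power_sum \<chi> n)"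
        using \<chi> character_norm[OF _ a, of \<chi> b'] ub' by (simp add: norm_mult)
      also have "\<dots> = norm (\<Sum>\<rho>\<in>#\<Omega> \<chi>. \<rho> ^ n)" using \<Omega>[OF \<chi> n1] by simp
      finally show "norm (\<chi> b' * prime_power_sum \<chi> n) \<le> (\<Sum>\<rho>\<in>#\<Omega> \<chi>. norm \<rho> ^ n)"
        using norm_le[of "\<Omega> \<chi>"] by simp
    qed
    also have "\<dots> = ?q ^ n * ?S n"
    proof -
      have "(\<Sum>\<rho>\<in>#R. norm \<rho> ^ n) = ?q ^ n * (\<Sum>\<rho>\<in>#R. (norm \<rho> / ?q) ^ n)" for R :: "complex multiset"
        using q by (induction R) (auto simp: power_divide field_simps)
      then show ?thesis by (simp only: sum_distrib_left)
    qed
    also have "\<dots> \<le> ?q ^ n * (1 / 2)" using N(1)[OF n(1)] q by (intro mult_left_mono) auto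
    finally have X': "norm ?Y \<le> ?q ^ n / 2" by simp
    have "?q ^ n - r \<le> norm (of_real (?q ^ n - r) :: complex)" by (simp only: norm_of_real)
    also have "\<dots> \<le> \<bar>h * ?W\<bar> + ?q ^ n / 2"
      unfolding main using norm_triangle_ineq4[of "of_real (h * ?W) :: complex"
        ?Y] X' by (simp only: norm_of_real)
    also have "\<bar>h * ?W\<bar> \<le> h * ?q"
      using Bq by (simp add: h_def abs_mult sum_nonneg mult_left_mono)
    finally show False using N(2)[OF n(1)] r(2) by simp
  qed
  then show ?thesis by blast
qed

section \<open>Powers that are constant modulo an irreducible polynomial\<close>

lemma geometric_sum_nat:
  fixes q :: nat
  assumes "q \<ge> 1"
  shows "(q - 1) * (\<Sum>i<n. q ^ i) + 1 = q ^ n"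
proof -
  obtain r where "q = Suc r" using assms by (cases q) auto
  then show ?thesis by (induction n) (simp_all add: algebra_simps)
qed

text \<open>Let a prime \<open>l\<close> divide both sides, and thus \<open>q\<^sup>n - 1\<close> and some \<open>q\<^sup>i - 1\<close> with \<open>0 < i < n\<close>.  As \<open>i\<close> and \<open>n\<close> are
coprime, \<open>q\<close> is \<open>1\<close> modulo \<open>l\<close>, so the geometric sum is \<open>n\<close> modulo \<open>l\<close>.  Hence \<open>l = n\<close>, which is too large to
divide \<open>q - 1\<close>.\<close>

lemma geometric_sum_coprime:
  fixes q n :: nat
  assumes q: "q > 1" and n: "prime n" "n > q"
  shows "coprime (\<Sum>i<n. q ^ i) (q ^ j * (\<Prod>i\<in>{1..<n}. q ^ i - 1))"
proof (rule ccontr)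
  let ?M = "\<Sum>i<n. q ^ i"
  assume "\<not> coprime ?M (q ^ j * (\<Prod>i\<in>{1..<n}. q ^ i - 1))"
  then have "gcd ?M (q ^ j * (\<Prod>i\<in>{1..<n}. q ^ i - 1)) \<noteq> 1"
    by (simp only: coprime_iff_gcd_eq_1 not_False_eq_True)
  from prime_factor_nat[OF this] obtain l
    where "prime l" and lg: "l dvd gcd ?M (q ^ j * (\<Prod>i\<in>{1..<n}. q ^ i - 1))" by blast
  then have l: "prime l" "l dvd ?M" "l dvd q ^ j * (\<Prod>i\<in>{1..<n}. q ^ i - 1)"
    by (auto intro: dvd_trans[OF lg gcd_dvd1] dvd_trans[OF lg gcd_dvd2])
  have n0: "n > 0" using n by (simp add: prime_gt_0_nat)
  have M: "(q - 1) * ?M + 1 = q ^ n" using q by (intro geometric_sum_nat) simp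
  have ndvd: "\<not> l dvd q"
  proof
    assume "l dvd q"
    then have "l dvd q ^ n" using n0 by (simp add: dvd_power_le dvd_trans[OF _ dvd_power])
    moreover have "l dvd (q - 1) * ?M" using l(2) by simp
    ultimately have "l dvd 1" using M by (metis dvd_add_right_iff)
    then show False using l(1) by simp
  qed
  then have "l dvd (\<Prod>i\<in>{1..<n}. q ^ i - 1)"
    using l(1,3) prime_dvd_mult_iff prime_dvd_power by blast
  then obtain i where i: "i \<in> {1..<n}" "l dvd q ^ i - 1"
    using prime_dvd_prod_iff[of "{1..<n}" l] l(1) by auto
  have qi: "[q ^ i = 1] (mod l)"
    using i(2) q by (simp add: cong_altdef_nat)
  have qn: "[q ^ n = 1] (mod l)"
  proof -
    have "l dvd q ^ n - 1" using M l(2) by (metis add_diff_cancel_right' dvd_mult)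
    then show ?thesis using q by (simp add: cong_altdef_nat)
  qed
  have "\<not> n dvd i" using i(1) by (auto dest: dvd_imp_le)
  then have "coprime i n" using prime_imp_coprime[OF n(1)] by (simp add: coprime_commute)
  then obtain x y where xy: "i * x = n * y + 1"
    using bezout_nat[of i n] i(1) by auto
  have "[q ^ (i * x) = 1] (mod l)" "[q ^ (n * y) = 1] (mod l)"
    using cong_pow[OF qi, of x] cong_pow[OF qn, of y] by (simp_all add: power_mult)
  then have q1: "[q = 1] (mod l)"
  proof -
    have "[q ^ (n * y) * q = 1 * q] (mod l)" by (rule cong_mult[OF \<open>[q ^ (n * y) = 1] (mod l)\<close> cong_refl])
    moreover have "q ^ (i * x) = q ^ (n * y) * q" unfolding xy by simp
    ultimately show ?thesis using \<open>[q ^ (i * x) = 1] (mod l)\<close> by (metis cong_sym cong_trans mult_1)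
  qed
  have "[?M = (\<Sum>i<n. 1)] (mod l)"
  proof (rule cong_sum)
    fix i show "[q ^ i = 1] (mod l)" using cong_pow[OF q1, of i] by simp
  qed
  then have "[?M = n] (mod l)" by simp
  then have "l dvd n" using l(2) cong_dvd_iff by blast
  then have "l = n" using l(1) n(1) primes_dvd_imp_eq by blast
  moreover have "l dvd q - 1" using q1 q by (simp add: cong_altdef_nat)
  ultimately show False using n(2) q dvd_imp_le[of l "q - 1"] by simp
qed

text \<open>The power \<open>w\<close> of \<open>v\<close> satisfies \<open>w\<^sup>q = w\<close> modulo \<open>k\<close>, and \<open>w\<^sup>q - w\<close> is the product of all \<open>w - u\<close> for constants \<open>u\<close>.\<close>

lemma power_geometric_sum_const:
  fixes k v :: "'a::{field,finite} poly"
  assumes k: "irreducible k" and v: "\<not> k dvd v"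
  shows "\<exists>u. u \<noteq> 0 \<and> k dvd v ^ (\<Sum>i<degree k. CARD('a) ^ i) - [:u:]"
proof -
  let ?q = "CARD('a)" let ?w = "v ^ (\<Sum>i<degree k. ?q ^ i)"
  have prime: "prime_elem k" using k by (rule field_poly_irreducible_imp_prime)
  have w: "\<not> k dvd ?w" using v prime prime_elem_dvd_power by blast
  have M: "(\<Sum>i<degree k. ?q ^ i) * (?q - 1) = ?q ^ degree k - 1"
    using geometric_sum_nat[of ?q "degree k"] card_field_gt_1[where 'a = 'a] by (simp add: mult.commute)
  have "k dvd ?w ^ (?q - 1) - 1"
    using fermat_irreducible[OF k v] by (simp only: power_mult[symmetric] M)
  then have "k dvd ?w * (?w ^ (?q - 1) - 1)" by (rule dvd_mult)
  also have "?w * (?w ^ (?q - 1) - 1) = ?w ^ ?q - ?w"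
    using card_field_gt_1[where 'a = 'a] by (simp add: algebra_simps flip: power_Suc)
  also have "\<dots> = (\<Prod>u\<in>UNIV. ?w - [:u:])" by (rule power_card_minus_self)
  finally obtain u where "k dvd ?w - [:u:]" using prime_elem_dvd_prod[OF prime] by blast
  moreover have "u \<noteq> 0" using calculation w by auto
  ultimately show ?thesis by blast
qed

section \<open>The special linear group of degree two\<close>

text \<open>The two leftmost factors undo row operations that make both entries of the first column nonzero,
and the rightmost one undoes, among other things, the column operation that makes the upper right
entry irreducible.  The rest comes from the exchange of powers.\<close>

definition sl2_word :: "(nat \<Rightarrow> 'a::comm_ring_1) \<Rightarrow> 'a mat2" where
  "sl2_word x = upper2 (x 0) * lower2 (x 1) * upper2 (x 2) *
     transpose2 (swindle (x 3) (x 4) (x 5) (x 6) (x 7)) *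
     adjugate2 (swindle (x 8) (x 9) (x 10) (x 11) (x 12)) *
     lower2 (x 13) * upper2 1 * lower2 (x 14) * upper2 (x 15) * lower2 (x 16) * upper2 (x 17)"

lemma det2_sl2_word: "det2 (sl2_word x) = 1"
  by (simp add: sl2_word_def det2_mult det2_swindle)

lemma upper2_add: "upper2 x * upper2 y = upper2 (x + y)"
  by (simp add: upper2_def add.commute)

text \<open>The exponent is \<open>0\<close> modulo \<open>(q\<^sup>n - 1) / (q - 1)\<close> and \<open>1\<close> modulo the exponent of the unit group modulo \<open>l\<close>.\<close>

lemma power_exchange_exponent:
  fixes k v l z :: "'a::{field,finite} poly"
  assumes k: "irreducible k" "prime (degree k)" "degree k > CARD('a)" and v: "\<not> k dvd v"
    and l: "l \<noteq> 0" "degree l < degree k" and z: "unit_mod l z"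
  shows "\<exists>m u. u \<noteq> 0 \<and> k dvd v ^ m - [:u:] \<and> l dvd z ^ m - z"
proof -
  let ?q = "CARD('a)" and ?n = "degree k"
  let ?M = "\<Sum>i<?n. ?q ^ i" and ?E = "?q ^ degree l * (\<Prod>i\<in>{1..<?n}. ?q ^ i - 1)"
  have q: "?q > 1" by (rule card_field_gt_1)
  have cop: "coprime ?M ?E" using geometric_sum_coprime[OF q k(2,3)] by blast
  have "1 < ?q ^ ?n" using one_less_power[OF q] prime_gt_0_nat[OF k(2)] by blast
  then have M0: "?M > 0" using geometric_sum_nat[of ?q ?n] q by (intro gr0I) simp
  have gcd: "gcd ?M ?E = 1" using cop by (simp only: coprime_iff_gcd_eq_1)
  from bezout_nat[OF gr_implies_not0[OF M0], of ?E] obtain x y where xy: "?M * x = ?E * y + 1"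
    unfolding gcd by blast
  obtain u where u: "u \<noteq> 0" "k dvd v ^ ?M - [:u:]" using power_geometric_sum_const[OF k(1) v] by blast
  have const: "[:u:] ^ x = [:u ^ x:]" by (induction x) (auto simp: one_pCons)
  have "k dvd v ^ (?M * x) - [:u ^ x:]"
    using dvd_diff_power[OF u(2), of x] unfolding const by (simp only: power_mult)
  moreover have "l dvd z ^ (?M * x) - z"
  proof -
    have "l dvd z * ((z ^ ?E) ^ y - 1 ^ y)"
      by (intro dvd_mult dvd_diff_power unit_mod_exponent l z)
    then show ?thesis unfolding xy by (simp add: right_diff_distrib power_mult[symmetric])
  qed
  ultimately show ?thesis using u(1) by (intro exI[of _ "?M * x"] exI[of _ "u ^ x"]) auto
qed

theorem sl2_word_surjective:
  fixes \<alpha> :: "'a::{field,finite} poly mat2"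
  assumes det: "det2 \<alpha> = 1"
  shows "\<exists>x. \<alpha> = sl2_word x"
proof -
  obtain a0 b0 c0 d0 where \<alpha>: "\<alpha> = Mat2 a0 b0 c0 d0" by (cases \<alpha>)
  define p1 :: "'a poly" where "p1 = (if a0 = 0 then 1 else 0)"
  define a where "a = a0 + p1 * c0"
  have a: "a \<noteq> 0" using det unfolding a_def p1_def \<alpha> by auto
  define b where "b = b0 + p1 * d0"
  define p2 :: "'a poly" where "p2 = (if c0 = 0 then 1 else 0)"
  define l where "l = c0 + p2 * a"
  have l: "l \<noteq> 0" using a unfolding l_def p2_def by auto
  define d where "d = d0 + p2 * b"
  have \<alpha>': "\<alpha> = upper2 (- p1) * lower2 (- p2) * Mat2 a b l d"
    unfolding \<alpha> a_def b_def l_def d_def upper2_def lower2_def by (simp add: algebra_simps)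
  have det': "a * d - b * l = 1"
    using det unfolding \<alpha>' by (simp add: det2_mult)
  have "b * (- l) - 1 = a * (- d)" using det' by (simp add: algebra_simps)
  then have "a dvd b * (- l) - 1" by (simp only: dvd_triv_left)
  then have "unit_mod a b" unfolding unit_mod_def by blast
  then obtain N where N: "\<And>n. n \<ge> N \<Longrightarrow> prime n \<Longrightarrow> \<exists>P. irreducible P \<and> degree P = n \<and> a dvd P - b"
    using irreducible_in_residue_class[OF a] by blast
  obtain n where n: "prime n" "n > N + CARD('a) + degree l" using bigger_prime by blast
  obtain k where k: "irreducible k" "degree k = n" "a dvd k - b" using N[of n] n by auto
  obtain y where y: "k - b = a * y" using k(3) by (auto elim: dvdE)
  define z where "z = d + l * y"
  have kb: "k = b + a * y" using y by (simp add: algebra_simps)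
  have \<gamma>: "Mat2 a b l d = Mat2 a k l z * upper2 (- y)"
    unfolding kb z_def by (simp add: upper2_def algebra_simps)
  have vz: "a * z - k * l = 1" using det' unfolding kb z_def by (simp add: algebra_simps)
  have ka: "\<not> k dvd a"
  proof
    assume "k dvd a"
    then have "k dvd a * z - k * l" by (intro dvd_diff dvd_mult2 dvd_triv_left)
    then show False using k(1) unfolding vz by (simp add: irreducible_def)
  qed
  have "z * a - 1 = l * k" using vz by (simp add: algebra_simps)
  then have "l dvd z * a - 1" by (simp only: dvd_triv_left)
  then have lz: "unit_mod l z" unfolding unit_mod_def by blast
  have kn: "prime (degree k)" "degree k > CARD('a)" "degree l < degree k" using k(2) n by auto
  obtain m u where mu: "u \<noteq> 0" "k dvd a ^ m - [:u:]" "l dvd z ^ m - z"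
    using power_exchange_exponent[OF k(1) kn(1,2) ka l kn(3) lz] by blast
  have "[:u:] * [:inverse u:] = 1" using mu(1) by (simp add: one_pCons)
  from power_exchange_factorization[OF poly_dvd_mult_split vz this mu(2,3)]
  obtain h s t b1 c1 e s' t' b' c' e' p q r i j where w: "Mat2 a k l z =
    upper2 h * transpose2 (swindle s t b1 c1 e) * adjugate2 (swindle s' t' b' c' e') *
    lower2 p * upper2 1 * lower2 q * upper2 r * lower2 j * upper2 i" by blast
  define x where "x i' = [- p1, - p2, h, s, t, b1, c1, e, s', t', b', c', e', p, q, r, j, i - y] ! i'" for i' :: nat
  have "\<alpha> = upper2 (- p1) * lower2 (- p2) * upper2 h * transpose2 (swindle s t b1 c1 e) *
    adjugate2 (swindle s' t' b' c' e') *
    lower2 p * upper2 1 * lower2 q * upper2 r * lower2 j * (upper2 i * upper2 (- y))"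
    unfolding \<alpha>' \<gamma> w by (simp only: mult.assoc)
  then have "\<alpha> = sl2_word x"
    unfolding upper2_add sl2_word_def x_def by simp
  then show ?thesis by blast
qed

definition polynomial_mat2 :: "nat \<Rightarrow> ((nat \<Rightarrow> 'r::comm_ring_1) \<Rightarrow> 'r mat2) \<Rightarrow> bool" where
  "polynomial_mat2 d F \<longleftrightarrow> (\<exists>f g h k. F = (\<lambda>x. Mat2 (f x) (g x) (h x) (k x)) \<and>
     polynomial_function d f \<and> polynomial_function d g \<and>
     polynomial_function d h \<and> polynomial_function d k)"

lemma polynomial_mat2_Mat2:
  assumes "polynomial_function d f" "polynomial_function d g" "polynomial_function d h" "polynomial_function d k"
  shows "polynomial_mat2 d (\<lambda>x. Mat2 (f x) (g x) (h x) (k x))"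
  using assms unfolding polynomial_mat2_def by blast

lemma polynomial_mat2_mult:
  assumes "polynomial_mat2 d F" "polynomial_mat2 d G"
  shows "polynomial_mat2 d (\<lambda>x. F x * G x)"
  using assms unfolding polynomial_mat2_def[of d F] polynomial_mat2_def[of d G]
  by (elim exE conjE, simp only: times_mat2.simps)
     (intro polynomial_mat2_Mat2 polynomial_function_intros)

lemma polynomial_mat2_transpose: "polynomial_mat2 d F \<Longrightarrow> polynomial_mat2 d (\<lambda>x. transpose2 (F x))"
  by (auto simp: polynomial_mat2_def[of d F] intro!: polynomial_mat2_Mat2)

lemma polynomial_mat2_adjugate: "polynomial_mat2 d F \<Longrightarrow> polynomial_mat2 d (\<lambda>x. adjugate2 (F x))"
  by (auto simp: polynomial_mat2_def[of d F] intro!: polynomial_mat2_Mat2 polynomial_function_uminus)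

lemma polynomial_mat2_elementary:
  assumes "polynomial_function d f"
  shows "polynomial_mat2 d (\<lambda>x. upper2 (f x))" "polynomial_mat2 d (\<lambda>x. lower2 (f x))"
  unfolding upper2_def lower2_def by (intro polynomial_mat2_Mat2 polynomial_function_intros assms)+

lemma polynomial_mat2_swindle:
  assumes "polynomial_function d s" "polynomial_function d t" "polynomial_function d b"
    "polynomial_function d c" "polynomial_function d e"
  shows "polynomial_mat2 d (\<lambda>x. swindle (s x) (t x) (b x) (c x) (e x))"
  unfolding swindle_def Let_def by (intro polynomial_mat2_Mat2 polynomial_function_intros assms)

lemma polynomial_mat2_sl2_word: "polynomial_mat2 18 sl2_word"
proof -
  have v: "polynomial_function 18 (\<lambda>x. x i)" if "i < 18" for i :: nat
    using that by (rule polynomial_function.var)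
  show ?thesis unfolding sl2_word_def
    by (intro polynomial_mat2_mult polynomial_mat2_elementary polynomial_mat2_transpose
        polynomial_mat2_adjugate polynomial_mat2_swindle v polynomial_function.const) simp_all
qed

fun mat_of_mat2 :: "'a mat2 \<Rightarrow> 'a mat" where
  "mat_of_mat2 (Mat2 a b c d) =
     mat 2 2 (\<lambda>(i, j). if i = 0 then (if j = 0 then a else b) else (if j = 0 then c else d))"

text \<open>A \<open>2 \<times> 2\<close> matrix consists of four \<open>1 \<times> 1\<close> blocks.\<close>

lemma det_2x2:
  fixes A :: "'r::idom mat"
  assumes "A \<in> carrier_mat 2 2"
  shows "det A = A $$ (0,0) * A $$ (1,1) - A $$ (0,1) * A $$ (1,0)"
proof -
  let ?E = "\<lambda>x. mat 1 1 (\<lambda>_. x) :: 'r mat"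
  let ?a = "?E (A $$ (0,0))" and ?b = "?E (A $$ (0,1))" and ?c = "?E (A $$ (1,0))" and ?d = "?E (A $$ (1,1))"
  have "A = four_block_mat ?a ?b ?c ?d"
    using assms by (intro eq_matI) (auto simp: less_Suc_eq numeral_2_eq_2)
  moreover have "det (four_block_mat ?a ?b ?c ?d) = det (?a * ?d - ?b * ?c)"
    by (rule det_four_block_mat[of _ 1]) (auto simp: scalar_prod_def mult.commute)
  moreover have "det (?a * ?d - ?b * ?c) = (?a * ?d - ?b * ?c) $$ (0, 0)"
    by (rule det_single) auto
  ultimately show ?thesis by (simp add: scalar_prod_def)
qed

lemma special_linear_parametrization_2:
  "special_linear_parametrization 2 18 (\<lambda>x. mat_of_mat2 (sl2_word x :: 'a::{field,finite} poly mat2))"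
proof -
  obtain f g h k where w: "sl2_word = (\<lambda>x. Mat2 (f x) (g x) (h x) (k x) :: 'a poly mat2)"
    and pf: "polynomial_function 18 f" "polynomial_function 18 g"
      "polynomial_function 18 h" "polynomial_function 18 k"
    using polynomial_mat2_sl2_word unfolding polynomial_mat2_def by blast
  have "polynomial_function 18 (\<lambda>x. mat_of_mat2 (sl2_word x :: 'a poly mat2) $$ (i, j))"
    if "i < 2" "j < 2" for i j
    using that pf unfolding w by (cases "i = 0"; cases "j = 0") auto
  moreover have det: "det (mat_of_mat2 M) = det2 M" for M :: "'a poly mat2"
    by (cases M) (simp add: det_2x2)
  have "range (\<lambda>x. mat_of_mat2 (sl2_word x)) = (special_linear 2 :: 'a poly mat set)"
  proof (intro equalityI subsetI)
    fix A assume "A \<in> range (\<lambda>x. mat_of_mat2 (sl2_word x :: 'a poly mat2))"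
    then obtain x where A: "A = mat_of_mat2 (sl2_word x)" by blast
    have "A \<in> carrier_mat 2 2" unfolding A w by simp
    moreover have "det A = 1" unfolding A det by (rule det2_sl2_word)
    ultimately show "A \<in> special_linear 2" by (simp only: special_linear_def mem_Collect_eq)
  next
    fix A assume A: "A \<in> (special_linear 2 :: 'a poly mat set)"
    let ?M = "Mat2 (A $$ (0,0)) (A $$ (0,1)) (A $$ (1,0)) (A $$ (1,1))"
    have c: "A \<in> carrier_mat 2 2" "det A = 1" using A by (auto simp: special_linear_def)
    have "A = mat_of_mat2 ?M"
      using c(1) by (intro eq_matI) (auto simp: less_2_cases_iff)
    moreover have "det2 ?M = 1" using c(2) det_2x2[OF c(1)] by simp
    then obtain x where "?M = sl2_word x" using sl2_word_surjective by blast
    ultimately have Ax: "A = mat_of_mat2 (sl2_word x)" by (simp only:)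
    show "A \<in> range (\<lambda>x. mat_of_mat2 (sl2_word x :: 'a poly mat2))" unfolding Ax by (rule rangeI)
  qed
  ultimately show ?thesis unfolding special_linear_parametrization_def by blast
qed

section \<open>Higher degrees\<close>

text \<open>Treat the irreducible factors of \<open>g\<close> one at a time.  If the translation found for \<open>g'\<close> fails for the new
factor \<open>P\<^sub>0\<close>, then \<open>P\<^sub>0\<close> does not divide \<open>g'\<close>, and adding \<open>g'\<close> to the translation corrects it at \<open>P\<^sub>0\<close> without
changing anything modulo the factors of \<open>g'\<close>.\<close>

lemma exists_translate_avoiding_factors:
  fixes g x a :: "'a::field poly"
  assumes "g \<noteq> 0" "\<And>P. irreducible P \<Longrightarrow> P dvd g \<Longrightarrow> P dvd x \<Longrightarrow> P dvd a \<Longrightarrow> False"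
  shows "\<exists>t. \<forall>P. irreducible P \<longrightarrow> P dvd g \<longrightarrow> \<not> P dvd x + t * a"
  using assms
proof (induction "degree g" arbitrary: g rule: less_induct)
  case less
  show ?case
  proof (cases "degree g = 0")
    case True
    then have "is_unit g" using less.prems(1) by (simp add: is_unit_iff_degree)
    then have "\<not> P dvd g" if "irreducible P" for P
      using that dvd_unit_imp_unit[of P g] irreducible_not_unit by blast
    then show ?thesis by blast
  next
    case False
    then obtain P0 where P0: "irreducible P0" "P0 dvd g" using irreducible_factor_exists by blast
    then obtain g' where g': "g = P0 * g'" by (auto elim: dvdE)
    have nz: "P0 \<noteq> 0" "g' \<noteq> 0" using less.prems(1) g' by auto
    have "degree P0 > 0" using P0(1) nz(1) by (auto simp: irreducible_def is_unit_iff_degree)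
    then have "degree g' < degree g" using nz by (simp add: g' degree_mult_eq)
    moreover have "\<And>P. irreducible P \<Longrightarrow> P dvd g' \<Longrightarrow> P dvd x \<Longrightarrow> P dvd a \<Longrightarrow> False"
      using less.prems(2) unfolding g' by (metis dvd_mult)
    ultimately obtain t where t: "\<And>P. irreducible P \<Longrightarrow> P dvd g' \<Longrightarrow> \<not> P dvd x + t * a"
      using less.hyps[of g'] nz(2) by blast
    have prime: "prime_elem P" if "irreducible P" for P :: "'a poly"
      using that by (rule field_poly_irreducible_imp_prime)
    have split: "P dvd g' \<or> P0 dvd P \<and> P dvd P0" if "irreducible P" "P dvd g" for P
    proof -
      have "P dvd P0 \<or> P dvd g'" using that prime[OF that(1)] g' by (simp add: prime_elem_dvd_mult_iff)
      moreover have "P0 dvd P" if "P dvd P0"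
        using irreducibleD'[OF P0(1) that] irreducible_not_unit[OF \<open>irreducible P\<close>] by blast
      ultimately show ?thesis by blast
    qed
    show ?thesis
    proof (cases "P0 dvd x + t * a")
      case False
      have "\<not> P dvd x + t * a" if P: "irreducible P" "P dvd g" for P
        using split[OF P] t[OF P(1)] False dvd_trans[of P0 P "x + t * a"] by blast
      then show ?thesis by blast
    next
      case True
      then have g'0: "\<not> P0 dvd g'" using t[OF P0(1)] by blast
      have a0: "\<not> P0 dvd a"
      proof
        assume "P0 dvd a"
        then have "P0 dvd x + t * a - t * a" by (intro dvd_diff True dvd_mult)
        then show False using less.prems(2)[OF P0] \<open>P0 dvd a\<close> by simp
      qed
      have 1: "\<not> P0 dvd x + (t + g') * a"
      proof
        assume "P0 dvd x + (t + g') * a"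
        from dvd_diff[OF this True] have "P0 dvd g' * a" by (simp add: algebra_simps)
        then show False using a0 g'0 prime[OF P0(1)] by (simp add: prime_elem_dvd_mult_iff)
      qed
      have "\<not> P dvd x + (t + g') * a" if P: "irreducible P" "P dvd g" for P
      proof
        assume dv: "P dvd x + (t + g') * a"
        show False
        proof (cases "P dvd g'")
          case True
          then have "P dvd x + (t + g') * a - g' * a" by (intro dvd_diff dv dvd_mult2)
          then show False using t[OF P(1) True] by (simp add: algebra_simps)
        next
          case False
          then show False using split[OF P] 1 dv dvd_trans by blast
        qed
      qed
      then show ?thesis by blast
    qed
  qed
qed

lemma poly_bezout_sum:
  fixes r :: "'i \<Rightarrow> 'a::field poly"
  assumes "finite I"
  shows "\<exists>g c. g = (\<Sum>j\<in>I. r j * c j) \<and> (\<forall>j\<in>I. g dvd r j)"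
  using assms
proof (induction I rule: finite_induct)
  case (insert i I)
  then obtain g c where g: "g = (\<Sum>j\<in>I. r j * c j)" "\<forall>j\<in>I. g dvd r j" by blast
  obtain d u v where d: "d = u * r i + v * g" "d dvd r i" "d dvd g" using poly_bezout by metis
  have "d = (\<Sum>j\<in>insert i I. r j * (if j = i then u else v * c j))"
  proof -
    have "(\<Sum>j\<in>I. r j * (if j = i then u else v * c j)) = (\<Sum>j\<in>I. v * (r j * c j))"
      using insert.hyps by (intro sum.cong) auto
    then show ?thesis using insert.hyps d(1) g(1) by (simp add: sum_distrib_left mult.commute)
  qed
  moreover have "\<forall>j\<in>insert i I. d dvd r j" using d g(2) by (auto intro: dvd_trans)
  ultimately show ?case
    by (intro exI[of _ d] exI[of _ "\<lambda>j. if j = i then u else v * c j"] conjI)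
qed simp

text \<open>A stable range property.  First \<open>a\<close> is added to the entry with index \<open>1\<close> if all entries of positive
index vanish; then the gcd \<open>g\<close> of the entries of positive index is nonzero, unless \<open>a = 0\<close> and the row
is already short.  No irreducible factor of \<open>g\<close> divides both \<open>r 0\<close> and \<open>a\<close>, so a suitable
multiple of \<open>a\<close> makes the entry with index \<open>0\<close> coprime to \<open>g\<close>.\<close>

lemma unimodular_row_shorten:
  fixes r b :: "nat \<Rightarrow> 'a::field poly"
  assumes m: "m \<ge> 2" and uni: "(\<Sum>j<m. r j * b j) + a * \<beta> = 1"
  shows "\<exists>t c. (\<forall>j\<ge>2. t j = 0) \<and> (\<Sum>j<m. (r j + a * t j) * c j) = 1"
proof -
  define t1 :: "'a poly" where "t1 = (if \<forall>j\<in>{1..<m}. r j = 0 then 1 else 0)"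
  define r' where "r' j = r j + a * (if j = 1 then t1 else 0)" for j
  have split: "(\<Sum>j<m. f j) = f 0 + (\<Sum>j\<in>{1..<m}. f j)" for f :: "nat \<Rightarrow> 'a poly"
    using m by (simp add: lessThan_atLeast0 sum.atLeast_Suc_lessThan)
  obtain g c where g: "g = (\<Sum>j\<in>{1..<m}. r' j * c j)" "\<forall>j\<in>{1..<m}. g dvd r' j"
    using poly_bezout_sum[of "{1..<m}" r'] by blast
  show ?thesis
  proof (cases "g = 0")
    case True
    then have z: "\<forall>j\<in>{1..<m}. r' j = 0" using g(2) by auto
    have r0: "\<forall>j\<in>{1..<m}. r j = 0"
    proof (rule ccontr)
      assume neg: "\<not> (\<forall>j\<in>{1..<m}. r j = 0)"
      then have "t1 = 0" unfolding t1_def by (rule if_not_P)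
      then have "r j = 0" if "j \<in> {1..<m}" for j using bspec[OF z that] \<open>t1 = 0\<close>
        by (cases "j = 1") (simp_all add: r'_def)
      then show False using neg by blast
    qed
    then have "t1 = 1" by (simp add: t1_def)
    then have "a = 0" using z r0 m by (auto simp: r'_def dest: bspec[of _ _ 1])
    then show ?thesis using uni by (intro exI[of _ "\<lambda>_. 0"] exI[of _ b]) simp
  next
    case False
    have "False" if P: "irreducible P" "P dvd g" "P dvd r 0" "P dvd a" for P
    proof -
      have "P dvd r j" if "j \<in> {1..<m}" for j
      proof -
        have "P dvd r' j" using g(2) that P(2) by (auto intro: dvd_trans)
        then have "P dvd r' j - a * (if j = 1 then t1 else 0)" using P(4) by (intro dvd_diff dvd_mult2)
        then show ?thesis by (simp add: r'_def)
      qed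
      then have "P dvd (\<Sum>j<m. r j * b j) + a * \<beta>"
        using P(3,4) unfolding split by (intro dvd_add dvd_sum dvd_mult2) auto
      then show False using uni P(1) by (simp add: irreducible_def)
    qed
    then obtain t0 where t0: "\<And>P. irreducible P \<Longrightarrow> P dvd g \<Longrightarrow> \<not> P dvd r 0 + t0 * a"
      using exists_translate_avoiding_factors[OF False, of "r 0" a] by blast
    obtain d u v where d: "d = u * (r 0 + t0 * a) + v * g" "d dvd r 0 + t0 * a" "d dvd g"
      using poly_bezout by metis
    have "d \<noteq> 0" using d(3) False by auto
    have "degree d = 0"
    proof (rule ccontr)
      assume "degree d \<noteq> 0"
      then obtain P where "irreducible P" "P dvd d" using irreducible_factor_exists by blast
      then show False using t0[of P] dvd_trans[of P d] d(2,3) by blast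
    qed
    then have "is_unit d" using \<open>d \<noteq> 0\<close> by (simp add: is_unit_iff_degree)
    then obtain e where e: "1 = d * e" by (rule dvdE)
    define t where "t j = (if j = 0 then t0 else if j = 1 then t1 else 0)" for j :: nat
    define c' where "c' j = (if j = 0 then u * e else v * e * c j)" for j
    have "(\<Sum>j<m. (r j + a * t j) * c' j) = (r 0 + a * t0) * (u * e) + (\<Sum>j\<in>{1..<m}. v * e * (r' j * c j))"
      unfolding split
      by (intro arg_cong2[of _ _ _ _ "(+)"] sum.cong) (auto simp: t_def c'_def r'_def)
    also have "\<dots> = (u * (r 0 + t0 * a) + v * g) * e"
      unfolding g(1) by (simp add: sum_distrib_left algebra_simps)
    also have "\<dots> = 1" using e d(1) by simp
    finally show ?thesis by (intro exI[of _ t] exI[of _ c']) (simp add: t_def)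
  qed
qed

definition upper_block :: "nat \<Rightarrow> (nat \<Rightarrow> 'r::comm_ring_1) \<Rightarrow> 'r mat" where
  "upper_block m v = four_block_mat (1\<^sub>m m) (mat m 1 (\<lambda>(i, j). v i)) (0\<^sub>m 1 m) (1\<^sub>m 1)"

definition lower_block :: "nat \<Rightarrow> (nat \<Rightarrow> 'r::comm_ring_1) \<Rightarrow> 'r mat" where
  "lower_block m v = four_block_mat (1\<^sub>m m) (0\<^sub>m m 1) (mat 1 m (\<lambda>(i, j). v j)) (1\<^sub>m 1)"

lemma block_carrier [simp]:
  "upper_block m v \<in> carrier_mat (Suc m) (Suc m)" "lower_block m v \<in> carrier_mat (Suc m) (Suc m)"
  by (auto simp: upper_block_def lower_block_def)

lemma det_block [simp]:
  fixes v :: "nat \<Rightarrow> 'r::idom"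
  shows "det (upper_block m v) = 1" "det (lower_block m v) = 1"
  unfolding upper_block_def lower_block_def
  by (subst det_four_block_mat_lower_left_zero[of _ m _ 1], auto)
     (subst det_four_block_mat_upper_right_zero[of _ m _ 1], auto)

definition extend_mat :: "nat \<Rightarrow> 'r::comm_ring_1 mat \<Rightarrow> 'r mat" where
  "extend_mat m B = four_block_mat B (0\<^sub>m m 1) (0\<^sub>m 1 m) (1\<^sub>m 1)"

lemma extend_mat_carrier: "B \<in> carrier_mat m m \<Longrightarrow> extend_mat m B \<in> carrier_mat (Suc m) (Suc m)"
  by (auto simp: extend_mat_def)

lemma det_extend_mat:
  fixes B :: "'r::idom mat"
  shows "B \<in> carrier_mat m m \<Longrightarrow> det (extend_mat m B) = det B"
  unfolding extend_mat_def by (subst det_four_block_mat_upper_right_zero[of _ m _ 1]) auto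

lemma mult_lower_block_index:
  assumes "A \<in> carrier_mat n (Suc m)" "i < n" "j < Suc m"
  shows "(A * lower_block m v) $$ (i, j) =
    (if j < m then A $$ (i, j) + A $$ (i, m) * v j else A $$ (i, m))"
proof -
  have "(A * lower_block m v) $$ (i, j) = (\<Sum>k<Suc m. A $$ (i, k) * lower_block m v $$ (k, j))"
    using assms(2,3) carrier_matD[OF assms(1)] carrier_matD[OF block_carrier(2)[of m v]]
    by (simp add: scalar_prod_def lessThan_atLeast0)
  also have "\<dots> = (\<Sum>k<m. A $$ (i, k) * (if k = j then 1 else 0)) + A $$ (i, m) * (if j < m then v j else 1)"
    using assms(3) by (simp add: lower_block_def)
  also have "(\<Sum>k<m. A $$ (i, k) * (if k = j then 1 else 0)) = (if j < m then A $$ (i, j) else 0)"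
    by (simp add: sum.delta if_distrib cong: if_cong)
  finally show ?thesis by simp
qed

lemma mult_upper_block_index:
  assumes "A \<in> carrier_mat n (Suc m)" "i < n" "j < Suc m"
  shows "(A * upper_block m v) $$ (i, j) =
    (if j < m then A $$ (i, j) else (\<Sum>k<m. A $$ (i, k) * v k) + A $$ (i, m))"
proof -
  have "(A * upper_block m v) $$ (i, j) = (\<Sum>k<Suc m. A $$ (i, k) * upper_block m v $$ (k, j))"
    using assms(2,3) carrier_matD[OF assms(1)] carrier_matD[OF block_carrier(1)[of m v]]
    by (simp add: scalar_prod_def lessThan_atLeast0)
  also have "\<dots> = (\<Sum>k<m. A $$ (i, k) * (if j < m then if k = j then 1 else 0 else v k)) +
      A $$ (i, m) * (if j < m then 0 else 1)"
    using assms(3) by (simp add: upper_block_def)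
  also have "\<dots> = (if j < m then A $$ (i, j) else (\<Sum>k<m. A $$ (i, k) * v k) + A $$ (i, m))"
  proof (cases "j < m")
    case True
    have "(\<Sum>k<m. A $$ (i, k) * (if k = j then 1 else 0)) = (\<Sum>k<m. if k = j then A $$ (i, k) else 0)"
      by (intro sum.cong) auto
    then show ?thesis using True by (simp add: sum.delta)
  qed simp
  finally show ?thesis .
qed

lemma block_inverse:
  "lower_block m (\<lambda>j. - v j) * lower_block m v = 1\<^sub>m (Suc m)"
  "upper_block m (\<lambda>j. - v j) * upper_block m v = 1\<^sub>m (Suc m)"
  "lower_block m v * lower_block m (\<lambda>j. - v j) = 1\<^sub>m (Suc m)"
  "upper_block m v * upper_block m (\<lambda>j. - v j) = 1\<^sub>m (Suc m)"
proof -
  have L: "lower_block m v * lower_block m u = 1\<^sub>m (Suc m)" if "\<And>j. v j + u j = 0" for u v :: "nat \<Rightarrow> 'a"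
    using that by (intro eq_matI)
      (auto simp: mult_lower_block_index[OF block_carrier(2)], auto simp: lower_block_def)
  have T: "upper_block m v = transpose_mat (lower_block m v)" for v :: "nat \<Rightarrow> 'a"
    by (intro eq_matI) (auto simp: upper_block_def lower_block_def)
  have U: "upper_block m v * upper_block m u = 1\<^sub>m (Suc m)" if "\<And>j. v j + u j = 0" for u v :: "nat \<Rightarrow> 'a"
    unfolding T transpose_mult[OF block_carrier(2) block_carrier(2), symmetric]
    using L[of u v] that by (simp add: add.commute transpose_one)
  show "lower_block m (\<lambda>j. - v j) * lower_block m v = 1\<^sub>m (Suc m)"
    "lower_block m v * lower_block m (\<lambda>j. - v j) = 1\<^sub>m (Suc m)" by (rule L; simp)+
  show "upper_block m (\<lambda>j. - v j) * upper_block m v = 1\<^sub>m (Suc m)"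
    "upper_block m v * upper_block m (\<lambda>j. - v j) = 1\<^sub>m (Suc m)" by (rule U; simp)+
qed

text \<open>In the last row, make the first \<open>m\<close> entries unimodular, use them to turn the last entry into \<open>1\<close>, and use
this \<open>1\<close> to clear the others.  What remains is block upper triangular.\<close>

lemma special_linear_step:
  fixes A :: "'a::field poly mat"
  assumes m: "m \<ge> 2" and A: "A \<in> special_linear (Suc m)"
  shows "\<exists>v B w c t. B \<in> special_linear m \<and> (\<forall>j\<ge>2. t j = 0) \<and>
    A = upper_block m v * extend_mat m B * lower_block m w * upper_block m c * lower_block m t"
proof -
  have Ac: "A \<in> carrier_mat (Suc m) (Suc m)" and det: "det A = 1" using A by (auto simp: special_linear_def)
  let ?B = "adj_mat A"
  have Bc: "?B \<in> carrier_mat (Suc m) (Suc m)" "A * ?B = 1\<^sub>m (Suc m)"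
    using adj_mat(1,2)[OF Ac] det by (auto intro!: eq_matI)
  have "(A * ?B) $$ (m, m) = (\<Sum>j<Suc m. A $$ (m, j) * ?B $$ (j, m))"
    using Ac Bc(1) by (auto simp: scalar_prod_def lessThan_atLeast0)
  then have "(\<Sum>j<m. A $$ (m, j) * ?B $$ (j, m)) + A $$ (m, m) * ?B $$ (m, m) = 1"
    unfolding Bc(2) by simp
  from unimodular_row_shorten[OF m this] obtain t c where t: "\<forall>j\<ge>2. t j = 0"
    and c: "(\<Sum>j<m. (A $$ (m, j) + A $$ (m, m) * t j) * c j) = 1" by blast
  define a where "a = A $$ (m, m)"
  define r where "r j = A $$ (m, j) + a * t j" for j
  define c' where "c' j = (1 - a) * c j" for j
  define A1 where "A1 = A * lower_block m t"
  define A2 where "A2 = A1 * upper_block m c'"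
  define A3 where "A3 = A2 * lower_block m (\<lambda>j. - r j)"
  have carr: "A1 \<in> carrier_mat (Suc m) (Suc m)" "A2 \<in> carrier_mat (Suc m) (Suc m)" "A3 \<in> carrier_mat (Suc m) (Suc m)"
    unfolding A3_def A2_def A1_def by (intro mult_carrier_mat[of _ "Suc m" "Suc m"] Ac block_carrier)+
  have r1: "A1 $$ (m, j) = (if j < m then r j else a)" if "j < Suc m" for j
    unfolding A1_def using that by (subst mult_lower_block_index[OF Ac]) (auto simp: r_def a_def)
  have r2: "A2 $$ (m, j) = (if j < m then r j else 1)" if "j < Suc m" for j
  proof -
    have "(\<Sum>k<m. r k * c' k) = (1 - a) * (\<Sum>j<m. r j * c j)"
      by (simp add: c'_def sum_distrib_left mult.left_commute)
    also have "\<dots> = 1 - a" using c by (simp add: r_def a_def)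
    finally have "(\<Sum>k<m. A1 $$ (m, k) * c' k) = 1 - a" by (simp add: r1)
    then show ?thesis
      unfolding A2_def using that by (subst mult_upper_block_index[OF carr(1)]) (auto simp: r1)
  qed
  have r3: "A3 $$ (m, j) = (if j < m then 0 else 1)" if "j < Suc m" for j
    unfolding A3_def using that by (subst mult_lower_block_index[OF carr(2)]) (auto simp: r2)
  define B where "B = mat m m (\<lambda>(i, j). A3 $$ (i, j))"
  define v where "v i = A3 $$ (i, m)" for i
  have A3: "A3 = upper_block m v * extend_mat m B"
  proof -
    have "upper_block m v * extend_mat m B = four_block_mat B (mat m 1 (\<lambda>(i, j). v i)) (0\<^sub>m 1 m) (1\<^sub>m 1)"
      unfolding upper_block_def extend_mat_def B_def
      by (subst mult_four_block_mat[of _ m m _ 1 _ 1 _ _ m _ 1]) auto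
    also have "\<dots> = A3"
      using carr(3) r3 by (intro eq_matI) (auto simp: B_def v_def less_Suc_eq)
    finally show ?thesis ..
  qed
  have "det A1 = 1" unfolding A1_def using det_mult[OF Ac block_carrier(2)] det by simp
  then have "det A2 = 1" unfolding A2_def using det_mult[OF carr(1) block_carrier(1)] by simp
  then have "det A3 = 1" unfolding A3_def using det_mult[OF carr(2) block_carrier(2)] by simp
  then have "det B = 1"
    unfolding A3 using extend_mat_carrier[of B m] det_extend_mat[of B m]
    by (simp add: det_mult[of _ "Suc m"] B_def)
  then have "B \<in> special_linear m" by (simp add: special_linear_def B_def)
  moreover have "A = A3 * lower_block m r * upper_block m (\<lambda>j. - c' j) * lower_block m (\<lambda>j. - t j)"
  proof -
    let ?n = "Suc m"
    have "A3 * lower_block m r = A2"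
      unfolding A3_def using carr(2) by (simp add: assoc_mult_mat[of _ ?n ?n _ ?n _ ?n] block_inverse)
    moreover have "A2 * upper_block m (\<lambda>j. - c' j) = A1"
      unfolding A2_def using carr(1) by (simp add: assoc_mult_mat[of _ ?n ?n _ ?n _ ?n] block_inverse)
    moreover have "A1 * lower_block m (\<lambda>j. - t j) = A"
      unfolding A1_def using Ac by (simp add: assoc_mult_mat[of _ ?n ?n _ ?n _ ?n] block_inverse)
    ultimately show ?thesis by simp
  qed
  ultimately show ?thesis unfolding A3 using t
    by (intro exI[of _ v] exI[of _ B] exI[of _ r] exI[of _ "\<lambda>j. - c' j"] exI[of _ "\<lambda>j. - t j"]) auto
qed

definition polynomial_matrix :: "nat \<Rightarrow> nat \<Rightarrow> nat \<Rightarrow> ((nat \<Rightarrow> 'r::comm_ring_1) \<Rightarrow> 'r mat) \<Rightarrow> bool" where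
  "polynomial_matrix d nr nc F \<longleftrightarrow> (\<forall>x. F x \<in> carrier_mat nr nc) \<and>
     (\<forall>i<nr. \<forall>j<nc. polynomial_function d (\<lambda>x. F x $$ (i, j)))"

lemma polynomial_matrix_mult:
  assumes "polynomial_matrix d nr n F" "polynomial_matrix d n nc G"
  shows "polynomial_matrix d nr nc (\<lambda>x. F x * G x)"
  unfolding polynomial_matrix_def
proof (intro conjI allI impI)
  have c: "F x \<in> carrier_mat nr n" "G x \<in> carrier_mat n nc" for x
    using assms by (auto simp: polynomial_matrix_def)
  show "F x * G x \<in> carrier_mat nr nc" for x using c by (rule mult_carrier_mat)
  fix i j assume ij: "i < nr" "j < nc"
  have "(F x * G x) $$ (i, j) = (\<Sum>k\<in>{0..<n}. F x $$ (i, k) * G x $$ (k, j))" for x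
    using c[of x] ij by (auto simp: scalar_prod_def)
  then show "polynomial_function d (\<lambda>x. (F x * G x) $$ (i, j))"
    using assms ij unfolding polynomial_matrix_def
    by (auto intro!: polynomial_function_sum polynomial_function.mult)
qed

lemma polynomial_matrix_four_block:
  assumes F: "polynomial_matrix d a c F" "polynomial_matrix d a e G"
    "polynomial_matrix d b c H" "polynomial_matrix d b e K"
  shows "polynomial_matrix d (a + b) (c + e) (\<lambda>x. four_block_mat (F x) (G x) (H x) (K x))"
  unfolding polynomial_matrix_def
proof (intro conjI allI impI)
  have dims: "F x \<in> carrier_mat a c" "K x \<in> carrier_mat b e" for x
    using F by (auto simp: polynomial_matrix_def)
  then show "four_block_mat (F x) (G x) (H x) (K x) \<in> carrier_mat (a + b) (c + e)" for x
    by (rule four_block_carrier_mat)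
  fix i j assume ij: "i < a + b" "j < c + e"
  have d: "dim_row (F x) = a" "dim_col (F x) = c" "dim_row (K x) = b" "dim_col (K x) = e" for x
    using dims[of x] by auto
  show "polynomial_function d (\<lambda>x. four_block_mat (F x) (G x) (H x) (K x) $$ (i, j))"
    using F ij unfolding polynomial_matrix_def
    by (cases "i < a"; cases "j < c") (simp_all add: d)
qed

lemma polynomial_matrix_const:
  "A \<in> carrier_mat nr nc \<Longrightarrow> polynomial_matrix d nr nc (\<lambda>_. A)"
  by (auto simp: polynomial_matrix_def intro: polynomial_function.const)

lemma polynomial_matrix_blocks:
  assumes "\<And>i. i < m \<Longrightarrow> polynomial_function d (\<lambda>x. v x i)"
  shows "polynomial_matrix d (Suc m) (Suc m) (\<lambda>x. upper_block m (v x))"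
    and "polynomial_matrix d (Suc m) (Suc m) (\<lambda>x. lower_block m (v x))"
proof -
  have "polynomial_matrix d m 1 (\<lambda>x. mat m 1 (\<lambda>(i, j). v x i))"
    "polynomial_matrix d 1 m (\<lambda>x. mat 1 m (\<lambda>(i, j). v x j))"
    using assms by (auto simp: polynomial_matrix_def)
  then have "polynomial_matrix d (m + 1) (m + 1) (\<lambda>x. upper_block m (v x))"
    "polynomial_matrix d (m + 1) (m + 1) (\<lambda>x. lower_block m (v x))"
    unfolding upper_block_def lower_block_def
    by (intro polynomial_matrix_four_block polynomial_matrix_const; simp)+
  then show "polynomial_matrix d (Suc m) (Suc m) (\<lambda>x. upper_block m (v x))"
    "polynomial_matrix d (Suc m) (Suc m) (\<lambda>x. lower_block m (v x))" by simp_all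
qed

text \<open>The first three blocks of \<open>m\<close> parameters are the column \<open>v\<close>, the row \<open>w\<close> and the column \<open>c\<close> of the
reduction step, the next two are the nonzero entries of \<open>t\<close>, and the remaining ones belong to the smaller
matrix.\<close>

lemma special_linear_parametrization_Suc:
  fixes F :: "(nat \<Rightarrow> 'a::field poly) \<Rightarrow> 'a poly mat"
  assumes m: "m \<ge> 2" and F: "special_linear_parametrization m d F"
  shows "\<exists>G :: (nat \<Rightarrow> 'a poly) \<Rightarrow> 'a poly mat. special_linear_parametrization (Suc m) (3 * m + 2 + d) G"
proof -
  let ?d = "3 * m + 2 + d"
  define G where "G x = upper_block m x * extend_mat m (F (\<lambda>i. x (3 * m + 2 + i))) *
    lower_block m (\<lambda>j. x (m + j)) * upper_block m (\<lambda>j. x (2 * m + j)) *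
    lower_block m (\<lambda>j. if j < 2 then x (3 * m + j) else 0)" for x :: "nat \<Rightarrow> 'a poly"
  have Fsl: "F x \<in> carrier_mat m m" "det (F x) = 1" for x
    using F by (auto simp: special_linear_parametrization_def special_linear_def)
  have "polynomial_matrix d m m F"
    using F Fsl by (auto simp: polynomial_matrix_def special_linear_parametrization_def)
  then have "polynomial_matrix ?d m m (\<lambda>x. F (\<lambda>i. x (3 * m + 2 + i)))"
    unfolding polynomial_matrix_def
  proof (intro conjI allI impI; elim conjE)
    fix i j assume "\<forall>i<m. \<forall>j<m. polynomial_function d (\<lambda>x. F x $$ (i, j))" "i < m" "j < m"
    then have "polynomial_function d (\<lambda>x. F x $$ (i, j))" by blast
    from polynomial_function_shift[OF this, of "3 * m + 2"]
    show "polynomial_function ?d (\<lambda>x. F (\<lambda>i. x (3 * m + 2 + i)) $$ (i, j))" .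
  qed blast
  then have "polynomial_matrix ?d (m + 1) (m + 1) (\<lambda>x. extend_mat m (F (\<lambda>i. x (3 * m + 2 + i))))"
    unfolding extend_mat_def by (intro polynomial_matrix_four_block polynomial_matrix_const) simp_all
  then have E: "polynomial_matrix ?d (Suc m) (Suc m) (\<lambda>x. extend_mat m (F (\<lambda>i. x (3 * m + 2 + i))))"
    by simp
  have "polynomial_matrix ?d (Suc m) (Suc m) (\<lambda>x. upper_block m x)"
    "polynomial_matrix ?d (Suc m) (Suc m) (\<lambda>x. lower_block m (\<lambda>j. x (m + j)))"
    "polynomial_matrix ?d (Suc m) (Suc m) (\<lambda>x. upper_block m (\<lambda>j. x (2 * m + j)))"
    by (rule polynomial_matrix_blocks, rule polynomial_function.var, simp)+
  moreover have "polynomial_function ?d (\<lambda>x. if j < 2 then x (3 * m + j) else 0)" for j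
    by (cases "j < 2") (auto intro: polynomial_function.var polynomial_function.const)
  then have "polynomial_matrix ?d (Suc m) (Suc m) (\<lambda>x. lower_block m (\<lambda>j. if j < 2 then x (3 * m + j) else 0))"
    by (rule polynomial_matrix_blocks(2))
  ultimately have "polynomial_matrix ?d (Suc m) (Suc m) G"
    unfolding G_def by (intro polynomial_matrix_mult[of _ "Suc m" "Suc m"] E)
  moreover have "range G = special_linear (Suc m)"
  proof (intro equalityI subsetI)
    fix A assume "A \<in> range G"
    then obtain x where A: "A = G x" by blast
    let ?n = "Suc m"
    have E: "extend_mat m (F (\<lambda>i. x (3 * m + 2 + i))) \<in> carrier_mat ?n ?n"
      by (intro extend_mat_carrier Fsl)
    have "A \<in> carrier_mat ?n ?n" unfolding A G_def
      by (intro mult_carrier_mat[of _ ?n ?n] E block_carrier)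
    moreover have "det A = 1" unfolding A G_def
      using E by (simp add: det_mult[of _ ?n] mult_carrier_mat[of _ ?n ?n] det_extend_mat Fsl)
    ultimately show "A \<in> special_linear ?n" by (simp add: special_linear_def)
  next
    fix A :: "'a poly mat" assume "A \<in> special_linear (Suc m)"
    from special_linear_step[OF m this] obtain v B w c t
      where B: "B \<in> special_linear m" and t: "\<forall>j\<ge>2. t j = 0"
        and A: "A = upper_block m v * extend_mat m B * lower_block m w * upper_block m c * lower_block m t"
      by blast
    have "B \<in> range F" using B F by (simp only: special_linear_parametrization_def)
    then obtain y where y: "B = F y" by blast
    define x where "x i = (if i < m then v i else if i < 2 * m then w (i - m)
      else if i < 3 * m then c (i - 2 * m) else if i < 3 * m + 2 then t (i - 3 * m)
      else y (i - (3 * m + 2)))" for i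
    have block_cong: "upper_block m f = upper_block m g" "lower_block m f = lower_block m g"
      if "\<And>j. j < m \<Longrightarrow> f j = g j" for f g :: "nat \<Rightarrow> 'a poly"
      using that unfolding upper_block_def lower_block_def
      by (auto intro!: arg_cong[where f = "\<lambda>M. four_block_mat _ M _ _"] arg_cong[where f = "\<lambda>M. four_block_mat _ _ M _"])
    have "upper_block m v = upper_block m x" by (rule block_cong) (simp add: x_def)
    moreover have "F y = F (\<lambda>i. x (3 * m + 2 + i))" by (simp add: x_def)
    moreover have "lower_block m w = lower_block m (\<lambda>j. x (m + j))" by (rule block_cong) (simp add: x_def)
    moreover have "upper_block m c = upper_block m (\<lambda>j. x (2 * m + j))" by (rule block_cong) (simp add: x_def)
    moreover have "lower_block m t = lower_block m (\<lambda>j. if j < 2 then x (3 * m + j) else 0)"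
      using t by (intro block_cong) (auto simp: x_def)
    ultimately have "A = G x" unfolding A G_def y by simp
    then show "A \<in> range G" by blast
  qed
  ultimately have "special_linear_parametrization (Suc m) ?d G"
    by (auto simp: special_linear_parametrization_def polynomial_matrix_def)
  then show ?thesis by blast
qed

lemma special_linear_parametrization_exists:
  assumes "n \<ge> 2"
  shows "\<exists>F :: (nat \<Rightarrow> 'a::{field,finite} poly) \<Rightarrow> 'a poly mat.
    special_linear_parametrization n (11 + (n * (3 * n + 1)) div 2) F"
  using assms
proof (induction n rule: dec_induct)
  case base
  then show ?case using special_linear_parametrization_2 by (auto intro: exI)
next
  case (step m)
  have "Suc m * (3 * Suc m + 1) = m * (3 * m + 1) + 2 * (3 * m + 2)" by (simp add: algebra_simps)
  then have "11 + (Suc m * (3 * Suc m + 1)) div 2 = 3 * m + 2 + (11 + (m * (3 * m + 1)) div 2)"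
    by simp
  then show ?case using step special_linear_parametrization_Suc by metis
qed

theorem corollary1p7:
  fixes p k q n :: nat
  assumes "prime p" and "odd p" and "k \<ge> 1" and "q = p ^ k"
    and "CARD('F) = q"
    and "n \<ge> 2"
  shows "polynomial_family (n\<^sup>2) (45 + (n * (3 * n + 1)) div 2)
           (mat_entries n ` (special_linear n :: ('F::{field,finite}) poly mat set))"
proof -
  obtain F :: "(nat \<Rightarrow> 'F poly) \<Rightarrow> 'F poly mat"
    where "special_linear_parametrization n (11 + (n * (3 * n + 1)) div 2) F"
    using special_linear_parametrization_exists[OF \<open>n \<ge> 2\<close>] by blast
  then show ?thesis by (rule polynomial_family_special_linear) simp_all
qed

end
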